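(* Let $n\ge 2$, $G=SL(n,\mathbb{C})$, and let $P_{\alpha_{n-1}}$ be the minimal parabolic subgroup of $G$ associated with the last simple root $\alpha_{n-1}$. Then there is no nonconstant morphism from $\mathbb{P}^3$ to $G/P_{\alpha_{n-1}}$.
   Context: Varieties are over $\mathbb{C}$, and morphism means morphism of algebraic varieties. $B\subset G$ is the Borel subgroup of upper triangular matrices and $T$ the maximal torus of diagonal matrices; $\epsilon_i$ is the character of $T$ sending $\mathrm{diag}(t_1,\dots,t_n)$ to $t_i$; the simple roots are $\alpha_i=\epsilon_i-\epsilon_{i+1}$ for $1\le i\le n-1$; the Weyl group is $S_n$, with $s_{\alpha_i}$ the transposition of $i$ and $i+1$. The minimal parabolic subgroup associated with $\alpha_i$ is $P_{\alpha_i}=B\cup Bs_{\alpha_i}B$. Equivalently, $G/P_{\alpha_i}$ is the variety of partial flags in $\mathbb{C}^n$ consisting of nested subspaces of every dimension in $\{1,\dots,n-1\}\setminus\{i\}$. *)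

theory Defs
  imports
    "HOL-Analysis.Abstract_Topology_2"
    "HOL-Algebra.Left_Coset"
    "Jordan_Normal_Form.Determinant"
begin

section \<open>Polynomial functions\<close>

text \<open>\<open>poly_funs C\<close> is the algebra of polynomials in the coordinate functions \<open>C\<close>, and
  \<open>hom_poly_funs C d\<close> its homogeneous part of degree \<open>d\<close>. Since the ground field is infinite,
  polynomials are identified with the functions they define.\<close>

inductive_set poly_funs :: "('a \<Rightarrow> complex) set \<Rightarrow> ('a \<Rightarrow> complex) set"
  for C :: "('a \<Rightarrow> complex) set" where
  const: "(\<lambda>_. c) \<in> poly_funs C"
| coord: "f \<in> C \<Longrightarrow> f \<in> poly_funs C"
| add: "f \<in> poly_funs C \<Longrightarrow> g \<in> poly_funs C \<Longrightarrow> (\<lambda>x. f x + g x) \<in> poly_funs C"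
| mult: "f \<in> poly_funs C \<Longrightarrow> g \<in> poly_funs C \<Longrightarrow> (\<lambda>x. f x * g x) \<in> poly_funs C"

inductive_set hom_poly_rel :: "('a \<Rightarrow> complex) set \<Rightarrow> (nat \<times> ('a \<Rightarrow> complex)) set"
  for C :: "('a \<Rightarrow> complex) set" where
  const: "(0, \<lambda>_. c) \<in> hom_poly_rel C"
| coord: "f \<in> C \<Longrightarrow> (1, f) \<in> hom_poly_rel C"
| add: "(d, f) \<in> hom_poly_rel C \<Longrightarrow> (d, g) \<in> hom_poly_rel C \<Longrightarrow>
    (d, \<lambda>x. f x + g x) \<in> hom_poly_rel C"
| mult: "(d, f) \<in> hom_poly_rel C \<Longrightarrow> (e, g) \<in> hom_poly_rel C \<Longrightarrow>
    (d + e, \<lambda>x. f x * g x) \<in> hom_poly_rel C"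

definition hom_poly_funs :: "('a \<Rightarrow> complex) set \<Rightarrow> nat \<Rightarrow> ('a \<Rightarrow> complex) set" where
  "hom_poly_funs C d = {f. (d, f) \<in> hom_poly_rel C}"

definition vec_coords :: "nat \<Rightarrow> (complex vec \<Rightarrow> complex) set" where
  "vec_coords m = {(\<lambda>v. v $ i) | i. i < m}"

definition mat_coords :: "nat \<Rightarrow> (complex mat \<Rightarrow> complex) set" where
  "mat_coords n = {(\<lambda>A. A $$ (i, j)) | i j. i < n \<and> j < n}"


section \<open>Varieties as spaces with functions\<close>

text \<open>A variety is given by its Zariski topology together with its sheaf of regular functions.
  For an open set \<open>U\<close>, \<open>Regular X U\<close> is the set of functions whose restriction to \<open>U\<close> is regular;
  their values outside \<open>U\<close> are irrelevant.\<close>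

record 'a fun_space =
  Zariski :: "'a topology"
  Regular :: "'a set \<Rightarrow> ('a \<Rightarrow> complex) set"

abbreviation points :: "('a, 'm) fun_space_scheme \<Rightarrow> 'a set" where
  "points X \<equiv> topspace (Zariski X)"

definition variety_morphism :: "'a fun_space \<Rightarrow> 'b fun_space \<Rightarrow> ('a \<Rightarrow> 'b) \<Rightarrow> bool" where
  "variety_morphism X Y \<phi> \<longleftrightarrow>
     continuous_map (Zariski X) (Zariski Y) \<phi> \<and>
     (\<forall>V g. openin (Zariski Y) V \<longrightarrow> g \<in> Regular Y V \<longrightarrow>
        g \<circ> \<phi> \<in> Regular X {x \<in> points X. \<phi> x \<in> V})"


subsection \<open>Closed subvarieties of affine space\<close>

text \<open>The open sets are the unions of the sets where a polynomial does not vanish, so the closed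
  sets are the common zero loci in \<open>X\<close> of arbitrary sets of polynomials.\<close>

definition affine_open_base :: "('a \<Rightarrow> complex) set \<Rightarrow> 'a set \<Rightarrow> 'a set \<Rightarrow> bool" where
  "affine_open_base C X D \<longleftrightarrow> (\<exists>f \<in> poly_funs C. D = {x \<in> X. f x \<noteq> 0})"

definition affine_zariski :: "('a \<Rightarrow> complex) set \<Rightarrow> 'a set \<Rightarrow> 'a topology" where
  "affine_zariski C X = topology (arbitrary union_of affine_open_base C X)"

definition affine_regular :: "('a \<Rightarrow> complex) set \<Rightarrow> 'a set \<Rightarrow> 'a set \<Rightarrow> ('a \<Rightarrow> complex) set" where
  "affine_regular C X U = {h. \<forall>x \<in> U. \<exists>V. openin (affine_zariski C X) V \<and> x \<in> V \<and> V \<subseteq> U \<and>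
     (\<exists>f \<in> poly_funs C. \<exists>g \<in> poly_funs C. \<forall>y \<in> V. g y \<noteq> 0 \<and> h y = f y / g y)}"

definition affine_variety :: "('a \<Rightarrow> complex) set \<Rightarrow> 'a set \<Rightarrow> 'a fun_space" where
  "affine_variety C X = \<lparr>Zariski = affine_zariski C X, Regular = affine_regular C X\<rparr>"

lemma openin_affine_zariski:
  "openin (affine_zariski C X) = arbitrary union_of affine_open_base C X"
proof -
  have "istopology (arbitrary union_of affine_open_base C X)"
  proof (rule istopology_base)
    fix S T assume "affine_open_base C X S" "affine_open_base C X T"
    then obtain f g where fg: "f \<in> poly_funs C" "g \<in> poly_funs C"
      and "S = {x \<in> X. f x \<noteq> 0}" "T = {x \<in> X. g x \<noteq> 0}"
      by (auto simp: affine_open_base_def)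
    then have "S \<inter> T = {x \<in> X. f x * g x \<noteq> 0}" by auto
    then show "affine_open_base C X (S \<inter> T)"
      unfolding affine_open_base_def by (rule bexI[OF _ poly_funs.mult[OF fg]])
  qed
  then show ?thesis unfolding affine_zariski_def by (rule topology_inverse')
qed

lemma topspace_affine_zariski [simp]: "topspace (affine_zariski C X) = X"
proof
  show "topspace (affine_zariski C X) \<subseteq> X"
    unfolding topspace_def openin_affine_zariski
    by (auto simp: union_of_def arbitrary_def affine_open_base_def)
  have "affine_open_base C X X"
    unfolding affine_open_base_def
    by (rule bexI[OF _ poly_funs.const[of 1]]) simp
  then have "openin (affine_zariski C X) X"
    unfolding openin_affine_zariski by (rule arbitrary_union_of_inc)
  then show "X \<subseteq> topspace (affine_zariski C X)" by (rule openin_subset)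
qed


subsection \<open>Projective space\<close>

text \<open>A point of projective \<open>m\<close>-space is a line in \<open>\<complex>\<^sup>m\<^sup>+\<^sup>1\<close> with the origin removed.\<close>

definition proj_point :: "complex vec \<Rightarrow> complex vec set" where
  "proj_point v = {c \<cdot>\<^sub>v v | c. c \<noteq> 0}"

definition proj_points :: "nat \<Rightarrow> complex vec set set" where
  "proj_points m = proj_point ` (carrier_vec (m + 1) - {0\<^sub>v (m + 1)})"

definition proj_open_base :: "nat \<Rightarrow> complex vec set set \<Rightarrow> bool" where
  "proj_open_base m D \<longleftrightarrow>
     (\<exists>d. \<exists>f \<in> hom_poly_funs (vec_coords (m + 1)) d. D = {L \<in> proj_points m. \<forall>v \<in> L. f v \<noteq> 0})"

definition proj_zariski :: "nat \<Rightarrow> complex vec set topology" where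
  "proj_zariski m = topology (arbitrary union_of proj_open_base m)"

definition proj_regular :: "nat \<Rightarrow> complex vec set set \<Rightarrow> (complex vec set \<Rightarrow> complex) set" where
  "proj_regular m U = {h. \<forall>L \<in> U. \<exists>V. openin (proj_zariski m) V \<and> L \<in> V \<and> V \<subseteq> U \<and>
     (\<exists>d. \<exists>f \<in> hom_poly_funs (vec_coords (m + 1)) d. \<exists>g \<in> hom_poly_funs (vec_coords (m + 1)) d.
        \<forall>M \<in> V. \<forall>v \<in> M. g v \<noteq> 0 \<and> h M = f v / g v)}"

definition proj_space :: "nat \<Rightarrow> complex vec set fun_space" where
  "proj_space m = \<lparr>Zariski = proj_zariski m, Regular = proj_regular m\<rparr>"

lemma openin_proj_zariski: "openin (proj_zariski m) = arbitrary union_of proj_open_base m"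
proof -
  have "istopology (arbitrary union_of proj_open_base m)"
  proof (rule istopology_base)
    fix S T assume "proj_open_base m S" "proj_open_base m T"
    then obtain d e f g where fg: "(d, f) \<in> hom_poly_rel (vec_coords (m + 1))"
        "(e, g) \<in> hom_poly_rel (vec_coords (m + 1))"
      and "S = {L \<in> proj_points m. \<forall>v \<in> L. f v \<noteq> 0}"
        "T = {L \<in> proj_points m. \<forall>v \<in> L. g v \<noteq> 0}"
      by (auto simp: proj_open_base_def hom_poly_funs_def)
    then have "S \<inter> T = {L \<in> proj_points m. \<forall>v \<in> L. f v * g v \<noteq> 0}" by auto
    moreover have "(\<lambda>v. f v * g v) \<in> hom_poly_funs (vec_coords (m + 1)) (d + e)"
      unfolding hom_poly_funs_def using hom_poly_rel.mult[OF fg] by simp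
    ultimately show "proj_open_base m (S \<inter> T)"
      unfolding proj_open_base_def by (intro exI[of _ "d + e"] bexI[of _ "\<lambda>v. f v * g v"])
  qed
  then show ?thesis unfolding proj_zariski_def by (rule topology_inverse')
qed

lemma topspace_proj_zariski [simp]: "topspace (proj_zariski m) = proj_points m"
proof
  show "topspace (proj_zariski m) \<subseteq> proj_points m"
    unfolding topspace_def openin_proj_zariski
    by (auto simp: union_of_def arbitrary_def proj_open_base_def)
  have "proj_open_base m (proj_points m)"
    unfolding proj_open_base_def hom_poly_funs_def
    by (intro exI[of _ 0] bexI[of _ "\<lambda>_. 1"]) (auto intro: hom_poly_rel.const)
  then have "openin (proj_zariski m) (proj_points m)"
    unfolding openin_proj_zariski by (rule arbitrary_union_of_inc)
  then show "proj_points m \<subseteq> topspace (proj_zariski m)" by (rule openin_subset)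
qed


subsection \<open>Quotients\<close>

text \<open>The quotient of \<open>X\<close> along \<open>q\<close>: a subset of the image is open iff its preimage is open, and a
  function is regular iff its pullback is. For an algebraic group \<open>G\<close> and a closed subgroup \<open>H\<close>,
  this is the variety structure on \<open>G/H\<close>.\<close>

definition quotient_zariski :: "'a fun_space \<Rightarrow> ('a \<Rightarrow> 'b) \<Rightarrow> 'b topology" where
  "quotient_zariski X q =
     topology (\<lambda>V. V \<subseteq> q ` points X \<and> openin (Zariski X) {x \<in> points X. q x \<in> V})"

definition quotient_space :: "'a fun_space \<Rightarrow> ('a \<Rightarrow> 'b) \<Rightarrow> 'b fun_space" where
  "quotient_space X q =
     \<lparr>Zariski = quotient_zariski X q,
      Regular = (\<lambda>V. {h. h \<circ> q \<in> Regular X {x \<in> points X. q x \<in> V}})\<rparr>"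

lemma openin_quotient_zariski:
  "openin (quotient_zariski X q) V \<longleftrightarrow>
     V \<subseteq> q ` points X \<and> openin (Zariski X) {x \<in> points X. q x \<in> V}"
proof -
  let ?P = "\<lambda>V. V \<subseteq> q ` points X \<and> openin (Zariski X) {x \<in> points X. q x \<in> V}"
  have "istopology ?P"
    unfolding istopology_def
  proof (intro conjI allI impI)
    fix S T assume S: "?P S" and T: "?P T"
    show "S \<inter> T \<subseteq> q ` points X" using S by blast
    have "{x \<in> points X. q x \<in> S \<inter> T} = {x \<in> points X. q x \<in> S} \<inter> {x \<in> points X. q x \<in> T}"
      by blast
    with S T show "openin (Zariski X) {x \<in> points X. q x \<in> S \<inter> T}" by auto
  next
    fix K assume K: "\<forall>V\<in>K. ?P V"
    show "\<Union>K \<subseteq> q ` points X" using K by blast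
    have "{x \<in> points X. q x \<in> \<Union>K} = \<Union>((\<lambda>V. {x \<in> points X. q x \<in> V}) ` K)" by blast
    moreover have "openin (Zariski X) (\<Union>((\<lambda>V. {x \<in> points X. q x \<in> V}) ` K))"
      using K by (intro openin_Union) auto
    ultimately show "openin (Zariski X) {x \<in> points X. q x \<in> \<Union>K}" by simp
  qed
  then show ?thesis unfolding quotient_zariski_def by (simp add: topology_inverse')
qed

lemma topspace_quotient_zariski [simp]: "topspace (quotient_zariski X q) = q ` points X"
proof
  show "topspace (quotient_zariski X q) \<subseteq> q ` points X"
    using openin_topspace[of "quotient_zariski X q", unfolded openin_quotient_zariski] by (rule conjunct1)
  have "{x \<in> points X. q x \<in> q ` points X} = points X" by blast
  then have "openin (quotient_zariski X q) (q ` points X)"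
    by (simp add: openin_quotient_zariski)
  then show "q ` points X \<subseteq> topspace (quotient_zariski X q)" by (rule openin_subset)
qed


section \<open>The special linear group and its minimal parabolic subgroups\<close>

definition SL :: "nat \<Rightarrow> complex mat monoid" where
  "SL n = \<lparr>carrier = {A \<in> carrier_mat n n. det A = 1}, monoid.mult = times, one = 1\<^sub>m n\<rparr>"

definition SL_variety :: "nat \<Rightarrow> complex mat fun_space" where
  "SL_variety n = affine_variety (mat_coords n) (carrier (SL n))"

definition borel_SL :: "nat \<Rightarrow> complex mat set" where
  "borel_SL n = {A \<in> carrier (SL n). upper_triangular A}"

text \<open>A representative in the normaliser of the diagonal torus of the simple reflection
  \<open>s\<^sub>\<alpha>\<^sub>i\<close>, for \<open>1 \<le> i \<le> n - 1\<close>. It is the permutation matrix of the transposition of \<open>i\<close> and \<open>i + 1\<close>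
  (rows \<open>i - 1\<close> and \<open>i\<close> in the 0-based indexing of \<^typ>\<open>complex mat\<close>) with one row negated, so that
  its determinant is 1. Two representatives differ by an element of the torus, so the double coset
  in \<open>minimal_parabolic\<close> does not depend on this choice.\<close>

definition simple_reflection :: "nat \<Rightarrow> nat \<Rightarrow> complex mat" where
  "simple_reflection n i = multrow_mat n i (-1) * swaprows_mat n (i - 1) i"

lemma simple_reflection_in_SL:
  assumes "1 \<le> i" "i < n"
  shows "simple_reflection n i \<in> carrier (SL n)"
proof -
  have "det (simple_reflection n i) = 1"
    unfolding simple_reflection_def using assms
    by (subst det_mult[of _ n]) (auto simp: det_multrow_mat det_swaprows_mat)
  moreover have "simple_reflection n i \<in> carrier_mat n n"
    unfolding simple_reflection_def by (rule mult_carrier_mat) auto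
  ultimately show ?thesis by (simp add: SL_def)
qed

definition minimal_parabolic :: "nat \<Rightarrow> nat \<Rightarrow> complex mat set" where
  "minimal_parabolic n i =
     borel_SL n \<union> ((borel_SL n #>\<^bsub>SL n\<^esub> simple_reflection n i) <#>\<^bsub>SL n\<^esub> borel_SL n)"

text \<open>The points of \<open>SL(n)/P\<close> are the left cosets \<open>gP\<close>.\<close>

definition SL_quotient :: "nat \<Rightarrow> complex mat set \<Rightarrow> complex mat set fun_space" where
  "SL_quotient n P = quotient_space (SL_variety n) (\<lambda>g. g <#\<^bsub>SL n\<^esub> P)"

lemma points_SL_quotient: "points (SL_quotient n P) = lcosets\<^bsub>SL n\<^esub> P"
  by (auto simp: SL_quotient_def quotient_space_def SL_variety_def affine_variety_def LCOSETS_def)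

end

theory Submission
  imports Defs
    "HOL-Computational_Algebra.Polynomial_Factorial"
    "HOL-Computational_Algebra.Field_as_Ring"
    "HOL-Computational_Algebra.Fundamental_Theorem_Algebra"
    "HOL-Library.Function_Algebras"
begin

text \<open>A morphism to the flag variety is a flag \<open>V\<^sub>1 \<subset> \<dots> \<subset> V\<^sub>k\<close>, \<open>k = n - 2\<close>, of subbundles of the
  trivial bundle of rank \<open>n\<close> on projective 3-space. The quotients \<open>V\<^sub>i\<^sub>+\<^sub>1 / V\<^sub>i\<close> are line bundles \<open>\<O>(-b\<^sub>i)\<close>
  and \<open>H\<^sup>1\<close> of every line bundle vanishes, so the flag splits: it is spanned by homogeneous polynomial
  vectors \<open>v\<^sub>i\<close> of degree \<open>b\<^sub>i \<ge> 0\<close> that are linearly independent away from the origin. On the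
  projectivisation of the sum of the \<open>\<O>(-b\<^sub>i)\<close>, which has dimension \<open>n\<close>, the \<open>n\<close> coordinates of the
  ambient space are sections of \<open>\<O>(1)\<close> without common zero. If some \<open>b\<^sub>i\<close> were positive,
  \<open>\<O>(1)\<close> would be big, and its powers would have more sections than polynomials in \<open>n\<close> base-point-free
  sections can generate. So all \<open>b\<^sub>i\<close> are zero and the flag is constant. (Equivalently, the third
  Chern class of the quotient bundle of rank 2 is the complete homogeneous symmetric
  polynomial of degree 3 in the \<open>b\<^sub>i\<close>.)\<close>

section \<open>Polynomials in four variables\<close>

text \<open>Leaving out only the subspaces of dimension n - 1 keeps every dimension from 1 to k, so
  each step of the flag is a line bundle. The remaining quotient of rank 2 makes the projectivised
  bundle have dimension 3 + (k - 1) = n, one more than the dimension of the projective space to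
  which its n sections map it; this is what the growth argument exploits. No cohomology is
  developed. A statement that holds at every point of projective space becomes one about polynomials
  by the Nullstellensatz: an ideal without zeros off the origin contains powers of the variables.
  Vanishing of H^1 becomes the fact that powers of three variables form a regular sequence. Coset
  representatives are chosen arbitrarily, point by point. Therefore only the kernels of rows of
  their inverses are used, and algebraicity enters through polynomial sections that exist near each
  point.\<close>

type_synonym poly4 = "complex poly poly poly poly"

definition cst :: "complex \<Rightarrow> poly4" where
  "cst c = [:[:[:[:c:]:]:]:]"

text \<open>\<open>X 0\<close> is the outermost variable, so divisibility by its powers can be read
  off coefficients, with the other variables as scalars. Iterating univariate polynomials also
  provides the factorial structure and \<open>Gcd\<close> on \<open>poly4\<close>. Every index from
  3 on denotes the same innermost variable.\<close>

definition X :: "nat \<Rightarrow> poly4" where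
  "X l = (if l = 0 then [:0, 1:] else if l = 1 then [:[:0, 1:]:]
     else if l = 2 then [:[:[:0, 1:]:]:] else [:[:[:[:0, 1:]:]:]:])"

definition ev :: "poly4 \<Rightarrow> (nat \<Rightarrow> complex) \<Rightarrow> complex" where
  "ev p z = poly (poly (poly (poly p [:[:[:z 0:]:]:]) [:[:z 1:]:]) [:z 2:]) (z 3)"

lemma ev_simps [simp]:
  "ev 0 z = 0" "ev 1 z = 1" "ev (p + q) z = ev p z + ev q z" "ev (p * q) z = ev p z * ev q z"
  "ev (- p) z = - ev p z" "ev (p - q) z = ev p z - ev q z" "ev (p ^ m) z = ev p z ^ m"
  "ev (cst c) z = c"
  by (simp_all add: ev_def cst_def flip: one_pCons)

lemma ev_X [simp]: "l < 4 \<Longrightarrow> ev (X l) z = z l"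
  by (auto simp: ev_def X_def less_Suc_eq numeral_eq_Suc)

lemma ev_sum [simp]: "ev (sum f A) z = (\<Sum>a\<in>A. ev (f a) z)"
  by (induction A rule: infinite_finite_induct) auto

lemma ev_prod [simp]: "ev (prod f A) z = (\<Prod>a\<in>A. ev (f a) z)"
  by (induction A rule: infinite_finite_induct) auto

lemma cst_simps: "cst 0 = 0" "cst 1 = 1" "cst (a + b) = cst a + cst b" "cst (a * b) = cst a * cst b"
  "cst (- a) = - cst a"
  by (simp_all add: cst_def flip: one_pCons)

lemma poly4_induct [case_names cst X add mult]:
  fixes p :: poly4
  assumes "\<And>c. Q (cst c)" "\<And>l. l < 4 \<Longrightarrow> Q (X l)"
    "\<And>p q. Q p \<Longrightarrow> Q q \<Longrightarrow> Q (p + q)" "\<And>p q. Q p \<Longrightarrow> Q q \<Longrightarrow> Q (p * q)"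
  shows "Q p"
proof -
  have 0: "Q 0" using assms(1)[of 0] by (simp add: cst_simps)
  have 3: "Q [:[:[:a:]:]:]" for a :: "complex poly"
  proof (induction a)
    case (pCons c a)
    have eq: "[:[:[:pCons c a:]:]:] = cst c + X 3 * [:[:[:a:]:]:]"
      by (simp add: cst_def X_def)
    show ?case unfolding eq using pCons.IH by (intro assms) auto
  qed (use 0 in simp)
  have 2: "Q [:[:a:]:]" for a :: "complex poly poly"
  proof (induction a)
    case (pCons c a)
    have eq: "[:[:pCons c a:]:] = [:[:[:c:]:]:] + X 2 * [:[:a:]:]"
      by (simp add: X_def)
    show ?case unfolding eq using pCons.IH 3[of c] by (intro assms) auto
  qed (use 0 in simp)
  have 1: "Q [:a:]" for a :: "complex poly poly poly"
  proof (induction a)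
    case (pCons c a)
    have eq: "[:pCons c a:] = [:[:c:]:] + X 1 * [:a:]"
      by (simp add: X_def)
    show ?case unfolding eq using pCons.IH 2[of c] by (intro assms) auto
  qed (use 0 in simp)
  show ?thesis
  proof (induction p)
    case (pCons c a)
    have eq: "pCons c a = [:c:] + X 0 * a"
      by (simp add: X_def)
    show ?case unfolding eq using pCons.IH 1[of c] by (intro assms) auto
  qed (use 0 in simp)
qed

text \<open>Infinitely many scalars, finitely many roots. The embedding \<open>f\<close> puts a
  scalar into the coefficient ring, however deeply nested; asking for a nonzero \<open>c\<close>
  allows identities to be tested off the origin, where the flag lives.\<close>

lemma ex_poly_nonzero:
  fixes p :: "'a :: idom poly" and f :: "complex \<Rightarrow> 'a"
  assumes "p \<noteq> 0" "inj f"
  shows "\<exists>c. c \<noteq> 0 \<and> poly p (f c) \<noteq> 0"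
proof (rule ccontr)
  assume "\<not> ?thesis"
  then have "f ` (UNIV - {0}) \<subseteq> {x. poly p x = 0}" by auto
  then have "finite (f ` (UNIV - {0}))"
    using poly_roots_finite[OF assms(1)] finite_subset by blast
  then have "finite (UNIV - {0} :: complex set)"
    using assms(2) by (meson finite_imageD inj_on_subset subset_UNIV)
  then show False using infinite_UNIV_char_0[where 'a=complex] by simp
qed

lemma ex_ev_nonzero:
  assumes "p \<noteq> 0"
  shows "\<exists>z. (\<forall>l. z l \<noteq> 0) \<and> ev p z \<noteq> 0"
proof -
  obtain a where a: "a \<noteq> 0" "poly p [:[:[:a:]:]:] \<noteq> 0"
    using ex_poly_nonzero[OF assms, of "\<lambda>c. [:[:[:c:]:]:]"] by (auto simp: inj_def)
  obtain b where b: "b \<noteq> 0" "poly (poly p [:[:[:a:]:]:]) [:[:b:]:] \<noteq> 0"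
    using ex_poly_nonzero[OF a(2), of "\<lambda>c. [:[:c:]:]"] by (auto simp: inj_def)
  obtain c where c: "c \<noteq> 0" "poly (poly (poly p [:[:[:a:]:]:]) [:[:b:]:]) [:c:] \<noteq> 0"
    using ex_poly_nonzero[OF b(2), of "\<lambda>c. [:c:]"] by (auto simp: inj_def)
  obtain d where d: "d \<noteq> 0" "poly (poly (poly (poly p [:[:[:a:]:]:]) [:[:b:]:]) [:c:]) d \<noteq> 0"
    using ex_poly_nonzero[OF c(2), of "\<lambda>c. c"] by (auto simp: inj_def)
  let ?z = "\<lambda>l :: nat. if l = 0 then a else if l = 1 then b else if l = 2 then c else d"
  show ?thesis using a b c d by (intro exI[of _ ?z]) (simp add: ev_def)
qed

lemma ev_eqI:
  assumes "\<And>z. (\<forall>l. z l \<noteq> 0) \<Longrightarrow> ev p z = ev q z"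
  shows "p = q"
  using ex_ev_nonzero[of "p - q"] assms by force

lemma X_neq_0 [simp]: "X l \<noteq> 0"
  by (simp add: X_def)

text \<open>\<open>X 1 ^ N\<close> acts on the coefficients with respect to \<open>X 0\<close> as a
  nonzero scalar of a domain, so it cannot create divisibility by \<open>X 0 ^ N\<close>. Together
  with the next lemma this makes powers of \<open>X 0\<close>, \<open>X 1\<close>,
  \<open>X 2\<close> a regular sequence.\<close>

lemma X0_power_dvd:
  assumes "X 0 ^ N dvd X 1 ^ N * a"
  shows "X 0 ^ N dvd a"
proof -
  have X0: "X 0 ^ N = monom 1 N" by (simp add: X_def monom_altdef)
  have X1: "X 1 ^ N * a = smult ([:0, 1:] ^ N) a"
    by (simp add: X_def poly_const_pow)
  show ?thesis
    using assms unfolding X0 X1 monom_1_dvd_iff' by simp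
qed

text \<open>Modulo \<open>X 0 ^ N\<close> only the first \<open>N\<close> coefficients in
  \<open>X 0\<close> count, and comparing them gives divisibility by \<open>X 1 ^ N\<close> one at a
  time. This is what the vanishing of H^1 amounts to in \<open>lift_generator\<close>.\<close>

lemma X_colon:
  assumes "X 2 ^ N * c = X 1 ^ N * a - X 0 ^ N * b"
  shows "\<exists>\<alpha> \<beta>. c = X 0 ^ N * \<alpha> + X 1 ^ N * \<beta>"
proof -
  have X0: "X 0 ^ N = monom 1 N" by (simp add: X_def monom_altdef)
  have X1: "X 1 ^ N * q = smult (monom 1 N) q" for q
    by (simp add: X_def monom_altdef poly_const_pow)
  have X2: "X 2 ^ N * q = smult ([:[:0,1:]:] ^ N) q" for q
    by (simp add: X_def poly_const_pow)
  have dvd: "monom 1 N dvd coeff c j" if "j < N" for j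
  proof -
    have "coeff (X 2 ^ N * c) j = monom 1 N * coeff a j"
      using that unfolding assms by (simp add: X0 X1[unfolded One_nat_def] coeff_monom_mult)
    then have "monom 1 N dvd smult ([:0,1:] ^ N) (coeff c j)"
      by (simp add: X2 poly_const_pow)
    then show ?thesis unfolding monom_1_dvd_iff' by simp
  qed
  then obtain e where e: "\<And>j. j < N \<Longrightarrow> coeff c j = monom 1 N * e j"
    unfolding dvd_def by metis
  \<comment> \<open>\<open>\<beta>\<close> collects the quotients of the low coefficients, so that
    subtracting \<open>X 1 ^ N * \<beta>\<close> leaves a multiple of
    \<open>X 0 ^ N\<close>.\<close>
  define \<beta> where "\<beta> = (\<Sum>j<N. monom (e j) j)"
  have "coeff (c - X 1 ^ N * \<beta>) j = 0" if "j < N" for j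
    using that by (simp add: X1[unfolded One_nat_def] \<beta>_def coeff_sum e coeff_monom)
  then have "X 0 ^ N dvd c - X 1 ^ N * \<beta>"
    unfolding X0 monom_1_dvd_iff' by blast
  then obtain \<alpha> where "c - X 1 ^ N * \<beta> = X 0 ^ N * \<alpha>" by blast
  then show ?thesis by (metis diff_add_cancel)
qed

section \<open>Linear algebra in the space of complex functions of the coordinates\<close>

interpretation fs: vector_space "\<lambda>(c :: complex) (f :: (nat \<Rightarrow> complex) \<Rightarrow> complex) z. c * f z"
  by unfold_locales (auto simp: fun_eq_iff algebra_simps)

lemma sum_fun_apply: "sum f A z = (\<Sum>a\<in>A. f a z)"
  for f :: "'a \<Rightarrow> 'b \<Rightarrow> complex"
  by (induction A rule: infinite_finite_induct) auto

lemma span_mult: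
  assumes "f \<in> fs.span A" "g \<in> fs.span B"
    and AB: "\<And>a b. a \<in> A \<Longrightarrow> b \<in> B \<Longrightarrow> (\<lambda>z. a z * b z) \<in> fs.span C"
  shows "(\<lambda>z. f z * g z) \<in> fs.span C"
proof -
  have 1: "(\<lambda>z. f z * b z) \<in> fs.span C" if "b \<in> B" for b
    using assms(1)
  proof (induction rule: fs.span_induct_alt)
    case base
    then show ?case using fs.span_zero[of C] by (simp add: zero_fun_def)
  next
    case (step c x y)
    have "(\<lambda>z. c * (x z * b z)) + (\<lambda>z. y z * b z) \<in> fs.span C"
      by (rule fs.span_add[OF fs.span_scale[OF AB[OF step(1) that]] step(2)])
    then show ?case by (simp add: plus_fun_def algebra_simps)
  qed
  show ?thesis
    using assms(2)
  proof (induction rule: fs.span_induct_alt)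
    case base
    then show ?case using fs.span_zero[of C] by (simp add: zero_fun_def)
  next
    case (step c x y)
    have "(\<lambda>z. c * (f z * x z)) + (\<lambda>z. f z * y z) \<in> fs.span C"
      by (rule fs.span_add[OF fs.span_scale[OF 1[OF step(1)]] step(2)])
    then show ?case by (simp add: plus_fun_def algebra_simps)
  qed
qed

lemma span_sum_scale:
  assumes "\<And>a. a \<in> A \<Longrightarrow> f a \<in> fs.span C"
  shows "(\<lambda>z. \<Sum>a\<in>A. c a * f a z) \<in> fs.span C"
proof -
  have "(\<Sum>a\<in>A. (\<lambda>z. c a * f a z)) \<in> fs.span C"
    using assms by (intro fs.span_sum fs.span_scale)
  then show ?thesis by (simp add: sum_fun_apply[abs_def])
qed

text \<open>A family rather than a set: if two members coincide, their difference is the relation;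
  otherwise the image has more elements than an independent subset of the span can have.\<close>

lemma dependent_family:
  assumes "finite B" "finite A" "card B < card A" "\<And>a. a \<in> A \<Longrightarrow> u a \<in> fs.span B"
  shows "\<exists>r a. a \<in> A \<and> r a \<noteq> 0 \<and> (\<forall>z. (\<Sum>a\<in>A. r a * u a z) = 0)"
proof (cases "inj_on u A")
  case False
  then obtain a b where ab: "a \<in> A" "b \<in> A" "a \<noteq> b" "u a = u b" by (auto simp: inj_on_def)
  define r where "r = (\<lambda>x. if x = a then 1 else if x = b then -1 else (0::complex))"
  have "(\<Sum>x\<in>A. r x * u x z) = 0" for z
  proof -
    have "(\<Sum>x\<in>A. r x * u x z) = (\<Sum>x\<in>{a,b}. r x * u x z)"
      using ab assms(2) by (intro sum.mono_neutral_right) (auto simp: r_def)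
    then show ?thesis using ab by (simp add: r_def)
  qed
  then show ?thesis using ab(1) by (intro exI[of _ r] exI[of _ a]) (simp add: r_def)
next
  case True
  have "fs.dependent (u ` A)"
    using fs.independent_span_bound[OF assms(1), of "u ` A"] assms card_image[OF True] by force
  then obtain r f where r: "f \<in> u ` A" "r f \<noteq> 0" "(\<Sum>v\<in>u ` A. (\<lambda>z. r v * v z)) = 0"
    using assms(2) by (auto simp: fs.dependent_finite)
  have "(\<Sum>a\<in>A. r (u a) * u a z) = 0" for z
    using fun_cong[OF r(3), of z] by (simp add: sum_fun_apply sum.reindex[OF True])
  with r show ?thesis by (intro exI[of _ "\<lambda>a. r (u a)"]) auto
qed


text \<open>The number \<open>K\<close> of variables is a parameter because the same monomials serve
  on the base, with 4 variables, and on the bundle, with \<open>4 + k\<close>.\<close>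

definition monom_fun :: "nat \<Rightarrow> (nat \<Rightarrow> nat) \<Rightarrow> (nat \<Rightarrow> complex) \<Rightarrow> complex" where
  "monom_fun K e z = (\<Prod>i<K. z i ^ e i)"

lemma monom_fun_mult:
  "monom_fun K e z * monom_fun K e' z = monom_fun K (\<lambda>i. e i + e' i) z"
  by (simp add: monom_fun_def power_add prod.distrib)

definition expo :: "nat \<Rightarrow> (nat \<Rightarrow> nat) set" where
  "expo K = {e. \<forall>i\<ge>K. e i = 0}"

lemma monom_fun_expo:
  assumes "e \<in> expo K" "K \<le> K'"
  shows "monom_fun K' e = monom_fun K e"
proof
  fix z
  show "monom_fun K' e z = monom_fun K e z"
    unfolding monom_fun_def using assms
    by (intro prod.mono_neutral_right) (auto simp: expo_def)
qed

lemma finite_expo_bounded: "finite {e \<in> expo K. \<forall>i<K. e i \<le> N}"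
proof -
  have "finite {e. \<forall>i. (i \<in> {..<K} \<longrightarrow> e i \<in> {..N}) \<and> (i \<notin> {..<K} \<longrightarrow> e i = 0)}"
    by (rule finite_set_of_finite_funs) auto
  then show ?thesis
    by (rule finite_subset[rotated]) (simp add: expo_def not_less Collect_mono_iff)
qed

text \<open>For the countability argument in the Nullstellensatz: these spaces are
  finite-dimensional and indexed by naturals. Exponent bounds add up under products, which settles
  the multiplicative case.\<close>

lemma ev_in_span_bounded: "\<exists>N. ev p \<in> fs.span (monom_fun 4 ` {e \<in> expo 4. \<forall>i<4. e i \<le> N})"
proof (induction p rule: poly4_induct)
  case (cst c)
  have "monom_fun 4 (\<lambda>_. 0) \<in> fs.span (monom_fun 4 ` {e \<in> expo 4. \<forall>i<4. e i \<le> 0})"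
    by (intro fs.span_base imageI) (auto simp: expo_def)
  from fs.span_scale[OF this, of c] show ?case
    by (intro exI[of _ 0]) (simp add: monom_fun_def[abs_def] ev_simps(8)[abs_def] Ball_def)
next
  case (X l)
  let ?e = "\<lambda>i. if i = l then 1 else 0 :: nat"
  have "monom_fun 4 ?e \<in> fs.span (monom_fun 4 ` {e \<in> expo 4. \<forall>i<4. e i \<le> 1})"
    using X by (intro fs.span_base imageI) (auto simp: expo_def)
  moreover have "monom_fun 4 ?e = ev (X l)"
    using X by (auto simp: monom_fun_def fun_eq_iff if_distrib[of "\<lambda>n. _ ^ n"] prod.delta cong: if_cong)
  ultimately show ?case by auto
next
  case (add p q)
  then obtain M N where "ev p \<in> fs.span (monom_fun 4 ` {e \<in> expo 4. \<forall>i<4. e i \<le> M})"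
    "ev q \<in> fs.span (monom_fun 4 ` {e \<in> expo 4. \<forall>i<4. e i \<le> N})" by blast
  moreover have "fs.span (monom_fun 4 ` {e \<in> expo 4. \<forall>i<4. e i \<le> K})
      \<subseteq> fs.span (monom_fun 4 ` {e \<in> expo 4. \<forall>i<4. e i \<le> M + N})" if "K \<le> M + N" for K
    using that by (intro fs.span_mono image_mono) (auto intro: order_trans)
  note this[of M] this[of N]
  ultimately have "ev p + ev q \<in> fs.span (monom_fun 4 ` {e \<in> expo 4. \<forall>i<4. e i \<le> M + N})"
    by (intro fs.span_add) (auto simp: subset_iff)
  moreover have "ev p + ev q = ev (p + q)" by (auto simp: fun_eq_iff)
  ultimately show ?case by metis
next
  case (mult p q)
  then obtain M N where MN: "ev p \<in> fs.span (monom_fun 4 ` {e \<in> expo 4. \<forall>i<4. e i \<le> M})"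
    "ev q \<in> fs.span (monom_fun 4 ` {e \<in> expo 4. \<forall>i<4. e i \<le> N})" by blast
  have "(\<lambda>z. ev p z * ev q z) \<in> fs.span (monom_fun 4 ` {e \<in> expo 4. \<forall>i<4. e i \<le> M + N})"
  proof (rule span_mult[OF MN])
    fix a b assume "a \<in> monom_fun 4 ` {e \<in> expo 4. \<forall>i<4. e i \<le> M}"
      "b \<in> monom_fun 4 ` {e \<in> expo 4. \<forall>i<4. e i \<le> N}"
    then show "(\<lambda>z. a z * b z) \<in> fs.span (monom_fun 4 ` {e \<in> expo 4. \<forall>i<4. e i \<le> M + N})"
      by (force intro!: fs.span_base simp: monom_fun_mult expo_def add_mono)
  qed
  then show ?case unfolding ev_simps(4)[symmetric] by blast
qed

section \<open>Hilbert's Nullstellensatz in four variables and its projective form\<close>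

definition ideal4 :: "poly4 set \<Rightarrow> bool" where
  "ideal4 I \<longleftrightarrow> 0 \<in> I \<and> (\<forall>p\<in>I. \<forall>q\<in>I. p + q \<in> I) \<and> (\<forall>p. \<forall>q\<in>I. p * q \<in> I)"

lemma ideal4D:
  assumes "ideal4 I"
  shows "0 \<in> I" "p \<in> I \<Longrightarrow> q \<in> I \<Longrightarrow> p + q \<in> I" "q \<in> I \<Longrightarrow> p * q \<in> I" "q \<in> I \<Longrightarrow> q * p \<in> I"
    "p \<in> I \<Longrightarrow> q \<in> I \<Longrightarrow> p - q \<in> I"
proof -
  show 3: "q \<in> I \<Longrightarrow> p * q \<in> I" for p q using assms by (auto simp: ideal4_def)
  show 2: "p \<in> I \<Longrightarrow> q \<in> I \<Longrightarrow> p + q \<in> I" for p q using assms by (auto simp: ideal4_def)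
  show "0 \<in> I" using assms by (auto simp: ideal4_def)
  show "q \<in> I \<Longrightarrow> q * p \<in> I" using 3[of q p] by (simp add: mult.commute)
  show "p \<in> I \<Longrightarrow> q \<in> I \<Longrightarrow> p - q \<in> I" using 2[of p "- q"] 3[of q "-1"] by simp
qed

lemma ideal4_sum:
  assumes "ideal4 I" "\<And>a. a \<in> A \<Longrightarrow> f a \<in> I"
  shows "sum f A \<in> I"
  using assms(2) by (induction A rule: infinite_finite_induct) (auto intro: ideal4D[OF assms(1)])

text \<open>Inverting \<open>f\<close> by maximality replaces Rabinowitsch's extra variable: the
  last property says that every element outside \<open>M\<close> becomes a unit modulo
  \<open>M\<close> once powers of \<open>f\<close> are inverted.\<close>

lemma maximal_avoiding_ideal:
  assumes "ideal4 I" "\<And>N. f ^ N \<notin> I"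
  obtains M where "ideal4 M" "I \<subseteq> M" "\<And>N. f ^ N \<notin> M"
    "\<And>h. h \<notin> M \<Longrightarrow> \<exists>N u. u * h - f ^ N \<in> M"
proof -
  let ?S = "{J. ideal4 J \<and> I \<subseteq> J \<and> (\<forall>N. f ^ N \<notin> J)}"
  have "\<exists>M\<in>?S. \<forall>J\<in>?S. M \<subseteq> J \<longrightarrow> J = M"
  proof (rule subset_Zorn_nonempty)
    show "?S \<noteq> {}" using assms by auto
    fix C assume C: "C \<noteq> {}" "subset.chain ?S C"
    have J: "ideal4 J" "I \<subseteq> J" "f ^ N \<notin> J" if "J \<in> C" for J N
      using C(2) that by (auto simp: subset_chain_def)
    have "ideal4 (\<Union>C)"
      unfolding ideal4_def
    proof (intro conjI ballI allI)
      show "0 \<in> \<Union>C" using C(1) J(1)[THEN ideal4D(1)] by blast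
    next
      fix p q assume "p \<in> \<Union>C" "q \<in> \<Union>C"
      then obtain J1 J2 where J12: "J1 \<in> C" "p \<in> J1" "J2 \<in> C" "q \<in> J2" by blast
      then consider "J1 \<subseteq> J2" | "J2 \<subseteq> J1" using C(2) by (auto simp: subset_chain_def)
      then show "p + q \<in> \<Union>C"
        by cases (use J12 J(1)[THEN ideal4D(2), of _ p q] in blast)+
    next
      fix p q assume "q \<in> \<Union>C"
      then show "p * q \<in> \<Union>C" using J(1)[THEN ideal4D(3), of _ q p] by blast
    qed
    moreover have "I \<subseteq> \<Union>C" using C(1) J(2) by blast
    moreover have "\<forall>N. f ^ N \<notin> \<Union>C" using J(3) by blast
    ultimately show "\<Union>C \<in> ?S" by blast
  qed
  then obtain M where M: "ideal4 M" "I \<subseteq> M" "\<And>N. f ^ N \<notin> M"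
    and max: "\<And>J. ideal4 J \<Longrightarrow> I \<subseteq> J \<Longrightarrow> (\<And>N. f ^ N \<notin> J) \<Longrightarrow> M \<subseteq> J \<Longrightarrow> J = M"
    by auto
  have "\<exists>N u. u * h - f ^ N \<in> M" if "h \<notin> M" for h
  proof (rule ccontr)
    assume *: "\<not> ?thesis"
    \<comment> \<open>\<open>?J\<close> is the ideal generated by \<open>M\<close> and
      \<open>h\<close>; if it contained no power of \<open>f\<close>, maximality would force
      \<open>h\<close> into \<open>M\<close>.\<close>
    let ?J = "{p. \<exists>u. u * h - p \<in> M}"
    have "ideal4 ?J"
      unfolding ideal4_def mem_Collect_eq
    proof (intro conjI ballI allI)
      show "\<exists>u. u * h - 0 \<in> M" using ideal4D(1)[OF M(1)] by (intro exI[of _ 0]) simp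
    next
      fix p q assume "p \<in> ?J" "q \<in> ?J"
      then obtain u v where "u * h - p \<in> M" "v * h - q \<in> M" by auto
      from ideal4D(2)[OF M(1) this] show "\<exists>u. u * h - (p + q) \<in> M"
        by (intro exI[of _ "u + v"]) (simp add: algebra_simps)
    next
      fix p q assume "q \<in> ?J"
      then obtain u where "u * h - q \<in> M" by auto
      from ideal4D(3)[OF M(1) this, of p] show "\<exists>u. u * h - p * q \<in> M"
        by (intro exI[of _ "p * u"]) (simp add: algebra_simps)
    qed
    moreover have "M \<subseteq> ?J"
      using ideal4D(5)[OF M(1) ideal4D(1)[OF M(1)]] by (auto intro!: exI[of _ 0])
    moreover have "h \<in> ?J" using ideal4D(1)[OF M(1)] by (auto intro!: exI[of _ 1])
    ultimately show False using max[of ?J] M(2) * that by blast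
  qed
  from that[OF M this] show thesis by blast
qed

definition emb :: "nat \<Rightarrow> complex poly \<Rightarrow> poly4" where
  "emb l H = (\<Sum>i\<le>degree H. cst (coeff H i) * X l ^ i)"

lemma ev_emb: "l < 4 \<Longrightarrow> ev (emb l H) z = poly H (z l)"
  by (simp add: emb_def poly_altdef)

text \<open>Modulo \<open>M\<close> and with \<open>f\<close> inverted, the polynomials form a field
  extension of the complex numbers. It is shown to be trivial, so that \<open>M\<close> consists of
  the polynomials vanishing at one point \<open>z\<close>. This is a zero of \<open>I\<close>, hence
  of \<open>f\<close>, which puts \<open>f\<close> itself into \<open>M\<close>.\<close>

theorem nullstellensatz:
  assumes I: "ideal4 I" and van: "\<And>z. (\<forall>p\<in>I. ev p z = 0) \<Longrightarrow> ev f z = 0"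
  shows "\<exists>N. f ^ N \<in> I"
proof (rule ccontr)
  assume "\<not> ?thesis"
  then obtain M where M: "ideal4 M" "I \<subseteq> M" "\<And>N. f ^ N \<notin> M"
    and max: "\<And>h. h \<notin> M \<Longrightarrow> \<exists>N u. u * h - f ^ N \<in> M"
    using maximal_avoiding_ideal[OF I] by metis
  have one: "1 \<notin> M" using M(3)[of 0] by simp
  have prime: "g \<in> M \<or> h \<in> M" if "g * h \<in> M" for g h
  proof (rule ccontr)
    assume "\<not> ?thesis"
    then obtain a b u v where uv: "u * g - f ^ a \<in> M" "v * h - f ^ b \<in> M" using max by metis
    have "f ^ (a + b) = u * v * (g * h) - u * g * (v * h - f ^ b) - f ^ b * (u * g - f ^ a)"
      by (simp add: power_add algebra_simps)
    also have "\<dots> \<in> M" by (rule ideal4D(5)[OF M(1) ideal4D(5)[OF M(1)]]; rule ideal4D(3)[OF M(1)]; fact)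
    finally show False using M(3) by blast
  qed
  \<comment> \<open>Over the complex numbers \<open>H\<close> splits into linear factors, and the
    prime ideal \<open>M\<close> has to contain one of them; it contains no nonzero
    constant.\<close>
  have root: "\<exists>a. X l - cst a \<in> M" if "emb l H \<in> M" "H \<noteq> 0" "l < 4" for H l
    using that
  proof (induction "degree H" arbitrary: H)
    case 0
    then obtain c where c: "H = [:c:]" "c \<noteq> 0" by (metis degree_eq_zeroE pCons_0_0)
    have "1 = cst (inverse c) * emb l H"
      using c 0 by (intro ev_eqI) (simp add: ev_emb)
    then show ?case using 0 one ideal4D(3)[OF M(1), of "emb l H" "cst (inverse c)"] by simp
  next
    case (Suc d)
    have "\<not> constant (poly H)" using Suc.hyps(2) by (simp add: constant_degree)
    then obtain a where "poly H a = 0" using fundamental_theorem_of_algebra by blast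
    then obtain H' where H': "H = [:-a, 1:] * H'" by (auto simp: poly_eq_0_iff_dvd)
    have "H' \<noteq> 0" using H' Suc.prems by auto
    have "degree H' = d"
      using Suc.hyps(2) \<open>H' \<noteq> 0\<close> unfolding H' by (subst (asm) degree_mult_eq) auto
    have "emb l H = (X l - cst a) * emb l H'"
      using Suc.prems by (intro ev_eqI) (simp add: ev_emb H' algebra_simps)
    then consider "X l - cst a \<in> M" | "emb l H' \<in> M" using prime Suc.prems by auto
    then show ?case
      by cases (use Suc.hyps(1) \<open>degree H' = d\<close> \<open>H' \<noteq> 0\<close> Suc.prems in auto)
  qed
  \<comment> \<open>The quotient by a maximal ideal has countable dimension over \<open>\<complex>\<close>, whereas the inverses of
    \<open>X l - t\<close> for the uncountably many \<open>t\<close> would be linearly independent.\<close>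
  have lin: "\<exists>a. X l - cst a \<in> M" if l: "l < 4" for l
  proof (rule ccontr)
    assume no: "\<not> ?thesis"
    then have "\<forall>t :: real. \<exists>N u. u * (X l - cst (of_real t)) - f ^ N \<in> M" using max by blast
    from choice[OF this] obtain N
      where "\<forall>t :: real. \<exists>u. u * (X l - cst (of_real t)) - f ^ N t \<in> M" by blast
    from choice[OF this] obtain u
      where u: "\<And>t :: real. u t * (X l - cst (of_real t)) - f ^ N t \<in> M" by blast
    have "\<forall>t. \<exists>b. ev (u t) \<in> fs.span (monom_fun 4 ` {e \<in> expo 4. \<forall>i<4. e i \<le> b})"
      using ev_in_span_bounded by blast
    from choice[OF this] obtain B
      where B: "\<And>t. ev (u t) \<in> fs.span (monom_fun 4 ` {e \<in> expo 4. \<forall>i<4. e i \<le> B t})" by blast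
    \<comment> \<open>\<open>N t\<close> and \<open>B t\<close> take countably many values on
      uncountably many \<open>t\<close>. A pair taken infinitely often puts more elements
      \<open>u t\<close> into one finite-dimensional space than its dimension.\<close>
    have "\<exists>k b. infinite {t. N t = k \<and> B t = b}"
    proof (rule ccontr)
      assume "\<not> ?thesis"
      then have "countable (\<Union>(k, b)\<in>UNIV. {t. N t = k \<and> B t = b})"
        by (intro countable_UN) (auto intro: countable_finite)
      moreover have "(\<Union>(k, b)\<in>UNIV. {t. N t = k \<and> B t = b}) = UNIV" by auto
      ultimately show False using uncountable_UNIV_real by simp
    qed
    then obtain k b where inf: "infinite {t. N t = k \<and> B t = b}" by blast
    let ?W = "monom_fun 4 ` {e \<in> expo 4. \<forall>i<4. e i \<le> b}"
    obtain A where A: "finite A" "card A = Suc (card ?W)" "A \<subseteq> {t. N t = k \<and> B t = b}"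
      using infinite_arbitrarily_large[OF inf] by blast
    have "\<exists>r a. a \<in> A \<and> r a \<noteq> 0 \<and> (\<forall>z. (\<Sum>a\<in>A. r a * ev (u a) z) = 0)"
    proof (rule dependent_family)
      show "ev (u a) \<in> fs.span ?W" if "a \<in> A" for a
        using B[of a] A(3) that by auto
    qed (use A finite_expo_bounded in auto)
    then obtain r a where r: "a \<in> A" "r a \<noteq> 0" "\<And>z. (\<Sum>a\<in>A. r a * ev (u a) z) = 0" by blast
    define c :: "real \<Rightarrow> complex" where "c = of_real"
    have c_inj: "c s = c t \<longleftrightarrow> s = t" for s t by (simp add: c_def)
    \<comment> \<open>\<open>H\<close> is the numerator of the sum of the fractions
      \<open>r t / (x - t)\<close> over their common denominator. At \<open>c a\<close> only the
      summand of \<open>a\<close> survives, so \<open>H\<close> is nonzero.\<close>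
    define H where "H = (\<Sum>t\<in>A. smult (r t) (\<Prod>s\<in>A - {t}. [:- c s, 1:]))"
    have "poly H (c a) = (\<Sum>t\<in>A. r t * (\<Prod>s\<in>A - {t}. c a - c s))"
      by (simp add: H_def poly_sum poly_prod)
    also have "\<dots> = (\<Sum>t\<in>{a}. r t * (\<Prod>s\<in>A - {t}. c a - c s))"
      using A r(1) by (intro sum.mono_neutral_right) auto
    also have "\<dots> \<noteq> 0" using A r by (simp add: c_inj)
    finally have "H \<noteq> 0" by auto
    let ?P = "\<lambda>t. \<Prod>s\<in>A - {t}. X l - cst (c s)"
    \<comment> \<open>The terms \<open>u t * (X l - t)\<close>, weighted by \<open>r t\<close> and
      their cofactors, sum to the full product times the sum of the \<open>r t * u t\<close>, which
      is zero; only the terms with \<open>f ^ k\<close> remain.\<close>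
    have "f ^ k * emb l H = - (\<Sum>t\<in>A. cst (r t) * ?P t * (u t * (X l - cst (c t)) - f ^ k))"
    proof (rule ev_eqI)
      fix z
      define Q where "Q t = (\<Prod>s\<in>A - {t}. z l - c s)" for t
      define U where "U t = ev (u t) z * (z l - c t)" for t
      have Q: "Q t * (z l - c t) = (\<Prod>s\<in>A. z l - c s)" if "t \<in> A" for t
        using prod.remove[OF A(1) that, of "\<lambda>s. z l - c s"] by (simp add: Q_def mult.commute)
      have "r t * Q t * U t = r t * ev (u t) z * (\<Prod>s\<in>A. z l - c s)" if "t \<in> A" for t
        unfolding Q[OF that, symmetric] U_def by (simp only: mult_ac)
      then have "(\<Sum>t\<in>A. r t * Q t * U t) = (\<Sum>t\<in>A. r t * ev (u t) z) * (\<Prod>s\<in>A. z l - c s)"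
        unfolding sum_distrib_right by (intro sum.cong) auto
      then have 0: "(\<Sum>t\<in>A. r t * Q t * U t) = 0" using r(3)[of z] by simp
      have "ev (f ^ k * emb l H) z = ev f z ^ k * (\<Sum>t\<in>A. r t * Q t)"
        using l by (simp add: ev_emb H_def poly_sum poly_prod Q_def)
      also have "\<dots> = - (\<Sum>t\<in>A. r t * Q t * (U t - ev f z ^ k))"
        unfolding right_diff_distrib sum_subtractf 0 sum_distrib_right[symmetric] by simp
      finally show "ev (f ^ k * emb l H) z =
          ev (- (\<Sum>t\<in>A. cst (r t) * ?P t * (u t * (X l - cst (c t)) - f ^ k))) z"
        using l unfolding Q_def U_def by simp
    qed
    also have "\<dots> = 0 - (\<Sum>t\<in>A. cst (r t) * ?P t * (u t * (X l - cst (c t)) - f ^ k))" by simp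
    also have "\<dots> \<in> M"
    proof (rule ideal4D(5)[OF M(1) ideal4D(1)[OF M(1)] ideal4_sum[OF M(1) ideal4D(3)[OF M(1)]]])
      fix t assume "t \<in> A"
      then show "u t * (X l - cst (c t)) - f ^ k \<in> M" using u[of t] A(3) by (auto simp: c_def)
    qed
    finally have "emb l H \<in> M" using prime[of "f ^ k" "emb l H"] M(3)[of k] by blast
    from root[OF this \<open>H \<noteq> 0\<close> l] no show False by blast
  qed
  then obtain z where z: "\<And>l. l < 4 \<Longrightarrow> X l - cst (z l) \<in> M" by metis
  have val: "p - cst (ev p z) \<in> M" for p
  proof (induction p rule: poly4_induct)
    case (cst c)
    then show ?case using ideal4D(1)[OF M(1)] by simp
  next
    case (X l)
    then show ?case using z by simp
  next
    case (add p q)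
    from ideal4D(2)[OF M(1) this] show ?case by (simp add: cst_simps algebra_simps)
  next
    case (mult p q)
    have "p * q - cst (ev (p * q) z) = q * (p - cst (ev p z)) + cst (ev p z) * (q - cst (ev q z))"
      by (simp add: cst_simps algebra_simps)
    also have "\<dots> \<in> M" by (intro ideal4D(2,3)[OF M(1)] mult)
    finally show ?case .
  qed
  have "ev p z = 0" if "p \<in> I" for p
  proof (rule ccontr)
    assume nz: "ev p z \<noteq> 0"
    have "cst (ev p z) = p - (p - cst (ev p z))" by simp
    also have "\<dots> \<in> M" using that M(2) val by (intro ideal4D(5)[OF M(1) _ val]) auto
    finally have "cst (inverse (ev p z)) * cst (ev p z) \<in> M" by (rule ideal4D(3)[OF M(1)])
    then show False using nz one by (simp add: cst_simps(2) flip: cst_simps(4))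
  qed
  then have "f \<in> M" using van val[of f] by (simp add: cst_simps)
  then show False using M(3)[of 1] by simp
qed

text \<open>The bridge from points of projective space to polynomials: on the common zeros of
  \<open>I\<close> the first four coordinates vanish, so the Nullstellensatz applies to each
  \<open>X l\<close>. One exponent serves all four variables after adding up the four
  exponents.\<close>

corollary power_X_in_ideal:
  assumes I: "ideal4 I" and van: "\<And>z. \<exists>l<4. z l \<noteq> 0 \<Longrightarrow> \<exists>p\<in>I. ev p z \<noteq> 0"
  shows "\<exists>N. \<forall>l<4. X l ^ N \<in> I"
proof -
  have "\<forall>l. \<exists>N. l < 4 \<longrightarrow> X l ^ N \<in> I"
  proof
    fix l
    show "\<exists>N. l < 4 \<longrightarrow> X l ^ N \<in> I"
    proof (cases "l < 4")
      case True
      have "\<exists>N. X l ^ N \<in> I"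
      proof (rule nullstellensatz[OF I])
        fix z assume "\<forall>p\<in>I. ev p z = 0"
        then have "z l = 0" using van[of z] True by blast
        then show "ev (X l) z = 0" using True by simp
      qed
      then show ?thesis by blast
    qed auto
  qed
  then obtain N where N: "\<And>l. l < 4 \<Longrightarrow> X l ^ N l \<in> I" by metis
  have "X l ^ (\<Sum>l<4. N l) \<in> I" if "l < 4" for l
  proof -
    have "(\<Sum>l<4. N l) = N l + (\<Sum>l\<in>{..<4} - {l}. N l)" using that by (intro sum.remove) auto
    then show ?thesis using ideal4D(4)[OF I N[OF that]] by (simp only: power_add)
  qed
  then show ?thesis by blast
qed

section \<open>Homogeneous polynomials and homogeneous components\<close>

definition homog :: "nat \<Rightarrow> poly4 \<Rightarrow> bool" where
  "homog d p \<longleftrightarrow> ev p \<in> fs.span (monom_fun 4 ` {e \<in> expo 4. (\<Sum>l<4. e l) = d})"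

lemma homog_0 [simp]: "homog d 0"
  using fs.span_zero by (simp add: homog_def zero_fun_def ev_simps(1)[abs_def])

lemma homog_scale:
  assumes "homog d p"
  shows "ev p (\<lambda>l. t * z l) = t ^ d * ev p z"
proof -
  have "f (\<lambda>l. t * z l) = t ^ d * f z"
    if "f \<in> fs.span (monom_fun 4 ` {e \<in> expo 4. (\<Sum>l<4. e l) = d})" for f
    using that
  proof (induction rule: fs.span_induct_alt)
    case base
    show ?case by simp
  next
    case (step c x y)
    then obtain e where e: "x = monom_fun 4 e" "(\<Sum>l<4. e l) = d" by auto
    have "x (\<lambda>l. t * z l) = t ^ d * x z"
      unfolding e(1) monom_fun_def power_mult_distrib prod.distrib power_sum[symmetric] e(2) ..
    with step(2) show ?case by (simp add: distrib_left mult.left_commute)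
  qed
  then show ?thesis using assms by (simp add: homog_def)
qed

text \<open>The zero components beyond \<open>D\<close> permit \<open>D\<close> to be enlarged, so
  that several polynomials can share one bound.\<close>

lemma homog_decomposition:
  "\<exists>c D. (\<forall>d. homog d (c d)) \<and> (\<forall>d>D. c d = 0) \<and> p = (\<Sum>d\<le>D. c d)"
proof -
  obtain N where "ev p \<in> fs.span (monom_fun 4 ` {e \<in> expo 4. \<forall>i<4. e i \<le> N})"
    using ev_in_span_bounded by blast
  then obtain T r where T: "finite T" "T \<subseteq> monom_fun 4 ` {e \<in> expo 4. \<forall>i<4. e i \<le> N}"
    and p: "ev p = (\<Sum>a\<in>T. (\<lambda>z. r a * a z))"
    unfolding fs.span_explicit by blast
  have "\<forall>a\<in>T. \<exists>e \<in> expo 4. a = monom_fun 4 e" using T(2) by auto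
  then obtain e where e: "\<And>a. a \<in> T \<Longrightarrow> e a \<in> expo 4" "\<And>a. a \<in> T \<Longrightarrow> a = monom_fun 4 (e a)" by metis
  define dg where "dg a = (\<Sum>l<4. e a l)" for a
  define c where "c d = (\<Sum>a\<in>{a \<in> T. dg a = d}. cst (r a) * (\<Prod>l<4. X l ^ e a l))" for d
  define D where "D = (\<Sum>a\<in>T. dg a)"
  have ev_c: "ev (c d) z = (\<Sum>a\<in>{a \<in> T. dg a = d}. r a * a z)" for d z
  proof -
    have "ev (c d) z = (\<Sum>a\<in>{a \<in> T. dg a = d}. r a * monom_fun 4 (e a) z)"
      by (simp add: c_def monom_fun_def)
    also have "\<dots> = (\<Sum>a\<in>{a \<in> T. dg a = d}. r a * a z)"
      by (intro sum.cong) (auto simp flip: e(2))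
    finally show ?thesis .
  qed
  have "homog d (c d)" for d
  proof -
    have "(\<lambda>z. \<Sum>a\<in>{a \<in> T. dg a = d}. r a * a z)
        \<in> fs.span (monom_fun 4 ` {e \<in> expo 4. (\<Sum>l<4. e l) = d})"
      using e by (intro span_sum_scale fs.span_base) (auto simp: dg_def)
    then show ?thesis by (simp add: homog_def ev_c[abs_def])
  qed
  moreover have le: "dg a \<le> D" if "a \<in> T" for a
    unfolding D_def using T(1) that by (simp add: member_le_sum)
  then have "c d = 0" if "d > D" for d
  proof -
    have "{a \<in> T. dg a = d} = {}" using le that by force
    then show ?thesis unfolding c_def by (simp only: sum.empty)
  qed
  moreover have "p = (\<Sum>d\<le>D. c d)"
  proof (rule ev_eqI)
    fix z
    have "(\<Sum>d\<le>D. \<Sum>a\<in>{a \<in> T. dg a = d}. r a * a z) = (\<Sum>a\<in>T. r a * a z)"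
      using T(1) le by (intro sum.group) auto
    then show "ev p z = ev (\<Sum>d\<le>D. c d) z" by (simp add: p sum_fun_apply ev_c)
  qed
  ultimately show ?thesis by blast
qed

text \<open>Separates homogeneous components along a punctured line through the origin, which is why
  only nonzero \<open>t\<close> are available.\<close>

lemma coeffs_zero:
  fixes a :: "nat \<Rightarrow> complex"
  assumes "\<And>t. t \<noteq> 0 \<Longrightarrow> (\<Sum>d\<le>D. t ^ d * a d) = 0" "d \<le> D"
  shows "a d = 0"
proof -
  define p where "p = (\<Sum>d\<le>D. monom (a d) d)"
  have "poly p t = 0" if "t \<noteq> 0" for t
    using assms(1)[OF that] by (simp add: p_def poly_sum poly_monom mult.commute)
  then have "p = 0"
    using ex_poly_nonzero[of p "\<lambda>c. c"] by (auto simp: inj_def)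
  then have "coeff p d = 0" by simp
  then show ?thesis using assms(2) by (simp add: p_def coeff_sum coeff_monom)
qed

section \<open>Flags of subbundles on projective space\<close>

definition dot :: "nat \<Rightarrow> (nat \<Rightarrow> 'a :: comm_ring_1) \<Rightarrow> (nat \<Rightarrow> 'a) \<Rightarrow> 'a" where
  "dot n a b = (\<Sum>r<n. a r * b r)"

lemma dot_add: "dot n a (\<lambda>r. b r + c r) = dot n a b + dot n a c"
  by (simp add: dot_def distrib_left sum.distrib)

lemma dot_diff: "dot n a (\<lambda>r. b r - c r) = dot n a b - dot n a c"
  by (simp add: dot_def right_diff_distrib sum_subtractf)

lemma dot_diff_left: "dot n (\<lambda>r. b r - c r) a = dot n b a - dot n c a"
  by (simp add: dot_def left_diff_distrib sum_subtractf)

lemma dot_scale: "dot n a (\<lambda>r. t * b r) = t * dot n a b"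
  by (simp add: dot_def sum_distrib_left mult.left_commute)

lemma dot_scale_left: "dot n (\<lambda>r. t * b r) a = t * dot n b a"
  by (simp add: dot_def sum_distrib_left mult.assoc)

lemma dot_sum: "dot n a (\<lambda>r. \<Sum>j\<in>A. f j r) = (\<Sum>j\<in>A. dot n a (f j))"
  unfolding dot_def sum_distrib_left by (rule sum.swap)

lemma dot_sum_left: "dot n (\<lambda>r. \<Sum>j\<in>A. f j r) a = (\<Sum>j\<in>A. dot n (f j) a)"
  unfolding dot_def sum_distrib_right by (rule sum.swap)

lemma dot_unit: "r < n \<Longrightarrow> dot n (\<lambda>s. if s = r then a else 0) u = a * u r"
  by (simp add: dot_def if_distrib[of "\<lambda>x. x * _"] cong: if_cong)

lemma dot_zero [simp]: "dot n a (\<lambda>r. 0) = 0"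
  by (simp add: dot_def)

lemma dot_cong: "(\<And>r. r < n \<Longrightarrow> b r = c r) \<Longrightarrow> dot n a b = dot n a c"
  by (simp add: dot_def)

lemma ev_dot: "ev (dot n a b) z = dot n (\<lambda>r. ev (a r) z) (\<lambda>r. ev (b r) z)"
  by (simp add: dot_def)

abbreviation nz :: "(nat \<Rightarrow> complex) \<Rightarrow> bool" where
  "nz z \<equiv> \<exists>l<4. z l \<noteq> 0"

lemma ev_eqI_nz:
  assumes "\<And>z. nz z \<Longrightarrow> ev p z = ev q z"
  shows "p = q"
  using assms by (intro ev_eqI) (metis zero_less_numeral)

text \<open>Cramer's rule without division. The matrix of pairings of the constant covectors
  \<open>C j\<close> with the \<open>v l\<close> is the identity at \<open>z\<close>, so its
  determinant \<open>a\<close> is nonzero there, and its adjugate corrects the covectors to be dual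
  up to \<open>a\<close> as polynomials.\<close>

lemma dual_polynomials:
  fixes v :: "nat \<Rightarrow> nat \<Rightarrow> poly4" and C :: "nat \<Rightarrow> nat \<Rightarrow> complex"
  assumes C: "\<And>j l. j < i \<Longrightarrow> l < i \<Longrightarrow> dot n (C j) (\<lambda>r. ev (v l r) z) = (if j = l then 1 else 0)"
  shows "\<exists>\<mu> a. ev a z \<noteq> 0 \<and> (\<forall>j<i. \<forall>l<i. dot n (\<mu> j) (v l) = (if j = l then a else 0))"
proof -
  define A where "A = mat i i (\<lambda>(j, l). dot n (\<lambda>r. cst (C j r)) (v l))"
  have A: "A \<in> carrier_mat i i" by (simp add: A_def)
  note adj = adj_mat[OF A]
  interpret h: comm_ring_hom "\<lambda>p. ev p z"
    by unfold_locales auto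
  have "map_mat (\<lambda>p. ev p z) A = 1\<^sub>m i"
    by (rule eq_matI) (auto simp: A_def ev_dot C)
  then have "ev (det A) z = 1"
    using h.hom_det[of A] by simp
  moreover have "dot n (\<lambda>r. \<Sum>m<i. adj_mat A $$ (j, m) * cst (C m r)) (v l) = (if j = l then det A else 0)"
    if "j < i" "l < i" for j l
  proof -
    have "dot n (\<lambda>r. \<Sum>m<i. adj_mat A $$ (j, m) * cst (C m r)) (v l)
        = (\<Sum>m<i. adj_mat A $$ (j, m) * A $$ (m, l))"
      using that by (simp add: dot_sum_left dot_scale_left A_def)
    also have "\<dots> = (adj_mat A * A) $$ (j, l)"
      using that A adj(1) by (auto simp: scalar_prod_def atLeast0LessThan intro!: sum.cong)
    also have "\<dots> = (if j = l then det A else 0)"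
      using that by (simp add: adj(3))
    finally show ?thesis .
  qed
  ultimately show ?thesis by (intro exI[of _ "\<lambda>j r. \<Sum>m<i. adj_mat A $$ (j, m) * cst (C m r)"] exI[of _ "det A"]) auto
qed

lemma dvd_Gcd_mult:
  fixes d :: poly4
  assumes "\<And>x. x \<in> B \<Longrightarrow> d dvd x * a"
  shows "d dvd Gcd B * a"
proof -
  have "d dvd Gcd ((*) a ` B)"
    using assms by (intro Gcd_greatest) (auto simp: mult.commute)
  then have "d dvd a * Gcd B" unfolding Gcd_mult dvd_normalize_iff .
  then show ?thesis by (simp only: mult.commute)
qed

text \<open>\<open>V i z\<close> is the i-th member of the flag over the point \<open>z\<close>, cut
  out by the last \<open>n - i\<close> rows of an invertible matrix \<open>H z\<close>, the inverse
  of a coset representative. Apart from homothety invariance of the kernels, the dependence on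
  \<open>z\<close> is controlled only by \<open>local_section\<close>, whose vector is a section
  everywhere but is required to leave \<open>V i\<close> only at the given point.\<close>

locale flag_map =
  fixes n k :: nat and H :: "(nat \<Rightarrow> complex) \<Rightarrow> nat \<Rightarrow> nat \<Rightarrow> complex"
  fixes V :: "nat \<Rightarrow> (nat \<Rightarrow> complex) \<Rightarrow> (nat \<Rightarrow> complex) \<Rightarrow> bool"
  defines V_def: "V i z u \<equiv> \<forall>r. i \<le> r \<longrightarrow> r < n \<longrightarrow> dot n (H z r) u = 0"
  assumes kn: "k \<le> n"
    and V_0: "nz z \<Longrightarrow> V 0 z u \<Longrightarrow> s < n \<Longrightarrow> u s = 0"
    and V_homothety: "nz z \<Longrightarrow> t \<noteq> 0 \<Longrightarrow> i \<le> k \<Longrightarrow> V i (\<lambda>l. t * z l) u \<longleftrightarrow> V i z u"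
    and local_section: "nz z \<Longrightarrow> i < k \<Longrightarrow>
      \<exists>w. (\<forall>z. nz z \<longrightarrow> V (Suc i) z (\<lambda>r. ev (w r) z)) \<and> \<not> V i z (\<lambda>r. ev (w r) z)"
begin

lemma V_cong: "(\<And>r. r < n \<Longrightarrow> u r = w r) \<Longrightarrow> V i z u \<longleftrightarrow> V i z w"
  unfolding V_def by (metis dot_cong)

lemma V_mono: "V i z u \<Longrightarrow> i \<le> j \<Longrightarrow> V j z u"
  by (simp add: V_def)

lemma V_zero: "V i z (\<lambda>r. 0)"
  by (simp add: V_def)

lemma V_add: "V i z u \<Longrightarrow> V i z w \<Longrightarrow> V i z (\<lambda>r. u r + w r)"
  by (simp add: V_def dot_add)

lemma V_diff: "V i z u \<Longrightarrow> V i z w \<Longrightarrow> V i z (\<lambda>r. u r - w r)"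
  by (simp add: V_def dot_diff)

lemma V_scale: "V i z u \<Longrightarrow> V i z (\<lambda>r. t * u r)"
  by (simp add: V_def dot_scale)

lemma V_scaleD: "V i z (\<lambda>r. t * u r) \<Longrightarrow> t \<noteq> 0 \<Longrightarrow> V i z u"
  by (auto simp: V_def dot_scale)

lemma V_sum: "(\<And>j. j \<in> A \<Longrightarrow> V i z (f j)) \<Longrightarrow> V i z (\<lambda>r. \<Sum>j\<in>A. f j r)"
  by (simp add: V_def dot_sum)

text \<open>Row \<open>i\<close> is the only equation that separates \<open>V i\<close> from
  \<open>V (Suc i)\<close>, so \<open>c\<close> is the quotient of its values on \<open>u\<close>
  and \<open>w\<close>.\<close>

lemma V_codim:
  assumes "V (Suc i) z u" "V (Suc i) z w" "\<not> V i z w"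
  shows "\<exists>c. V i z (\<lambda>r. u r - c * w r)"
proof -
  have S: "dot n (H z r) u = 0" "dot n (H z r) w = 0" if "Suc i \<le> r" "r < n" for r
    using assms(1,2) that unfolding V_def by auto
  then have "dot n (H z i) w \<noteq> 0"
    using assms(3) unfolding V_def by (metis Suc_leI le_neq_implies_less)
  then have "dot n (H z r) (\<lambda>r. u r - (dot n (H z i) u / dot n (H z i) w) * w r) = 0" if "i \<le> r" "r < n" for r
    unfolding dot_diff dot_scale using S[of r] that by (cases "r = i") simp_all
  then show ?thesis unfolding V_def by blast
qed

definition sect :: "nat \<Rightarrow> (nat \<Rightarrow> poly4) \<Rightarrow> bool" where
  "sect i w \<longleftrightarrow> (\<forall>z. nz z \<longrightarrow> V i z (\<lambda>r. ev (w r) z))"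

text \<open>The flag at \<open>t * z\<close> is the flag at \<open>z\<close>, so its equations, read
  along a punctured line, are polynomials in \<open>t\<close> whose coefficients are the equations
  for the components.\<close>

lemma sect_homog_component:
  assumes w: "sect i w" and "i \<le> k" and c: "\<And>r. r < n \<Longrightarrow> w r = (\<Sum>d\<le>D. c d r)"
    "\<And>d r. homog d (c d r)" and d: "d \<le> D"
  shows "sect i (c d)"
  unfolding sect_def V_def
proof (intro allI impI)
  fix z r assume z: "nz z" and r: "i \<le> r" "r < n"
  have "(\<Sum>d\<le>D. t ^ d * dot n (H z r) (\<lambda>r. ev (c d r) z)) = 0" if t: "t \<noteq> 0" for t
  proof -
    have "nz (\<lambda>l. t * z l)" using z t by auto
    with w have "V i (\<lambda>l. t * z l) (\<lambda>r. ev (w r) (\<lambda>l. t * z l))" by (simp only: sect_def)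
    then have V: "V i z (\<lambda>r. ev (w r) (\<lambda>l. t * z l))" by (simp only: V_homothety[OF z t \<open>i \<le> k\<close>])
    have "ev (w r) (\<lambda>l. t * z l) = (\<Sum>d\<le>D. t ^ d * ev (c d r) z)" if "r < n" for r
      by (simp add: c(1)[OF that] homog_scale[OF c(2)])
    from V_cong[THEN iffD1, OF this V] have "V i z (\<lambda>r. \<Sum>d\<le>D. t ^ d * ev (c d r) z)" .
    then have "dot n (H z r) (\<lambda>r. \<Sum>d\<le>D. t ^ d * ev (c d r) z) = 0"
      using r unfolding V_def by blast
    then show ?thesis by (simp add: dot_sum dot_scale)
  qed
  then show "dot n (H z r) (\<lambda>r. ev (c d r) z) = 0" by (rule coeffs_zero[OF _ d])
qed

text \<open>At every point \<open>v j\<close> generates the line \<open>V (Suc j) / V j\<close>, so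
  such a frame splits the flag globally.\<close>

definition adapted :: "nat \<Rightarrow> (nat \<Rightarrow> nat \<Rightarrow> poly4) \<Rightarrow> bool" where
  "adapted i v \<longleftrightarrow> (\<forall>j<i. sect (Suc j) (v j) \<and> (\<forall>z. nz z \<longrightarrow> \<not> V j z (\<lambda>r. ev (v j r) z)))"

lemma adapted_sect: "adapted i v \<Longrightarrow> j < i \<Longrightarrow> nz z \<Longrightarrow> V i z (\<lambda>r. ev (v j r) z)"
  unfolding adapted_def sect_def using V_mono[of "Suc j" z _ i] by auto

lemma adapted_span:
  assumes "adapted i v" "nz z" "V i z u"
  shows "\<exists>c. \<forall>s<n. u s = (\<Sum>j<i. c j * ev (v j s) z)"
  using assms
proof (induction i arbitrary: u)
  case 0
  then show ?case using V_0 by auto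
next
  case (Suc i)
  have "adapted i v" using Suc.prems by (simp add: adapted_def)
  have v: "V (Suc i) z (\<lambda>r. ev (v i r) z)" "\<not> V i z (\<lambda>r. ev (v i r) z)"
    using Suc.prems by (auto simp: adapted_def sect_def)
  obtain a where "V i z (\<lambda>r. u r - a * ev (v i r) z)"
    using V_codim[OF Suc.prems(3) v] by blast
  from Suc.IH[OF \<open>adapted i v\<close> \<open>nz z\<close> this] obtain c
    where c: "\<forall>s<n. u s - a * ev (v i s) z = (\<Sum>j<i. c j * ev (v j s) z)" by blast
  have "\<forall>s<n. u s = (\<Sum>j<Suc i. (c(i := a)) j * ev (v j s) z)"
  proof (intro allI impI)
    fix s assume "s < n"
    then have "u s = (\<Sum>j<i. c j * ev (v j s) z) + a * ev (v i s) z" using c by (metis diff_add_cancel)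
    also have "(\<Sum>j<i. c j * ev (v j s) z) = (\<Sum>j<i. (c(i := a)) j * ev (v j s) z)"
      by (intro sum.cong) auto
    finally show "u s = (\<Sum>j<Suc i. (c(i := a)) j * ev (v j s) z)" by simp
  qed
  then show ?case by blast
qed

lemma adapted_dual:
  assumes "adapted i v" "nz z" "i \<le> n"
  shows "\<exists>C. \<forall>j<i. \<forall>l<i. dot n (C j) (\<lambda>r. ev (v l r) z) = (if j = l then 1 else 0)"
  using assms
proof (induction i)
  case (Suc i)
  have v: "adapted i v" using Suc.prems by (simp add: adapted_def)
  obtain C where C: "\<And>j l. j < i \<Longrightarrow> l < i \<Longrightarrow> dot n (C j) (\<lambda>r. ev (v l r) z) = (if j = l then 1 else 0)"
    using Suc.IH[OF v \<open>nz z\<close>] Suc.prems(3) by (meson Suc_leD)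
  let ?v = "\<lambda>l r. ev (v l r) z"
  let ?q = "dot n (H z i) (?v i)"
  have low: "dot n (H z i) (?v l) = 0" if "l < i" for l
    using adapted_sect[OF v that \<open>nz z\<close>] Suc.prems(3) unfolding V_def by auto
  have q: "?q \<noteq> 0"
  proof
    assume "?q = 0"
    moreover have "V (Suc i) z (?v i)" "\<not> V i z (?v i)"
      using Suc.prems(1,2) by (auto simp: adapted_def sect_def)
    ultimately show False unfolding V_def by (metis Suc_leI le_neq_implies_less)
  qed
  \<comment> \<open>Row \<open>i\<close> of \<open>H z\<close> kills the earlier vectors but not
    \<open>v i\<close>; rescaled, it is the new dual covector, and the old ones are corrected by
    multiples of it.\<close>
  define e where "e = (\<lambda>r. inverse ?q * H z i r)"
  have e: "dot n e (?v l) = (if l = i then 1 else 0)" if "l \<le> i" for l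
    using that low[of l] q by (auto simp: e_def dot_scale_left)
  define C' where "C' = (\<lambda>j. if j = i then e else (\<lambda>r. C j r - dot n (C j) (?v i) * e r))"
  have "dot n (C' j) (?v l) = (if j = l then 1 else 0)" if "j < Suc i" "l < Suc i" for j l
    using that by (cases "j = i"; cases "l = i") (auto simp: C'_def dot_diff_left dot_scale_left e C)
  then show ?case by blast
qed auto

lemma adapted_dual_polynomials:
  assumes "adapted i v" "nz z" "i \<le> n"
  shows "\<exists>\<mu> a. ev a z \<noteq> 0 \<and> (\<forall>j<i. \<forall>l<i. dot n (\<mu> j) (v l) = (if j = l then a else 0))"
  using adapted_dual[OF assms] dual_polynomials[of i n _ v z] by metis

lemma adapted_free:
  assumes v: "adapted i v" and i: "i \<le> n" and 0: "\<And>s. s < n \<Longrightarrow> (\<Sum>j<i. c j * v j s) = 0" and l: "l < i"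
  shows "c l = 0"
proof (rule ev_eqI_nz)
  fix z :: "nat \<Rightarrow> complex" assume z: "nz z"
  obtain \<mu> a where a: "ev a z \<noteq> 0" and \<mu>: "\<And>j l. j < i \<Longrightarrow> l < i \<Longrightarrow> dot n (\<mu> j) (v l) = (if j = l then a else 0)"
    using adapted_dual_polynomials[OF v z i] by blast
  have "0 = dot n (\<mu> l) (\<lambda>s. \<Sum>j<i. c j * v j s)"
    using 0 by (simp add: dot_def)
  also have "\<dots> = (\<Sum>j<i. c j * (if l = j then a else 0))"
    unfolding dot_sum dot_scale using \<mu> l by (intro sum.cong) auto
  also have "\<dots> = c l * a"
    using l by (simp add: if_distrib[of "\<lambda>x. _ * x"] cong: if_cong)
  finally show "ev (c l) z = ev 0 z" using a by (metis ev_simps(1) ev_simps(4) mult_eq_0_iff)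
qed

text \<open>The multipliers \<open>a\<close> for which \<open>a * u\<close> is a combination form an
  ideal without zeros off the origin, hence it contains powers of \<open>X 0\<close> and
  \<open>X 1\<close>. The two resulting expressions agree after cross-multiplication, and regularity
  of \<open>X 0 ^ N\<close>, \<open>X 1 ^ N\<close> permits \<open>X 0 ^ N\<close> to be
  cancelled.\<close>

lemma adapted_generate:
  assumes v: "adapted i v" and i: "i \<le> n" and u: "sect i u"
  shows "\<exists>c. \<forall>s<n. u s = (\<Sum>j<i. c j * v j s)"
proof -
  let ?I = "{a. \<exists>c. \<forall>s<n. a * u s = (\<Sum>j<i. c j * v j s)}"
  have "ideal4 ?I"
    unfolding ideal4_def
  proof (intro conjI ballI allI)
    show "0 \<in> ?I" by (auto intro!: exI[of _ "\<lambda>_. 0"])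
  next
    fix p q assume "p \<in> ?I" "q \<in> ?I"
    then obtain c c' where "\<forall>s<n. p * u s = (\<Sum>j<i. c j * v j s)" "\<forall>s<n. q * u s = (\<Sum>j<i. c' j * v j s)"
      by blast
    then have "\<forall>s<n. (p + q) * u s = (\<Sum>j<i. (c j + c' j) * v j s)"
      by (simp add: distrib_right sum.distrib)
    then show "p + q \<in> ?I" by (intro CollectI exI[of _ "\<lambda>j. c j + c' j"])
  next
    fix p q assume "q \<in> ?I"
    then obtain c where "\<forall>s<n. q * u s = (\<Sum>j<i. c j * v j s)" by blast
    then have "\<forall>s<n. (p * q) * u s = (\<Sum>j<i. (p * c j) * v j s)"
      unfolding mult.assoc sum_distrib_left[symmetric] by simp
    then show "p * q \<in> ?I" by (intro CollectI exI[of _ "\<lambda>j. p * c j"])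
  qed
  moreover have "\<exists>a\<in>?I. ev a z \<noteq> 0" if z: "nz z" for z
  proof -
    obtain \<mu> a where a: "ev a z \<noteq> 0" and \<mu>: "\<And>j l. j < i \<Longrightarrow> l < i \<Longrightarrow> dot n (\<mu> j) (v l) = (if j = l then a else 0)"
      using adapted_dual_polynomials[OF v z i] by blast
    have "a * u s = (\<Sum>j<i. dot n (\<mu> j) u * v j s)" if s: "s < n" for s
    proof (rule ev_eqI_nz)
      fix y :: "nat \<Rightarrow> complex" assume y: "nz y"
      obtain c where c: "\<And>s. s < n \<Longrightarrow> ev (u s) y = (\<Sum>j<i. c j * ev (v j s) y)"
        using adapted_span[OF v y] u y unfolding sect_def by blast
      have "ev (dot n (\<mu> j) u) y = ev a y * c j" if "j < i" for j
      proof -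
        have "ev (dot n (\<mu> j) u) y = dot n (\<lambda>r. ev (\<mu> j r) y) (\<lambda>s. \<Sum>l<i. c l * ev (v l s) y)"
          unfolding ev_dot by (intro dot_cong c)
        also have "\<dots> = (\<Sum>l<i. c l * ev (dot n (\<mu> j) (v l)) y)"
          by (simp add: dot_sum dot_scale ev_dot)
        also have "\<dots> = (\<Sum>l<i. c l * (if j = l then ev a y else 0))"
          using \<mu> that by (intro sum.cong) auto
        finally show ?thesis using that
          by (simp add: if_distrib[of "\<lambda>x. _ * x"] mult.commute cong: if_cong)
      qed
      then show "ev (a * u s) y = ev (\<Sum>j<i. dot n (\<mu> j) u * v j s) y"
        by (simp add: c[OF s] sum_distrib_left mult.assoc)
    qed
    then have "a \<in> ?I" by (intro CollectI exI[of _ "\<lambda>j. dot n (\<mu> j) u"]) blast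
    with a show ?thesis by blast
  qed
  ultimately obtain N where N: "\<And>l. l < 4 \<Longrightarrow> X l ^ N \<in> ?I"
    using power_X_in_ideal[of ?I] by blast
  from N[of 0] N[of 1] obtain a b
    where a: "\<And>s. s < n \<Longrightarrow> X 0 ^ N * u s = (\<Sum>j<i. a j * v j s)"
      and b: "\<And>s. s < n \<Longrightarrow> X 1 ^ N * u s = (\<Sum>j<i. b j * v j s)" by auto
  have "X 1 ^ N * a j - X 0 ^ N * b j = 0" if j: "j < i" for j
  proof (rule adapted_free[OF v i _ j])
    fix s assume s: "s < n"
    have "(\<Sum>j<i. (X 1 ^ N * a j - X 0 ^ N * b j) * v j s)
        = X 1 ^ N * (\<Sum>j<i. a j * v j s) - X 0 ^ N * (\<Sum>j<i. b j * v j s)"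
      unfolding left_diff_distrib sum_subtractf sum_distrib_left mult.assoc ..
    also have "\<dots> = 0" unfolding a[OF s, symmetric] b[OF s, symmetric] by (simp only: mult_ac diff_self)
    finally show "(\<Sum>j<i. (X 1 ^ N * a j - X 0 ^ N * b j) * v j s) = 0" .
  qed
  then have "X 0 ^ N dvd a j" if "j < i" for j
    using that by (intro X0_power_dvd[of N "a j"]) (metis dvd_triv_left eq_iff_diff_eq_0)
  then obtain c where c: "\<And>j. j < i \<Longrightarrow> a j = X 0 ^ N * c j" unfolding dvd_def by metis
  have "u s = (\<Sum>j<i. c j * v j s)" if s: "s < n" for s
  proof -
    have "X 0 ^ N * u s = X 0 ^ N * (\<Sum>j<i. c j * v j s)"
      unfolding a[OF s] sum_distrib_left by (intro sum.cong) (simp_all only: c lessThan_iff mult.assoc)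
    then show ?thesis by simp
  qed
  then show ?thesis by blast
qed


text \<open>If all covectors killing the frame also killed \<open>u\<close>, then \<open>u\<close>
  would be a combination of the frame at \<open>z\<close>.\<close>

lemma adapted_separate:
  assumes v: "adapted i v" and i: "i \<le> n" and z: "nz z" and u: "\<not> V i z u"
  shows "\<exists>\<theta>. (\<forall>j<i. dot n \<theta> (v j) = 0) \<and> dot n (\<lambda>r. ev (\<theta> r) z) u \<noteq> 0"
proof (rule ccontr)
  assume no: "\<not> ?thesis"
  obtain \<mu> a where a: "ev a z \<noteq> 0" and \<mu>: "\<And>j l. j < i \<Longrightarrow> l < i \<Longrightarrow> dot n (\<mu> j) (v l) = (if j = l then a else 0)"
    using adapted_dual_polynomials[OF v z i] by blast
  have eq: "ev a z * u r = (\<Sum>j<i. dot n (\<lambda>s. ev (\<mu> j s) z) u * ev (v j r) z)" if r: "r < n" for r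
  proof -
    \<comment> \<open>Row \<open>r\<close> of \<open>a\<close> times the identity minus the sum of
      the rank-one matrices \<open>v j \<mu> j\<close>, that is, of \<open>a\<close> times the
      projection along the frame; it kills every \<open>v l\<close>.\<close>
    define \<theta> where "\<theta> = (\<lambda>s. (if s = r then a else 0) - (\<Sum>j<i. v j r * \<mu> j s))"
    have "dot n \<theta> (v l) = 0" if l: "l < i" for l
    proof -
      have "dot n \<theta> (v l) = a * v l r - (\<Sum>j<i. v j r * dot n (\<mu> j) (v l))"
        unfolding \<theta>_def dot_diff_left dot_sum_left dot_scale_left dot_unit[OF r] ..
      also have "(\<Sum>j<i. v j r * dot n (\<mu> j) (v l)) = (\<Sum>j<i. v j r * (if j = l then a else 0))"
        using \<mu> l by (intro sum.cong) auto
      also have "\<dots> = v l r * a"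
        using l by (simp add: if_distrib[of "\<lambda>x. _ * x"] cong: if_cong)
      finally show ?thesis by (simp add: mult.commute)
    qed
    then have "dot n (\<lambda>s. ev (\<theta> s) z) u = 0" using no by blast
    moreover have "(\<lambda>s. ev (\<theta> s) z) = (\<lambda>s. (if s = r then ev a z else 0) - (\<Sum>j<i. ev (v j r) z * ev (\<mu> j s) z))"
      by (auto simp: \<theta>_def)
    ultimately have "ev a z * u r - (\<Sum>j<i. ev (v j r) z * dot n (\<lambda>s. ev (\<mu> j s) z) u) = 0"
      by (simp only: dot_diff_left dot_sum_left dot_scale_left dot_unit[OF r])
    then show ?thesis by (simp add: mult.commute)
  qed
  have "V i z (\<lambda>r. \<Sum>j<i. dot n (\<lambda>s. ev (\<mu> j s) z) u * ev (v j r) z)"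
    using adapted_sect[OF v _ z] by (intro V_sum V_scale) auto
  moreover have "V i z (\<lambda>r. ev a z * u r)
      \<longleftrightarrow> V i z (\<lambda>r. \<Sum>j<i. dot n (\<lambda>s. ev (\<mu> j s) z) u * ev (v j r) z)"
    by (rule V_cong) (rule eq)
  ultimately have "V i z (\<lambda>r. ev a z * u r)" by blast
  with a u show False using V_scaleD by blast
qed

lemma adapted_annihilate:
  assumes v: "adapted i v" and z: "nz z" and \<theta>: "\<And>j. j < i \<Longrightarrow> dot n \<theta> (v j) = 0" and u: "V i z u"
  shows "dot n (\<lambda>r. ev (\<theta> r) z) u = 0"
proof -
  obtain c where c: "\<And>s. s < n \<Longrightarrow> u s = (\<Sum>j<i. c j * ev (v j s) z)"
    using adapted_span[OF v z u] by blast
  have "dot n (\<lambda>r. ev (\<theta> r) z) u = dot n (\<lambda>r. ev (\<theta> r) z) (\<lambda>s. \<Sum>j<i. c j * ev (v j s) z)"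
    by (intro dot_cong c)
  also have "\<dots> = (\<Sum>j<i. c j * ev (dot n \<theta> (v j)) z)"
    by (simp add: dot_sum dot_scale ev_dot)
  also have "\<dots> = 0" by (simp add: \<theta>)
  finally show ?thesis .
qed

lemma sect_add: "sect i u \<Longrightarrow> sect i w \<Longrightarrow> sect i (\<lambda>r. u r + w r)"
  by (simp add: sect_def V_add)

lemma sect_diff: "sect i u \<Longrightarrow> sect i w \<Longrightarrow> sect i (\<lambda>r. u r - w r)"
  by (simp add: sect_def V_diff)

lemma sect_scale: "sect i w \<Longrightarrow> sect i (\<lambda>r. p * w r)"
  by (simp add: sect_def V_scale)

lemma sect_mono: "sect i w \<Longrightarrow> i \<le> j \<Longrightarrow> sect j w"
  by (meson V_mono sect_def)

lemma sect_sum: "(\<And>j. j \<in> A \<Longrightarrow> sect i (f j)) \<Longrightarrow> sect i (\<lambda>r. \<Sum>j\<in>A. f j r)"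
  by (simp add: sect_def V_sum)

text \<open>The quotient of consecutive flag members is a line bundle, hence of the form \<open>\<O>(d)\<close> because
  polynomial rings are factorial: \<open>f\<close> sends a section of the larger bundle to its image in the quotient.\<close>

lemma line_quotient:
  assumes v: "adapted i v" and i: "i < k"
  obtains \<theta> :: "nat \<Rightarrow> poly4" and g :: poly4
  where "g \<noteq> 0" "\<And>j. j < i \<Longrightarrow> dot n \<theta> (v j) = 0" "\<And>w. sect (Suc i) w \<Longrightarrow> g dvd dot n \<theta> w"
    "\<And>z. nz z \<Longrightarrow> \<exists>w s. sect (Suc i) w \<and> dot n \<theta> w = g * s \<and> ev s z \<noteq> 0"
    "\<And>w f z. sect (Suc i) w \<Longrightarrow> dot n \<theta> w = g * f \<Longrightarrow> nz z \<Longrightarrow>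
      ev f z = 0 \<longleftrightarrow> V i z (\<lambda>r. ev (w r) z)"
proof -
  have i': "i \<le> n" using i kn by simp
  have loc: "\<exists>w. sect (Suc i) w \<and> \<not> V i z (\<lambda>r. ev (w r) z)" if "nz z" for z
    using local_section[OF that i] unfolding sect_def by blast
  have z1: "nz (\<lambda>_. 1)" by (intro exI[of _ 0]) simp
  obtain w0 where w0: "sect (Suc i) w0" "\<not> V i (\<lambda>_. 1) (\<lambda>r. ev (w0 r) (\<lambda>_. 1))"
    using loc[OF z1] by blast
  obtain \<theta> where \<theta>: "\<And>j. j < i \<Longrightarrow> dot n \<theta> (v j) = 0" "ev (dot n \<theta> w0) (\<lambda>_. 1) \<noteq> 0"
    using adapted_separate[OF v i' z1 w0(2)] unfolding ev_dot by blast
  have \<theta>w0: "dot n \<theta> w0 \<noteq> 0" using \<theta>(2) by auto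
  \<comment> \<open>\<open>g\<close> is the common factor of the values of \<open>\<theta>\<close>
    on sections; after division by it, \<open>\<theta>\<close> will be a nowhere vanishing
    functional on the line bundle.\<close>
  define g where "g = Gcd (dot n \<theta> ` Collect (sect (Suc i)))"
  have g: "g dvd dot n \<theta> w" if "sect (Suc i) w" for w
    unfolding g_def using that by (intro Gcd_dvd) auto
  have g0: "g \<noteq> 0" using g[OF w0(1)] \<theta>w0 by auto
  \<comment> \<open>Two functionals that kill \<open>V i\<close> are proportional on the line
    \<open>V (Suc i) / V i\<close>, so their values on two sections form a 2 by 2 matrix of
    determinant zero.\<close>
  have rel: "dot n \<kappa> w * dot n \<theta> w' = dot n \<theta> w * dot n \<kappa> w'"
    if w: "sect (Suc i) w" "sect (Suc i) w'" and \<kappa>: "\<And>j. j < i \<Longrightarrow> dot n \<kappa> (v j) = 0" for \<kappa> w w'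
  proof (rule ev_eqI_nz)
    fix z :: "nat \<Rightarrow> complex" assume z: "nz z"
    let ?w = "\<lambda>r. ev (w r) z" and ?w' = "\<lambda>r. ev (w' r) z"
    let ?K = "dot n (\<lambda>r. ev (\<kappa> r) z)" and ?L = "dot n (\<lambda>r. ev (\<theta> r) z)"
    have K: "?K u = 0" "?L u = 0" if "V i z u" for u
      using adapted_annihilate[OF v z _ that] \<kappa> \<theta>(1) by blast+
    have S: "V (Suc i) z ?w" "V (Suc i) z ?w'" using w z unfolding sect_def by blast+
    show "ev (dot n \<kappa> w * dot n \<theta> w') z = ev (dot n \<theta> w * dot n \<kappa> w') z"
    proof (cases "V i z ?w'")
      case True
      then show ?thesis by (simp add: ev_dot K)
    next
      case False
      obtain c where "V i z (\<lambda>r. ?w r - c * ?w' r)" using V_codim[OF S False] by blast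
      from K[OF this] have "?K ?w = c * ?K ?w'" "?L ?w = c * ?L ?w'"
        by (simp_all add: dot_diff dot_scale)
      then show ?thesis by (simp add: ev_dot)
    qed
  qed
  have gen: "\<exists>w s. sect (Suc i) w \<and> dot n \<theta> w = g * s \<and> ev s z \<noteq> 0 \<and> \<not> V i z (\<lambda>r. ev (w r) z)"
    if z: "nz z" for z
  proof -
    obtain w1 where w1: "sect (Suc i) w1" "\<not> V i z (\<lambda>r. ev (w1 r) z)" using loc[OF z] by blast
    obtain \<kappa> where \<kappa>: "\<And>j. j < i \<Longrightarrow> dot n \<kappa> (v j) = 0" "ev (dot n \<kappa> w1) z \<noteq> 0"
      using adapted_separate[OF v i' z w1(2)] unfolding ev_dot by blast
    \<comment> \<open>By \<open>rel\<close>, \<open>dot n \<theta> w1\<close> divides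
      \<open>dot n \<theta> w * dot n \<kappa> w1\<close> for every section \<open>w\<close>, and
      hence \<open>g * dot n \<kappa> w1\<close>. Therefore the cofactor \<open>s\<close> divides
      \<open>dot n \<kappa> w1\<close> and inherits its nonvanishing at \<open>z\<close>.\<close>
    have "dot n \<theta> w1 dvd g * dot n \<kappa> w1"
      unfolding g_def
    proof (rule dvd_Gcd_mult)
      fix x assume "x \<in> dot n \<theta> ` Collect (sect (Suc i))"
      then obtain w where w: "sect (Suc i) w" "x = dot n \<theta> w" by blast
      have "x * dot n \<kappa> w1 = dot n \<theta> w1 * dot n \<kappa> w"
        using rel[OF w(1) w1(1) \<kappa>(1)] by (simp only: w(2) mult.commute)
      then show "dot n \<theta> w1 dvd x * dot n \<kappa> w1" by (simp only: dvd_triv_left)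
    qed
    then obtain e where e: "g * dot n \<kappa> w1 = dot n \<theta> w1 * e" by (elim dvdE)
    obtain s where s: "dot n \<theta> w1 = g * s" using g[OF w1(1)] by (elim dvdE)
    have "dot n \<kappa> w1 = s * e" using e g0 unfolding s mult.assoc by simp
    then have "ev s z \<noteq> 0" using \<kappa>(2) by auto
    with w1 s show ?thesis by blast
  qed
  have zero: "ev f z = 0 \<longleftrightarrow> V i z (\<lambda>r. ev (w r) z)"
    if w: "sect (Suc i) w" and f: "dot n \<theta> w = g * f" and z: "nz z" for w f z
  proof -
    obtain w1 s where w1: "sect (Suc i) w1" "dot n \<theta> w1 = g * s" "ev s z \<noteq> 0" "\<not> V i z (\<lambda>r. ev (w1 r) z)"
      using gen[OF z] by blast
    have eq: "dot n \<kappa> w * s = f * dot n \<kappa> w1" if \<kappa>: "\<And>j. j < i \<Longrightarrow> dot n \<kappa> (v j) = 0" for \<kappa>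
    proof -
      have "g * (dot n \<kappa> w * s) = g * (f * dot n \<kappa> w1)"
        using rel[OF w w1(1) \<kappa>] unfolding f w1(2) by (simp only: mult_ac)
      then show ?thesis using g0 by simp
    qed
    show ?thesis
    proof
      assume f0: "ev f z = 0"
      show "V i z (\<lambda>r. ev (w r) z)"
      proof (rule ccontr)
        assume "\<not> ?thesis"
        then obtain \<kappa> where \<kappa>: "\<And>j. j < i \<Longrightarrow> dot n \<kappa> (v j) = 0" "ev (dot n \<kappa> w) z \<noteq> 0"
          using adapted_separate[OF v i' z] unfolding ev_dot by blast
        have "ev (dot n \<kappa> w) z * ev s z = 0"
          using arg_cong[OF eq[OF \<kappa>(1)], of "\<lambda>p. ev p z"] f0 by simp
        then show False using \<kappa>(2) w1(3) by simp
      qed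
    next
      assume V: "V i z (\<lambda>r. ev (w r) z)"
      obtain \<kappa> where \<kappa>: "\<And>j. j < i \<Longrightarrow> dot n \<kappa> (v j) = 0" "ev (dot n \<kappa> w1) z \<noteq> 0"
        using adapted_separate[OF v i' z w1(4)] unfolding ev_dot by blast
      have "ev (dot n \<kappa> w) z = 0"
        unfolding ev_dot by (rule adapted_annihilate[OF v z \<kappa>(1) V])
      then have "ev f z * ev (dot n \<kappa> w1) z = 0"
        using arg_cong[OF eq[OF \<kappa>(1)], of "\<lambda>p. ev p z"] by simp
      then show "ev f z = 0" using \<kappa>(2) by simp
    qed
  qed
  show ?thesis
  proof (rule that[OF g0 \<theta>(1) g _ zero])
    show "\<exists>w s. sect (Suc i) w \<and> dot n \<theta> w = g * s \<and> ev s z \<noteq> 0" if "nz z" for z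
      using gen[OF that] by (elim exE conjE) (intro exI conjI)
  qed
qed

text \<open>Local generators \<open>w\<^sub>l\<close> of the line bundle over the charts \<open>X l \<noteq> 0\<close> lift its trivialisation,
  up to the factor \<open>X l ^ N\<close>. They differ by sections of the smaller bundle, and this cocycle is a
  coboundary because \<open>H\<^sup>1\<close> of the twists of \<open>\<O>\<close> vanishes on projective space of dimension at least 2.\<close>

lemma lift_generator:
  assumes v: "adapted i v" and i: "i < k"
    and g: "g \<noteq> 0" and \<theta>: "\<And>j. j < i \<Longrightarrow> dot n \<theta> (v j) = 0"
    and gen: "\<And>z. nz z \<Longrightarrow> \<exists>w s. sect (Suc i) w \<and> dot n \<theta> w = g * s \<and> ev s z \<noteq> 0"
    and zero: "\<And>w f z. sect (Suc i) w \<Longrightarrow> dot n \<theta> w = g * f \<Longrightarrow> nz z \<Longrightarrow>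
      ev f z = 0 \<longleftrightarrow> V i z (\<lambda>r. ev (w r) z)"
  shows "\<exists>w. sect (Suc i) w \<and> dot n \<theta> w = g"
proof -
  have i': "i \<le> n" using i kn by simp
  \<comment> \<open>\<open>?I\<close> records which multiples of \<open>g\<close> are values of
    \<open>\<theta>\<close> on sections; the aim is that it contains 1.\<close>
  let ?I = "{f. \<exists>w. sect (Suc i) w \<and> dot n \<theta> w = g * f}"
  have "ideal4 ?I"
    unfolding ideal4_def
  proof (intro conjI ballI allI)
    show "0 \<in> ?I" by (intro CollectI exI[of _ "\<lambda>_. 0"]) (simp add: sect_def V_zero)
  next
    fix p q assume "p \<in> ?I" "q \<in> ?I"
    then obtain w w' where "sect (Suc i) w" "dot n \<theta> w = g * p" "sect (Suc i) w'" "dot n \<theta> w' = g * q"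
      by blast
    then show "p + q \<in> ?I"
      by (intro CollectI exI[of _ "\<lambda>r. w r + w' r"] conjI sect_add) (simp_all only: dot_add distrib_left)
  next
    fix p q assume "q \<in> ?I"
    then obtain w where "sect (Suc i) w" "dot n \<theta> w = g * q" by blast
    then show "p * q \<in> ?I"
      by (intro CollectI exI[of _ "\<lambda>r. p * w r"] conjI sect_scale) (simp_all only: dot_scale mult.left_commute)
  qed
  moreover have "\<exists>f\<in>?I. ev f z \<noteq> 0" if z: "nz z" for z
  proof -
    obtain w s where "sect (Suc i) w" "dot n \<theta> w = g * s" "ev s z \<noteq> 0"
      using gen[OF z] by (elim exE conjE)
    then show ?thesis by (intro bexI[of _ s] CollectI exI[of _ w] conjI)
  qed
  ultimately obtain N where N: "\<And>l. l < 4 \<Longrightarrow> X l ^ N \<in> ?I"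
    using power_X_in_ideal[of ?I] by blast
  then have "\<forall>l\<in>{..<4}. \<exists>w. sect (Suc i) w \<and> dot n \<theta> w = g * X l ^ N" by simp
  from bchoice[OF this] obtain w where w: "\<And>l. l < 4 \<Longrightarrow> sect (Suc i) (w l)"
    and \<theta>w: "\<And>l. l < 4 \<Longrightarrow> dot n \<theta> (w l) = g * X l ^ N" by auto
  have lt4: "(0 :: nat) < 4" "(1 :: nat) < 4" "(2 :: nat) < 4" by auto
  \<comment> \<open>On the overlap of two charts the generators are compared by a section killed by
    \<open>\<theta>\<close>, which therefore lies in \<open>V i\<close> and is a combination of the
    frame.\<close>
  have pre: "\<exists>c. \<forall>s<n. X l ^ N * w m s - X m ^ N * w l s = (\<Sum>j<i. c j * v j s)"
    if "l < 4" "m < 4" for l m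
  proof (rule adapted_generate[OF v i'])
    let ?u = "\<lambda>s. X l ^ N * w m s - X m ^ N * w l s"
    have S: "sect (Suc i) ?u" using w that by (intro sect_diff sect_scale)
    have eq: "dot n \<theta> ?u = g * 0"
      unfolding dot_diff dot_scale \<theta>w[OF that(1)] \<theta>w[OF that(2)] by (simp add: mult_ac)
    show "sect i ?u" unfolding sect_def using zero[OF S eq] ev_simps(1) by blast
  qed
  obtain c01 where c01: "\<And>s. s < n \<Longrightarrow> X 0 ^ N * w 1 s - X 1 ^ N * w 0 s = (\<Sum>j<i. c01 j * v j s)"
    using pre[OF lt4(1) lt4(2)] by blast
  obtain c02 where c02: "\<And>s. s < n \<Longrightarrow> X 0 ^ N * w 2 s - X 2 ^ N * w 0 s = (\<Sum>j<i. c02 j * v j s)"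
    using pre[OF lt4(1) lt4(3)] by blast
  obtain c12 where c12: "\<And>s. s < n \<Longrightarrow> X 1 ^ N * w 2 s - X 2 ^ N * w 1 s = (\<Sum>j<i. c12 j * v j s)"
    using pre[OF lt4(2) lt4(3)] by blast
  \<comment> \<open>The three differences satisfy the cocycle identity, which passes to the
    coefficients because the frame is free. \<open>X_colon\<close> then writes \<open>c01 j\<close>
    as a coboundary.\<close>
  have "X 2 ^ N * c01 j - X 1 ^ N * c02 j + X 0 ^ N * c12 j = 0" if j: "j < i" for j
  proof (rule adapted_free[OF v i' _ j])
    fix s assume s: "s < n"
    have "(\<Sum>j<i. (X 2 ^ N * c01 j - X 1 ^ N * c02 j + X 0 ^ N * c12 j) * v j s)
        = X 2 ^ N * (\<Sum>j<i. c01 j * v j s) - X 1 ^ N * (\<Sum>j<i. c02 j * v j s) + X 0 ^ N * (\<Sum>j<i. c12 j * v j s)"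
      unfolding left_diff_distrib distrib_right sum.distrib sum_subtractf sum_distrib_left mult.assoc ..
    also have "\<dots> = 0"
      unfolding c01[OF s, symmetric] c02[OF s, symmetric] c12[OF s, symmetric]
      by (simp add: algebra_simps)
    finally show "(\<Sum>j<i. (X 2 ^ N * c01 j - X 1 ^ N * c02 j + X 0 ^ N * c12 j) * v j s) = 0" .
  qed
  then have "\<exists>\<alpha> \<beta>. c01 j = X 0 ^ N * \<alpha> + X 1 ^ N * \<beta>" if "j < i" for j
    using that by (intro X_colon[where a = "c02 j" and b = "c12 j"]) (simp add: add_eq_0_iff2 diff_eq_eq)
  then have "\<forall>j. \<exists>\<alpha> \<beta>. j < i \<longrightarrow> c01 j = X 0 ^ N * \<alpha> + X 1 ^ N * \<beta>" by blast
  then obtain \<alpha> \<beta> where \<alpha>\<beta>: "\<And>j. j < i \<Longrightarrow> c01 j = X 0 ^ N * \<alpha> j + X 1 ^ N * \<beta> j" by metis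
  \<comment> \<open>Correcting \<open>w 0\<close> by the \<open>\<beta>\<close> part makes
    \<open>X 1 ^ N * u\<close> equal to \<open>X 0 ^ N\<close> times \<open>w 1\<close> corrected by
    the \<open>\<alpha>\<close> part; hence \<open>X 0 ^ N\<close> divides \<open>u\<close>.\<close>
  define u where "u = (\<lambda>s. w 0 s + (\<Sum>j<i. \<beta> j * v j s))"
  have "X 0 ^ N dvd u s" if s: "s < n" for s
  proof (rule X0_power_dvd)
    have "(\<Sum>j<i. c01 j * v j s) = (\<Sum>j<i. (X 0 ^ N * \<alpha> j + X 1 ^ N * \<beta> j) * v j s)"
      using \<alpha>\<beta> by (intro sum.cong) auto
    also have "\<dots> = X 0 ^ N * (\<Sum>j<i. \<alpha> j * v j s) + X 1 ^ N * (\<Sum>j<i. \<beta> j * v j s)"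
      unfolding distrib_right sum.distrib sum_distrib_left mult.assoc ..
    finally have "X 1 ^ N * u s = X 0 ^ N * (w 1 s - (\<Sum>j<i. \<alpha> j * v j s))"
      using c01[OF s] unfolding u_def right_diff_distrib distrib_left by (simp only: diff_eq_eq algebra_simps)
    then show "X 0 ^ N dvd X 1 ^ N * u s" by (simp only: dvd_triv_left)
  qed
  then have "\<forall>s. \<exists>y. s < n \<longrightarrow> u s = X 0 ^ N * y" unfolding dvd_def by blast
  from choice[OF this] obtain y where y: "\<And>s. s < n \<Longrightarrow> u s = X 0 ^ N * y s" by blast
  have u_sect: "sect (Suc i) u"
    unfolding u_def
  proof (intro sect_add w sect_sum sect_scale)
    fix j assume "j \<in> {..<i}"
    then have "j < i" by simp
    then show "sect (Suc i) (v j)"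
      using v unfolding adapted_def by (meson Suc_leI le_SucI less_SucI sect_mono)
  qed simp
  have \<theta>u: "dot n \<theta> u = g * X 0 ^ N"
    unfolding u_def dot_add dot_sum dot_scale using \<theta>w[of 0] \<theta> by simp
  have "X 0 ^ N * dot n \<theta> y = X 0 ^ N * g"
  proof -
    have "X 0 ^ N * dot n \<theta> y = dot n \<theta> (\<lambda>s. X 0 ^ N * y s)" by (simp only: dot_scale)
    also have "\<dots> = dot n \<theta> u" by (intro dot_cong) (simp only: y)
    finally show ?thesis using \<theta>u by (simp only: mult.commute)
  qed
  then have \<theta>y: "dot n \<theta> y = g" by simp
  \<comment> \<open>Where \<open>X 0\<close> vanishes nothing is known yet about \<open>y\<close>,
    the quotient of \<open>u\<close> by \<open>X 0 ^ N\<close>. There \<open>s * y\<close> is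
    compared with a section \<open>w1\<close> of value \<open>g * s\<close>: their difference lies
    in \<open>V i\<close> after multiplication by \<open>X 0 ^ N\<close>, and the separating
    covectors, being polynomial, cancel this factor.\<close>
  have "V (Suc i) z (\<lambda>r. ev (y r) z)" if z: "nz z" for z
  proof -
    obtain w1 s where w1: "sect (Suc i) w1" "dot n \<theta> w1 = g * s" "ev s z \<noteq> 0"
      using gen[OF z] by blast
    define q where "q = (\<lambda>r. s * y r - w1 r)"
    have S: "sect (Suc i) (\<lambda>r. s * u r - X 0 ^ N * w1 r)"
      using u_sect w1(1) by (intro sect_diff sect_scale)
    have eq: "dot n \<theta> (\<lambda>r. s * u r - X 0 ^ N * w1 r) = g * 0"
      unfolding dot_diff dot_scale \<theta>u w1(2) by (simp add: mult_ac)
    have low: "V i x (\<lambda>r. ev (s * u r - X 0 ^ N * w1 r) x)" if "nz x" for x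
      using zero[OF S eq that] ev_simps(1) by blast
    have "V i z (\<lambda>r. ev (q r) z)"
    proof (rule ccontr)
      assume "\<not> ?thesis"
      then obtain \<kappa> where \<kappa>: "\<And>j. j < i \<Longrightarrow> dot n \<kappa> (v j) = 0" "ev (dot n \<kappa> q) z \<noteq> 0"
        using adapted_separate[OF v i' z] unfolding ev_dot by blast
      have "X 0 ^ N * dot n \<kappa> q = 0"
      proof (rule ev_eqI_nz)
        fix x :: "nat \<Rightarrow> complex" assume x: "nz x"
        have "X 0 ^ N * dot n \<kappa> q = dot n \<kappa> (\<lambda>r. s * u r - X 0 ^ N * w1 r)"
          unfolding dot_scale[symmetric] q_def
          by (intro dot_cong) (simp only: y right_diff_distrib mult.left_commute)
        then show "ev (X 0 ^ N * dot n \<kappa> q) x = ev 0 x"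
          using adapted_annihilate[OF v x \<kappa>(1) low[OF x]] by (simp only: ev_dot ev_simps(1))
      qed
      then show False using \<kappa>(2) by simp
    qed
    then have "V (Suc i) z (\<lambda>r. ev (q r) z)" by (rule V_mono) simp
    moreover have "V (Suc i) z (\<lambda>r. ev (w1 r) z)" using w1(1) z unfolding sect_def by blast
    ultimately have "V (Suc i) z (\<lambda>r. ev (q r) z + ev (w1 r) z)" by (rule V_add)
    then have "V (Suc i) z (\<lambda>r. ev s z * ev (y r) z)" by (simp add: q_def)
    then show ?thesis using w1(3) by (rule V_scaleD)
  qed
  with \<theta>y show ?thesis unfolding sect_def by blast
qed

end

lemma homog_decomposition_vec:
  fixes n :: nat
  shows "\<exists>c D. (\<forall>d r. homog d (c d r)) \<and> (\<forall>r<n. w r = (\<Sum>d\<le>D. c d r))"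
proof -
  have "\<forall>r. \<exists>c D. (\<forall>d. homog d (c d)) \<and> (\<forall>d>D. c d = 0) \<and> w r = (\<Sum>d\<le>D. c d)"
    using homog_decomposition by blast
  from choice[OF this] obtain c
    where "\<forall>r. \<exists>D. (\<forall>d. homog d (c r d)) \<and> (\<forall>d>D. c r d = 0) \<and> w r = (\<Sum>d\<le>D. c r d)" by blast
  from choice[OF this] obtain D
    where D: "\<forall>r. (\<forall>d. homog d (c r d)) \<and> (\<forall>d>D r. c r d = 0) \<and> w r = (\<Sum>d\<le>D r. c r d)" by blast
  have c: "\<And>r d. homog d (c r d)" "\<And>r d. d > D r \<Longrightarrow> c r d = 0" "\<And>r. w r = (\<Sum>d\<le>D r. c r d)"
    using D[rule_format] by simp_all
  have "w r = (\<Sum>d\<le>\<Sum>r<n. D r. c r d)" if "r < n" for r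
  proof -
    have "D r \<le> (\<Sum>r<n. D r)" using that by (simp add: member_le_sum)
    then show ?thesis
      unfolding c(3)[of r] by (intro sum.mono_neutral_left) (auto intro: c(2))
  qed
  then show ?thesis
    by (intro exI[of _ "\<lambda>d r. c r d"] exI[of _ "\<Sum>r<n. D r"] conjI allI impI c(1))
qed

section \<open>Homogeneous frames adapted to the flag\<close>

context flag_map begin

text \<open>The lift \<open>w\<close> need not be homogeneous. Its components have values
  \<open>g * f d\<close> with the \<open>f d\<close> summing to 1, so some \<open>f d\<close> is
  nonzero at the origin. A zero of that \<open>f d\<close> would spread by homothety along a
  punctured line and reach the origin, so this component generates everywhere.\<close>

lemma adapted_extend:
  assumes v: "adapted i v" and i: "i < k"
  shows "\<exists>w d. (\<forall>r. homog d (w r)) \<and> sect (Suc i) w \<and> (\<forall>z. nz z \<longrightarrow> \<not> V i z (\<lambda>r. ev (w r) z))"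
proof -
  obtain \<theta> g where g: "g \<noteq> 0" and \<theta>: "\<And>j. j < i \<Longrightarrow> dot n \<theta> (v j) = 0"
    and dvd: "\<And>w. sect (Suc i) w \<Longrightarrow> g dvd dot n \<theta> w"
    and gen: "\<And>z. nz z \<Longrightarrow> \<exists>w s. sect (Suc i) w \<and> dot n \<theta> w = g * s \<and> ev s z \<noteq> 0"
    and zero: "\<And>w f z. sect (Suc i) w \<Longrightarrow> dot n \<theta> w = g * f \<Longrightarrow> nz z \<Longrightarrow>
      ev f z = 0 \<longleftrightarrow> V i z (\<lambda>r. ev (w r) z)"
    by (rule line_quotient[OF v i], rule that; assumption)
  have "\<exists>w. sect (Suc i) w \<and> dot n \<theta> w = g"
    by (rule lift_generator[OF v i]) fact+
  then obtain w where w: "sect (Suc i) w" "dot n \<theta> w = g" by blast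
  obtain c D where c: "\<And>d r. homog d (c d r)" "\<And>r. r < n \<Longrightarrow> w r = (\<Sum>d\<le>D. c d r)"
    using homog_decomposition_vec by blast
  have S: "sect (Suc i) (c d)" if "d \<le> D" for d
    using i by (intro sect_homog_component[OF w(1) _ c(2) c(1) that]) auto
  have "\<exists>f. dot n \<theta> (c d) = g * f" if "d \<le> D" for d
    using dvd[OF S[OF that]] by (simp only: dvd_def)
  then have "\<forall>d\<in>{..D}. \<exists>f. dot n \<theta> (c d) = g * f" by simp
  from bchoice[OF this] obtain f where f: "\<And>d. d \<le> D \<Longrightarrow> dot n \<theta> (c d) = g * f d" by auto
  have "g * (\<Sum>d\<le>D. f d) = (\<Sum>d\<le>D. dot n \<theta> (c d))"
    unfolding sum_distrib_left by (intro sum.cong) (simp_all only: f atMost_iff)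
  also have "\<dots> = dot n \<theta> w" unfolding dot_sum[symmetric] by (intro dot_cong) (simp only: c(2))
  finally have "(\<Sum>d\<le>D. f d) = 1" using g w(2) by simp
  then have "(\<Sum>d\<le>D. ev (f d) (\<lambda>_. 0)) \<noteq> 0" by (metis ev_sum ev_simps(2) zero_neq_one)
  then obtain d where d: "d \<le> D" "ev (f d) (\<lambda>_. 0) \<noteq> 0"
    by (meson atMost_iff sum.not_neutral_contains_not_neutral)
  have "\<not> V i z (\<lambda>r. ev (c d r) z)" if z: "nz z" for z
  proof
    assume V: "V i z (\<lambda>r. ev (c d r) z)"
    obtain h E where h: "\<And>e. homog e (h e)" "f d = (\<Sum>e\<le>E. h e)"
      using homog_decomposition by blast
    have hom: "ev (f d) (\<lambda>l. t * z l) = (\<Sum>e\<le>E. t ^ e * ev (h e) z)" for t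
      by (simp add: h(2) homog_scale[OF h(1)])
    have vanish: "(\<Sum>e\<le>E. t ^ e * ev (h e) z) = 0" if t: "t \<noteq> 0" for t
    proof -
      have tz: "nz (\<lambda>l. t * z l)" using z t by auto
      have "V i (\<lambda>l. t * z l) (\<lambda>r. ev (c d r) (\<lambda>l. t * z l))"
        unfolding homog_scale[OF c(1)] using V V_homothety[OF z t, of i] i by (simp add: V_scale)
      then have "ev (f d) (\<lambda>l. t * z l) = 0"
        using zero[OF S[OF d(1)] f[OF d(1)] tz] by blast
      then show ?thesis by (simp only: hom)
    qed
    have "ev (h e) z = 0" if "e \<le> E" for e
      by (rule coeffs_zero[OF vanish that])
    then have "ev (f d) (\<lambda>l. 0 * z l) = 0" unfolding hom by (intro sum.neutral) auto
    then show False using d(2) by simp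
  qed
  then show ?thesis using S[OF d(1)] c(1) by blast
qed

theorem homogeneous_adapted_frame:
  "\<exists>v b. adapted k v \<and> (\<forall>j<k. \<forall>r. homog (b j) (v j r))"
proof -
  have "\<exists>v b. adapted i v \<and> (\<forall>j<i. \<forall>r. homog (b j) (v j r))" if "i \<le> k" for i
    using that
  proof (induction i)
    case 0
    then show ?case by (simp add: adapted_def)
  next
    case (Suc i)
    then obtain v b where v: "adapted i v" "\<forall>j<i. \<forall>r. homog (b j) (v j r)" by auto
    obtain w d where "\<forall>r. homog d (w r)" "sect (Suc i) w" "\<forall>z. nz z \<longrightarrow> \<not> V i z (\<lambda>r. ev (w r) z)"
      using adapted_extend[OF v(1)] Suc.prems by auto
    then show ?case
      using v by (intro exI[of _ "v(i := w)"] exI[of _ "b(i := d)"]) (simp add: adapted_def less_Suc_eq)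
  qed
  then show ?thesis by blast
qed

end

section \<open>Degrees of a homogeneous frame\<close>

text \<open>Sorting by the last exponent and comparing coefficients of the last variable removes one
  variable. The separation hypothesis stands in for membership in \<open>expo K\<close>, which the
  sorted subsets would not inherit for fewer variables.\<close>

lemma monom_fun_independent:
  assumes "finite A" "\<And>e e'. e \<in> A \<Longrightarrow> e' \<in> A \<Longrightarrow> (\<And>i. i < K \<Longrightarrow> e i = e' i) \<Longrightarrow> e = e'"
    "\<And>z. (\<Sum>e\<in>A. r e * monom_fun K e z) = 0" "e \<in> A"
  shows "r e = 0"
  using assms
proof (induction K arbitrary: A e)
  case 0
  then have "A = {e}" by auto
  with 0 show ?case by (simp add: monom_fun_def)
next
  case (Suc K)
  define D where "D = (\<Sum>e\<in>A. e K)"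
  define B where "B d = {e \<in> A. e K = d}" for d
  have le: "e K \<le> D" if "e \<in> A" for e
    unfolding D_def using Suc.prems(1) that member_le_sum[of e A "\<lambda>e. e K"] by simp
  have "(\<Sum>e\<in>B d. r e * monom_fun K e z) = 0" if d: "d \<le> D" for z d
  proof (rule coeffs_zero[OF _ d])
    fix t :: complex
    have "(\<Sum>d\<le>D. t ^ d * (\<Sum>e\<in>B d. r e * monom_fun K e z))
        = (\<Sum>d\<le>D. \<Sum>e\<in>{e \<in> A. e K = d}. r e * monom_fun (Suc K) e (z(K := t)))"
      unfolding sum_distrib_left B_def
      by (intro sum.cong refl) (auto simp: monom_fun_def intro!: prod.cong)
    also have "\<dots> = (\<Sum>e\<in>A. r e * monom_fun (Suc K) e (z(K := t)))"
      using Suc.prems(1) le by (intro sum.group) auto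
    finally show "(\<Sum>d\<le>D. t ^ d * (\<Sum>e\<in>B d. r e * monom_fun K e z)) = 0"
      using Suc.prems(3) by simp
  qed
  then have 0: "(\<Sum>e'\<in>B (e K). r e' * monom_fun K e' z) = 0" for z
    using le[OF Suc.prems(4)] by blast
  show ?case
  proof (rule Suc.IH[OF _ _ 0])
    show "finite (B (e K))" using Suc.prems(1) by (simp add: B_def)
    show "e \<in> B (e K)" using Suc.prems(4) by (simp add: B_def)
    fix f f' assume "f \<in> B (e K)" "f' \<in> B (e K)" "\<And>i. i < K \<Longrightarrow> f i = f' i"
    then show "f = f'" by (intro Suc.prems(2)) (auto simp: B_def less_Suc_eq)
  qed
qed

lemma homog_add: "homog d p \<Longrightarrow> homog d q \<Longrightarrow> homog d (p + q)"
  unfolding homog_def using fs.span_add[of "ev p" _ "ev q"] by (simp add: plus_fun_def ev_simps(3)[abs_def])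

lemma homog_cst_mult: "homog d p \<Longrightarrow> homog d (cst c * p)"
  unfolding homog_def using fs.span_scale[of "ev p" _ c] by (simp add: ev_simps(4,8)[abs_def])

lemma homog_sum: "(\<And>a. a \<in> A \<Longrightarrow> homog d (f a)) \<Longrightarrow> homog d (sum f A)"
  by (induction A rule: infinite_finite_induct) (auto intro: homog_add)

lemma homog_0_const: "homog 0 p \<Longrightarrow> ev p z = ev p (\<lambda>_. 0)"
  using homog_scale[of 0 p 0 z] by simp

lemma homog_times_monom_fun:
  assumes "homog d p" "e \<in> expo K" "4 \<le> K"
  shows "(\<lambda>z. ev p z * monom_fun K e z) \<in> fs.span (monom_fun K `
    {e' \<in> expo K. (\<forall>i\<ge>4. e' i = e i) \<and> (\<Sum>l<4. e' l) = d + (\<Sum>l<4. e l)})"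
proof (rule span_mult)
  show "ev p \<in> fs.span (monom_fun 4 ` {e \<in> expo 4. (\<Sum>l<4. e l) = d})"
    using assms(1) by (simp add: homog_def)
  show "monom_fun K e \<in> fs.span {monom_fun K e}" by (intro fs.span_base) simp
  fix a b assume "a \<in> monom_fun 4 ` {e \<in> expo 4. (\<Sum>l<4. e l) = d}" "b \<in> {monom_fun K e}"
  then obtain a' where a': "a' \<in> expo 4" "(\<Sum>l<4. a' l) = d" "a = monom_fun K a'" "b = monom_fun K e"
    using monom_fun_expo[OF _ assms(3)] by auto
  have "(\<lambda>z. a z * b z) = monom_fun K (\<lambda>i. a' i + e i)"
    by (simp add: a' monom_fun_mult)
  moreover have "(\<lambda>i. a' i + e i) \<in>
      {e' \<in> expo K. (\<forall>i\<ge>4. e' i = e i) \<and> (\<Sum>l<4. e' l) = d + (\<Sum>l<4. e l)}"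
    using a' assms(2,3) by (auto simp: expo_def sum.distrib)
  ultimately show "(\<lambda>z. a z * b z) \<in> fs.span (monom_fun K `
      {e' \<in> expo K. (\<forall>i\<ge>4. e' i = e i) \<and> (\<Sum>l<4. e' l) = d + (\<Sum>l<4. e l)})"
    by (auto intro: fs.span_base)
qed

text \<open>The last exponent is determined by the others; this is the exponent \<open>n - 1\<close>
  that loses against \<open>n\<close> in the final count.\<close>

lemma card_expo_sum:
  assumes "0 < n"
  shows "finite {\<gamma> \<in> expo n. (\<Sum>r<n. \<gamma> r) = t}" "card {\<gamma> \<in> expo n. (\<Sum>r<n. \<gamma> r) = t} \<le> (t + 1) ^ (n - 1)"
proof -
  let ?S = "{\<gamma> \<in> expo n. (\<Sum>r<n. \<gamma> r) = t}"
  let ?P = "PiE {..<n - 1} (\<lambda>_. {..t})"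
  let ?f = "\<lambda>\<gamma>. restrict \<gamma> {..<n - 1}"
  have inj: "inj_on ?f ?S"
  proof (rule inj_onI)
    fix \<gamma> \<delta> assume \<gamma>: "\<gamma> \<in> ?S" and \<delta>: "\<delta> \<in> ?S" and eq: "?f \<gamma> = ?f \<delta>"
    have low: "\<gamma> r = \<delta> r" if "r < n - 1" for r
      using fun_cong[OF eq, of r] that by simp
    have split: "(\<Sum>r<n. h r) = (\<Sum>r<n - 1. h r) + h (n - 1)" for h :: "nat \<Rightarrow> nat"
      using sum.lessThan_Suc[of h "n - 1"] assms by simp
    have "(\<Sum>r<n - 1. \<gamma> r) + \<gamma> (n - 1) = t" "(\<Sum>r<n - 1. \<delta> r) + \<delta> (n - 1) = t"
      using \<gamma> \<delta> by (simp_all only: split mem_Collect_eq)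
    moreover have "(\<Sum>r<n - 1. \<gamma> r) = (\<Sum>r<n - 1. \<delta> r)" using low by (intro sum.cong) auto
    ultimately have last: "\<gamma> (n - 1) = \<delta> (n - 1)" by simp
    show "\<gamma> = \<delta>"
    proof
      fix r
      consider "r < n - 1" | "r = n - 1" | "r \<ge> n" using assms by linarith
      then show "\<gamma> r = \<delta> r" by cases (use low last \<gamma> \<delta> in \<open>auto simp: expo_def\<close>)
    qed
  qed
  have "\<gamma> r \<le> t" if "\<gamma> \<in> ?S" "r < n" for \<gamma> r
    using that member_le_sum[of r "{..<n}" \<gamma>] by auto
  then have sub: "?f ` ?S \<subseteq> ?P"
    by (intro image_subsetI) (simp add: restrict_PiE_iff)
  have fin: "finite ?P" by (intro finite_PiE) auto
  show "finite ?S" using finite_subset[OF sub fin] inj finite_imageD by blast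
  have "card ?S \<le> card ?P" using card_inj_on_le[OF inj sub fin] .
  also have "\<dots> = (t + 1) ^ (n - 1)" by (simp add: card_PiE)
  finally show "card ?S \<le> (t + 1) ^ (n - 1)" .
qed

text \<open>All that the degree argument uses of the flag: homogeneous vectors, independent away
  from the origin as witnessed by dual covectors.\<close>

locale homog_frame =
  fixes n k :: nat and v :: "nat \<Rightarrow> nat \<Rightarrow> poly4" and b :: "nat \<Rightarrow> nat"
  assumes homog_v: "\<And>j r. j < k \<Longrightarrow> homog (b j) (v j r)"
    and dual: "\<And>z. nz z \<Longrightarrow>
      \<exists>C. \<forall>j<k. \<forall>l<k. dot n (C j) (\<lambda>r. ev (v l r) z) = (if j = l then 1 else 0)"
begin

text \<open>Paired with the sections \<open>F r\<close> defined below, \<open>\<mu>\<close> yields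
  the fibre coordinate \<open>i\<close> times \<open>X l ^ N\<close>; this is the algebraic form of
  the absence of common zeros. Homogeneity is achieved by keeping only the component of degree
  \<open>N - b i\<close>.\<close>

lemma X_power_dual:
  "\<exists>N. (\<forall>i<k. b i \<le> N) \<and> (\<forall>l<4. \<forall>i<k. \<exists>\<mu>. (\<forall>r. homog (N - b i) (\<mu> r)) \<and>
     (\<forall>j<k. dot n \<mu> (v j) = (if j = i then X l ^ N else 0)))"
proof -
  define I where "I i = {a. \<exists>\<mu>. \<forall>j<k. dot n \<mu> (v j) = (if j = i then a else 0)}" for i
  have I: "ideal4 (I i)" for i
    unfolding ideal4_def I_def
  proof (intro conjI ballI allI)
    show "0 \<in> {a. \<exists>\<mu>. \<forall>j<k. dot n \<mu> (v j) = (if j = i then a else 0)}"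
      by (intro CollectI exI[of _ "\<lambda>_. 0"]) (simp add: dot_def)
  next
    fix p q
    assume "p \<in> {a. \<exists>\<mu>. \<forall>j<k. dot n \<mu> (v j) = (if j = i then a else 0)}"
      and "q \<in> {a. \<exists>\<mu>. \<forall>j<k. dot n \<mu> (v j) = (if j = i then a else 0)}"
    then obtain \<mu> \<nu> where "\<forall>j<k. dot n \<mu> (v j) = (if j = i then p else 0)"
      "\<forall>j<k. dot n \<nu> (v j) = (if j = i then q else 0)" by blast
    then show "p + q \<in> {a. \<exists>\<mu>. \<forall>j<k. dot n \<mu> (v j) = (if j = i then a else 0)}"
      by (intro CollectI exI[of _ "\<lambda>r. \<mu> r + \<nu> r"]) (simp add: dot_def distrib_right sum.distrib)
  next
    fix p q assume "q \<in> {a. \<exists>\<mu>. \<forall>j<k. dot n \<mu> (v j) = (if j = i then a else 0)}"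
    then obtain \<mu> where "\<forall>j<k. dot n \<mu> (v j) = (if j = i then q else 0)" by blast
    then show "p * q \<in> {a. \<exists>\<mu>. \<forall>j<k. dot n \<mu> (v j) = (if j = i then a else 0)}"
      by (intro CollectI exI[of _ "\<lambda>r. p * \<mu> r"]) (simp add: dot_scale_left)
  qed
  have "\<exists>a\<in>I i. ev a z \<noteq> 0" if z: "nz z" and i: "i < k" for i z
  proof -
    obtain C where C: "\<And>j l. j < k \<Longrightarrow> l < k \<Longrightarrow> dot n (C j) (\<lambda>r. ev (v l r) z) = (if j = l then 1 else 0)"
      using dual[OF z] by blast
    obtain \<mu> a where a: "ev a z \<noteq> 0" and \<mu>: "\<And>j l. j < k \<Longrightarrow> l < k \<Longrightarrow> dot n (\<mu> j) (v l) = (if j = l then a else 0)"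
      using dual_polynomials[OF C] by blast
    have "a \<in> I i" unfolding I_def using \<mu>[OF i] by (intro CollectI exI[of _ "\<mu> i"]) simp
    with a show ?thesis by blast
  qed
  then have "\<forall>i\<in>{..<k}. \<exists>N. \<forall>l<4. X l ^ N \<in> I i"
    using power_X_in_ideal[OF I] by simp
  from bchoice[OF this] obtain N where N: "\<And>i l. i < k \<Longrightarrow> l < 4 \<Longrightarrow> X l ^ N i \<in> I i" by auto
  define M where "M = (\<Sum>i<k. N i + b i)"
  have M: "N i \<le> M" "b i \<le> M" if "i < k" for i
  proof -
    have "N i + b i \<le> M" unfolding M_def using that member_le_sum[of i "{..<k}" "\<lambda>i. N i + b i"] by simp
    then show "N i \<le> M" "b i \<le> M" by auto
  qed
  have "\<exists>\<mu>. (\<forall>r. homog (M - b i) (\<mu> r)) \<and> (\<forall>j<k. dot n \<mu> (v j) = (if j = i then X l ^ M else 0))"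
    if l: "l < 4" and i: "i < k" for l i
  proof -
    have "X l ^ M = X l ^ (M - N i) * X l ^ N i" using M(1)[OF i] by (simp flip: power_add)
    then have "X l ^ M \<in> I i" using ideal4D(3)[OF I N[OF i l]] by simp
    then obtain \<mu> where \<mu>: "\<And>j. j < k \<Longrightarrow> dot n \<mu> (v j) = (if j = i then X l ^ M else 0)"
      unfolding I_def by blast
    obtain c' D' where c': "\<And>d r. homog d (c' d r)" "\<And>r. r < n \<Longrightarrow> \<mu> r = (\<Sum>d\<le>D'. c' d r)"
      using homog_decomposition_vec[of n \<mu>] by blast
    \<comment> \<open>Padding with zero components up to \<open>D\<close> makes sure that the degree
      \<open>M - b i\<close> occurs in the sum.\<close>
    define c where "c = (\<lambda>d r. if d \<le> D' then c' d r else 0)"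
    define D where "D = D' + M"
    have c: "homog d (c d r)" for d r using c' by (simp add: c_def)
    have \<mu>c: "\<mu> r = (\<Sum>d\<le>D. c d r)" if "r < n" for r
      unfolding c'(2)[OF that] c_def D_def by (rule sum.mono_neutral_cong_left) auto
    have "dot n (c (M - b i)) (v j) = (if j = i then X l ^ M else 0)" if j: "j < k" for j
    proof (rule ev_eqI_nz)
      fix z :: "nat \<Rightarrow> complex"
      define a where "a d = (if j = i \<and> d = M - b i then z l ^ M else 0)" for d
      have "ev (dot n (c (M - b i)) (v j)) z - a (M - b i) = 0"
      proof (rule coeffs_zero[where D = D and a = "\<lambda>d. ev (dot n (c d) (v j)) z - a d"])
        show "M - b i \<le> D" by (simp add: D_def)
        fix t :: complex assume t: "t \<noteq> 0"
        have "dot n \<mu> (v j) = dot n (\<lambda>r. \<Sum>d\<le>D. c d r) (v j)"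
          unfolding dot_def by (intro sum.cong) (simp_all add: \<mu>c)
        then have eq: "dot n \<mu> (v j) = (\<Sum>d\<le>D. dot n (c d) (v j))" by (simp add: dot_sum_left)
        have "ev (dot n (c d) (v j)) (\<lambda>l. t * z l) = t ^ b j * (t ^ d * ev (dot n (c d) (v j)) z)" for d
          unfolding ev_dot homog_scale[OF c] homog_scale[OF homog_v[OF j]] dot_scale_left dot_scale
          by (simp only: mult_ac)
        then have "t ^ b j * (\<Sum>d\<le>D. t ^ d * ev (dot n (c d) (v j)) z) = ev (dot n \<mu> (v j)) (\<lambda>l. t * z l)"
          unfolding eq by (simp add: sum_distrib_left)
        also have "\<dots> = t ^ b j * (\<Sum>d\<le>D. t ^ d * a d)"
        proof (cases "j = i")
          case True
          have "(\<Sum>d\<le>D. t ^ d * a d) = t ^ (M - b i) * z l ^ M"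
            using True by (simp add: a_def D_def if_distrib[of "\<lambda>x. _ * x"] cong: if_cong)
          then have "t ^ b j * (\<Sum>d\<le>D. t ^ d * a d) = t ^ (b j + (M - b i)) * z l ^ M"
            by (simp add: power_add)
          also have "b j + (M - b i) = M" using True M(2)[OF i] by simp
          finally show ?thesis using True l \<mu>[OF j] by (simp add: power_mult_distrib)
        next
          case False
          then show ?thesis using \<mu>[OF j] by (simp add: a_def)
        qed
        finally show "(\<Sum>d\<le>D. t ^ d * (ev (dot n (c d) (v j)) z - a d)) = 0"
          using t by (simp add: right_diff_distrib sum_subtractf)
      qed
      then show "ev (dot n (c (M - b i)) (v j)) z = ev (if j = i then X l ^ M else 0) z"
        using l by (simp add: a_def)
    qed
    then show ?thesis using c by (intro exI[of _ "c (M - b i)"]) auto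
  qed
  then show ?thesis using M(2) by blast
qed

text \<open>A frame vector of degree 0 is constant, so a covector dual at the single point with all
  coordinates 1 remains dual on the vectors of degree 0. On the others only homogeneity
  survives.\<close>

lemma constant_dual:
  assumes i: "i < k" "b i = 0"
  shows "\<exists>c. (\<forall>l<k. homog (b l) (dot n (\<lambda>r. cst (c r)) (v l))) \<and>
    (\<forall>l<k. b l = 0 \<longrightarrow> dot n (\<lambda>r. cst (c r)) (v l) = (if l = i then 1 else 0))"
proof -
  have "nz (\<lambda>_. 1)" by (intro exI[of _ 0]) simp
  from dual[OF this] obtain C where C: "\<And>j l. j < k \<Longrightarrow> l < k \<Longrightarrow>
      dot n (C j) (\<lambda>r. ev (v l r) (\<lambda>_. 1)) = (if j = l then 1 else 0)" by blast
  have hom: "homog (b l) (dot n (\<lambda>r. cst (C i r)) (v l))" if "l < k" for l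
    unfolding dot_def using homog_v[OF that] by (intro homog_sum homog_cst_mult)
  moreover have "dot n (\<lambda>r. cst (C i r)) (v l) = (if l = i then 1 else 0)" if l: "l < k" "b l = 0" for l
  proof (rule ev_eqI)
    fix z
    have h: "homog 0 (dot n (\<lambda>r. cst (C i r)) (v l))" using hom l by metis
    have "ev (dot n (\<lambda>r. cst (C i r)) (v l)) z = ev (dot n (\<lambda>r. cst (C i r)) (v l)) (\<lambda>_. 1)"
      using homog_0_const[OF h, of z] homog_0_const[OF h, of "\<lambda>_. 1"] by simp
    also have "\<dots> = (if l = i then 1 else 0)" using C[OF i(1) l(1)] by (simp add: ev_dot)
    finally show "ev (dot n (\<lambda>r. cst (C i r)) (v l)) z = ev (if l = i then 1 else 0) z" by simp
  qed
  ultimately show ?thesis by blast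
qed

text \<open>Variables \<open>4 + i\<close> for \<open>i < k\<close> are fibre coordinates of the bundle spanned by the frame. The
  functions \<open>F r\<close> are the sections of \<open>\<O>(1)\<close> on its projectivisation pulled back from the ambient
  projective space, and \<open>E m\<close> indexes the monomial basis of the sections of \<open>\<O>(m)\<close>.\<close>

definition F :: "nat \<Rightarrow> (nat \<Rightarrow> complex) \<Rightarrow> complex" where
  "F r z = (\<Sum>i<k. z (4 + i) * ev (v i r) z)"

definition E :: "nat \<Rightarrow> (nat \<Rightarrow> nat) set" where
  "E m = {e \<in> expo (4 + k). (\<Sum>i<k. e (4 + i)) = m \<and> (\<Sum>l<4. e l) = (\<Sum>i<k. e (4 + i) * b i)}"

definition R :: "nat \<Rightarrow> ((nat \<Rightarrow> complex) \<Rightarrow> complex) set" where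
  "R m = monom_fun (4 + k) ` E m"

definition Q :: "nat \<Rightarrow> ((nat \<Rightarrow> complex) \<Rightarrow> complex) set" where
  "Q m = {\<lambda>z. F r z * g z | r g. r < n \<and> g \<in> R m}"

lemma F_times_span:
  assumes "r < n" "g \<in> fs.span (R m)"
  shows "(\<lambda>z. F r z * g z) \<in> fs.span (Q m)"
proof (rule span_mult[OF _ assms(2)])
  show "F r \<in> fs.span {F r}" by (intro fs.span_base) simp
  fix a g assume "a \<in> {F r}" "g \<in> R m"
  then show "(\<lambda>z. a z * g z) \<in> fs.span (Q m)"
    using assms(1) by (intro fs.span_base) (auto simp: Q_def)
qed

lemma dot_F: "dot n (\<lambda>r. ev (\<mu> r) z) (\<lambda>r. F r z) = (\<Sum>j<k. z (4 + j) * ev (dot n \<mu> (v j)) z)"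
  unfolding F_def dot_sum dot_scale ev_dot ..

lemma finite_R: "finite (R m)"
proof -
  have "E m \<subseteq> {e \<in> expo (4 + k). \<forall>i<4 + k. e i \<le> m + (\<Sum>i<k. m * b i)}"
  proof
    fix e assume e: "e \<in> E m"
    have y: "e (4 + i) \<le> m" if "i < k" for i
      using e that member_le_sum[of i "{..<k}" "\<lambda>i. e (4 + i)"] by (simp add: E_def)
    have "e i \<le> m + (\<Sum>i<k. m * b i)" if "i < 4 + k" for i
    proof (cases "i < 4")
      case True
      then have "e i \<le> (\<Sum>l<4. e l)" using member_le_sum[of i "{..<4}" e] by simp
      also have "\<dots> = (\<Sum>i<k. e (4 + i) * b i)" using e by (simp add: E_def)
      also have "\<dots> \<le> (\<Sum>i<k. m * b i)" using y by (intro sum_mono mult_right_mono) auto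
      finally show ?thesis by simp
    next
      case False
      then have "e i \<le> m" using y[of "i - 4"] that by simp
      then show ?thesis by simp
    qed
    then show "e \<in> {e \<in> expo (4 + k). \<forall>i<4 + k. e i \<le> m + (\<Sum>i<k. m * b i)}"
      using e by (simp add: E_def)
  qed
  from finite_subset[OF this finite_expo_bounded] show ?thesis unfolding R_def by (rule finite_imageI)
qed


text \<open>Bookkeeping for splitting \<open>z (4 + i) * z l ^ N\<close> off a monomial. The base
  degree drops by \<open>N\<close> and the required base degree by \<open>b i\<close>, so
  multiplication by a polynomial of degree \<open>N - b i\<close> leads back into
  \<open>E m\<close>.\<close>

lemma E_decrease:
  assumes e: "e \<in> E (Suc m)" and i: "i < k" "0 < e (4 + i)" and l: "l < 4" "N \<le> e l"
    and e'_def: "e' = (\<lambda>j. if j = 4 + i then e j - 1 else if j = l then e j - N else e j)"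
  shows "e' \<in> expo (4 + k)" "(\<Sum>j<k. e' (4 + j)) = m" "(\<Sum>j<4. e' j) + N = (\<Sum>j<4. e j)"
    "(\<Sum>j<k. e' (4 + j) * b j) + b i = (\<Sum>j<k. e (4 + j) * b j)"
    "monom_fun (4 + k) e z = z (4 + i) * z l ^ N * monom_fun (4 + k) e' z"
proof -
  have pos: "e (4 + i) = Suc (e' (4 + i))" using i(2) by (simp add: e'_def)
  have y: "(\<Sum>j<k. f (e (4 + j)) j) = f (e (4 + i)) i + (\<Sum>j\<in>{..<k} - {i}. f (e (4 + j)) j)"
    "(\<Sum>j<k. f (e' (4 + j)) j) = f (e' (4 + i)) i + (\<Sum>j\<in>{..<k} - {i}. f (e (4 + j)) j)" for f :: "nat \<Rightarrow> nat \<Rightarrow> nat"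
  proof -
    show "(\<Sum>j<k. f (e (4 + j)) j) = f (e (4 + i)) i + (\<Sum>j\<in>{..<k} - {i}. f (e (4 + j)) j)"
      using i(1) by (intro sum.remove) auto
    have "(\<Sum>j<k. f (e' (4 + j)) j) = f (e' (4 + i)) i + (\<Sum>j\<in>{..<k} - {i}. f (e' (4 + j)) j)"
      using i(1) by (intro sum.remove) auto
    also have "(\<Sum>j\<in>{..<k} - {i}. f (e' (4 + j)) j) = (\<Sum>j\<in>{..<k} - {i}. f (e (4 + j)) j)"
      using l(1) by (intro sum.cong) (auto simp: e'_def)
    finally show "(\<Sum>j<k. f (e' (4 + j)) j) = f (e' (4 + i)) i + (\<Sum>j\<in>{..<k} - {i}. f (e (4 + j)) j)" .
  qed
  show "e' \<in> expo (4 + k)" using e by (auto simp: E_def expo_def e'_def)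
  show "(\<Sum>j<k. e' (4 + j)) = m"
    using e y[of "\<lambda>x j. x"] pos by (simp add: E_def)
  show "(\<Sum>j<k. e' (4 + j) * b j) + b i = (\<Sum>j<k. e (4 + j) * b j)"
    using y[of "\<lambda>x j. x * b j"] pos by simp
  have "(\<Sum>j<4. e j) = e l + (\<Sum>j\<in>{..<4} - {l}. e j)" using l(1) by (intro sum.remove) auto
  moreover have "(\<Sum>j<4. e' j) = e' l + (\<Sum>j\<in>{..<4} - {l}. e' j)" using l(1) by (intro sum.remove) auto
  moreover have "(\<Sum>j\<in>{..<4} - {l}. e' j) = (\<Sum>j\<in>{..<4} - {l}. e j)" by (intro sum.cong) (auto simp: e'_def)
  moreover have "e' l + N = e l" using l by (simp add: e'_def)
  ultimately show "(\<Sum>j<4. e' j) + N = (\<Sum>j<4. e j)" by simp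
  let ?S = "{..<4 + k} - {l} - {4 + i}"
  have "monom_fun (4 + k) e z = z l ^ e l * (z (4 + i) ^ e (4 + i) * (\<Prod>j\<in>?S. z j ^ e j))"
    unfolding monom_fun_def using i(1) l(1)
    by (subst prod.remove[of _ l], simp, simp, subst prod.remove[of _ "4 + i"]) auto
  moreover have "monom_fun (4 + k) e' z = z l ^ e' l * (z (4 + i) ^ e' (4 + i) * (\<Prod>j\<in>?S. z j ^ e' j))"
    unfolding monom_fun_def using i(1) l(1)
    by (subst prod.remove[of _ l], simp, simp, subst prod.remove[of _ "4 + i"]) auto
  moreover have "(\<Prod>j\<in>?S. z j ^ e' j) = (\<Prod>j\<in>?S. z j ^ e j)" by (intro prod.cong) (auto simp: e'_def)
  moreover have "e l = e' l + N" using l by (simp add: e'_def)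
  ultimately show "monom_fun (4 + k) e z = z (4 + i) * z l ^ N * monom_fun (4 + k) e' z"
    using pos by (simp add: power_add)
qed

text \<open>Induction on the total exponent of the fibre coordinates of degree 0. If one occurs, a
  constant covector trades it, modulo \<open>Q m\<close>, for coordinates of positive degree. If
  none occurs, the base degree is at least \<open>Suc m\<close>, which exceeds \<open>4 * N\<close>;
  so some base variable has exponent at least \<open>N\<close>, and \<open>\<mu>\<close>
  applies.\<close>

lemma R_subset_span_Q:
  assumes bN: "\<And>i. i < k \<Longrightarrow> b i \<le> N"
    and \<mu>: "\<And>l i. l < 4 \<Longrightarrow> i < k \<Longrightarrow> \<exists>\<mu>. (\<forall>r. homog (N - b i) (\<mu> r)) \<and>
     (\<forall>j<k. dot n \<mu> (v j) = (if j = i then X l ^ N else 0))"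
    and m: "4 * N < Suc m" and e: "e \<in> E (Suc m)"
  shows "monom_fun (4 + k) e \<in> fs.span (Q m)"
  using e
proof (induction "\<Sum>i\<in>{i. i < k \<and> b i = 0}. e (4 + i)" arbitrary: e rule: less_induct)
  case less
  note e = less.prems
  show ?case
  proof (cases "\<exists>i<k. b i = 0 \<and> 0 < e (4 + i)")
    case True
    then obtain i where i: "i < k" "b i = 0" "0 < e (4 + i)" by blast
    obtain c where c: "\<And>l. l < k \<Longrightarrow> homog (b l) (dot n (\<lambda>r. cst (c r)) (v l))"
      and c0: "\<And>l. l < k \<Longrightarrow> b l = 0 \<Longrightarrow> dot n (\<lambda>r. cst (c r)) (v l) = (if l = i then 1 else 0)"
      using constant_dual[OF i(1,2)] by blast
    define p where "p l = dot n (\<lambda>r. cst (c r)) (v l)" for l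
    \<comment> \<open>The form required by \<open>E_decrease\<close> with \<open>N = 0\<close> and
      \<open>l = 0\<close>: no base variable is split off.\<close>
    define e' where "e' = (\<lambda>j. if j = 4 + i then e j - 1 else if j = 0 then e j - 0 else e j)"
    note e' = E_decrease[OF e i(1,3) _ _ e'_def, simplified]
    have e'E: "e' \<in> E m" using e' i(2) e by (simp add: E_def)
    let ?m = "monom_fun (4 + k)"
    have F: "(\<Sum>r<n. c r * F r z) = z (4 + i) + (\<Sum>l\<in>{l. l < k \<and> 0 < b l}. z (4 + l) * ev (p l) z)" for z
    proof -
      have "(\<Sum>r<n. c r * F r z) = (\<Sum>l<k. z (4 + l) * ev (p l) z)"
        using dot_F[of "\<lambda>r. cst (c r)" z] by (simp add: dot_def[of n c] p_def)
      also have "\<dots> = (\<Sum>l\<in>{..<k} \<inter> {l. b l = 0}. z (4 + l) * ev (p l) z)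
          + (\<Sum>l\<in>{..<k} - {l. b l = 0}. z (4 + l) * ev (p l) z)"
        by (intro sum.Int_Diff) auto
      also have "(\<Sum>l\<in>{..<k} \<inter> {l. b l = 0}. z (4 + l) * ev (p l) z)
          = (\<Sum>l\<in>{..<k} \<inter> {l. b l = 0}. if l = i then z (4 + i) else 0)"
        by (intro sum.cong) (auto simp: p_def c0)
      also have "\<dots> = z (4 + i)" using i by simp
      also have "{..<k} - {l. b l = 0} = {l. l < k \<and> 0 < b l}" by auto
      finally show ?thesis .
    qed
    have eq: "?m e = (\<lambda>z. (\<Sum>r<n. c r * (F r z * ?m e' z))
        - (\<Sum>l\<in>{l. l < k \<and> 0 < b l}. 1 * (z (4 + l) * (ev (p l) z * ?m e' z))))"
    proof
      fix z
      have "?m e z = ((\<Sum>r<n. c r * F r z) - (\<Sum>l\<in>{l. l < k \<and> 0 < b l}. z (4 + l) * ev (p l) z)) * ?m e' z"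
        unfolding F e'(5) by simp
      then show "?m e z = (\<Sum>r<n. c r * (F r z * ?m e' z))
          - (\<Sum>l\<in>{l. l < k \<and> 0 < b l}. 1 * (z (4 + l) * (ev (p l) z * ?m e' z)))"
        by (simp only: left_diff_distrib sum_distrib_right mult.assoc mult_1_left)
    qed
    have "?m e' \<in> fs.span (R m)" using e'E by (intro fs.span_base) (simp add: R_def)
    then have 1: "(\<lambda>z. \<Sum>r<n. c r * (F r z * ?m e' z)) \<in> fs.span (Q m)"
      by (intro span_sum_scale F_times_span) auto
    have "(\<lambda>z. z (4 + l) * (ev (p l) z * ?m e' z)) \<in> fs.span (Q m)" if l: "l < k" "0 < b l" for l
    proof -
      let ?T = "?m ` {f \<in> expo (4 + k). (\<forall>j\<ge>4. f j = e' j) \<and> (\<Sum>j<4. f j) = b l + (\<Sum>j<4. e' j)}"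
      have "(\<lambda>z. z (4 + l) * (ev (p l) z * ?m e' z)) \<in> fs.span (Q m)"
      proof (rule span_mult)
        show "(\<lambda>z. z (4 + l)) \<in> fs.span {\<lambda>z. z (4 + l)}" by (intro fs.span_base) simp
        show "(\<lambda>z. ev (p l) z * ?m e' z) \<in> fs.span ?T"
          using c[OF l(1)] e'(1) by (intro homog_times_monom_fun) (auto simp: p_def)
        fix a g :: "(nat \<Rightarrow> complex) \<Rightarrow> complex"
        assume a: "a \<in> {\<lambda>z. z (4 + l)}" and "g \<in> ?T"
        then obtain f where f: "f \<in> expo (4 + k)" "\<And>j. j \<ge> 4 \<Longrightarrow> f j = e' j"
          "(\<Sum>j<4. f j) = b l + (\<Sum>j<4. e' j)" "g = ?m f" by blast
        define h where "h = f(4 + l := Suc (f (4 + l)))"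
        have ag: "(\<lambda>z. a z * g z) = ?m h"
        proof
          fix z
          have "?m h z = z (4 + l) ^ h (4 + l) * (\<Prod>j\<in>{..<4 + k} - {4 + l}. z j ^ h j)"
            unfolding monom_fun_def using l(1) by (intro prod.remove) auto
          moreover have "?m f z = z (4 + l) ^ f (4 + l) * (\<Prod>j\<in>{..<4 + k} - {4 + l}. z j ^ f j)"
            unfolding monom_fun_def using l(1) by (intro prod.remove) auto
          moreover have "(\<Prod>j\<in>{..<4 + k} - {4 + l}. z j ^ h j) = (\<Prod>j\<in>{..<4 + k} - {4 + l}. z j ^ f j)"
            by (intro prod.cong) (auto simp: h_def)
          ultimately show "a z * g z = ?m h z" using a f(4) by (simp add: h_def)
        qed
        have y: "(\<Sum>j<k. w (h (4 + j)) j) = w (Suc (e' (4 + l))) l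
            + (\<Sum>j\<in>{..<k} - {l}. w (e' (4 + j)) j)" for w :: "nat \<Rightarrow> nat \<Rightarrow> nat"
        proof -
          have "(\<Sum>j\<in>{..<k} - {l}. w (h (4 + j)) j) = (\<Sum>j\<in>{..<k} - {l}. w (e' (4 + j)) j)"
            using f(2) by (intro sum.cong) (auto simp: h_def)
          moreover have "h (4 + l) = Suc (e' (4 + l))" using f(2)[of "4 + l"] by (simp add: h_def)
          ultimately show ?thesis
            using l(1) sum.remove[of "{..<k}" l "\<lambda>j. w (h (4 + j)) j"] by simp
        qed
        have y': "(\<Sum>j<k. w (e' (4 + j)) j) = w (e' (4 + l)) l
            + (\<Sum>j\<in>{..<k} - {l}. w (e' (4 + j)) j)" for w :: "nat \<Rightarrow> nat \<Rightarrow> nat"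
          using l(1) by (intro sum.remove) auto
        have h4: "(\<Sum>j<4. h j) = (\<Sum>j<4. f j)" by (intro sum.cong) (auto simp: h_def)
        have hk: "(\<Sum>j<k. h (4 + j)) = Suc (\<Sum>j<k. e' (4 + j))"
          using y[of "\<lambda>x j. x"] y'[of "\<lambda>x j. x"] by simp
        have hb: "(\<Sum>j<k. h (4 + j) * b j) = b l + (\<Sum>j<k. e' (4 + j) * b j)"
          using y[of "\<lambda>x j. x * b j"] y'[of "\<lambda>x j. x * b j"] by simp
        have "h \<in> expo (4 + k)" using f(1) l(1) by (simp add: expo_def h_def)
        moreover have em: "(\<Sum>j<k. e' (4 + j)) = m" and eb: "(\<Sum>j<4. e' j) = (\<Sum>j<k. e' (4 + j) * b j)"
          using e'E by (simp_all only: E_def mem_Collect_eq)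
        have "(\<Sum>j<k. h (4 + j)) = Suc m" by (simp only: hk em)
        moreover have "(\<Sum>j<4. h j) = (\<Sum>j<k. h (4 + j) * b j)" by (simp only: h4 f(3) hb eb)
        ultimately have hE: "h \<in> E (Suc m)" by (simp only: E_def mem_Collect_eq simp_thms)
        let ?J = "{i. i < k \<and> b i = 0}"
        have "(\<Sum>j\<in>?J. h (4 + j)) = (\<Sum>j\<in>?J. e' (4 + j))"
          using f(2) l(2) by (intro sum.cong) (auto simp: h_def)
        also have "\<dots> < (\<Sum>j\<in>?J. e (4 + j))"
          using i by (intro sum_strict_mono_ex1) (auto simp: e'_def intro!: exI[of _ i])
        finally have "?m h \<in> fs.span (Q m)" using less.hyps hE by blast
        then show "(\<lambda>z. a z * g z) \<in> fs.span (Q m)" by (simp only: ag)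
      qed
      then show ?thesis .
    qed
    then have 2: "(\<lambda>z. \<Sum>l\<in>{l. l < k \<and> 0 < b l}. 1 * (z (4 + l) * (ev (p l) z * ?m e' z))) \<in> fs.span (Q m)"
      by (intro span_sum_scale) auto
    from fs.span_diff[OF 1 2] show ?thesis unfolding eq by (simp add: fun_diff_def)
  next
    case False
    have "\<exists>i<k. 0 < e (4 + i)"
    proof (rule ccontr)
      assume "\<not> ?thesis"
      then have "(\<Sum>i<k. e (4 + i)) = 0" by simp
      then show False using e by (simp add: E_def)
    qed
    then obtain i where i: "i < k" "0 < e (4 + i)" by blast
    have "\<exists>l<4. N \<le> e l"
    proof (rule ccontr)
      assume "\<not> ?thesis"
      then have "(\<Sum>l<4. e l) \<le> (\<Sum>l<(4 :: nat). N)" by (intro sum_mono) auto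
      moreover have "(\<Sum>i<k. e (4 + i)) \<le> (\<Sum>i<k. e (4 + i) * b i)"
        using False by (intro sum_mono) (auto simp: Suc_le_eq)
      ultimately show False using e m by (simp add: E_def)
    qed
    then obtain l where l: "l < 4" "N \<le> e l" by blast
    obtain \<mu> where \<mu>: "\<And>r. homog (N - b i) (\<mu> r)"
      "\<And>j. j < k \<Longrightarrow> dot n \<mu> (v j) = (if j = i then X l ^ N else 0)"
      using \<mu>[OF l(1) i(1)] by blast
    define e' where "e' = (\<lambda>j. if j = 4 + i then e j - 1 else if j = l then e j - N else e j)"
    note e' = E_decrease[OF e i l e'_def]
    let ?m = "monom_fun (4 + k)"
    have F: "(\<Sum>r<n. ev (\<mu> r) z * F r z) = z (4 + i) * z l ^ N" for z
    proof -
      have "(\<Sum>r<n. ev (\<mu> r) z * F r z) = (\<Sum>j<k. z (4 + j) * ev (dot n \<mu> (v j)) z)"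
        using dot_F[of \<mu> z] by (simp add: dot_def[of n "\<lambda>r. ev (\<mu> r) z"])
      also have "\<dots> = (\<Sum>j<k. if j = i then z (4 + i) * z l ^ N else 0)"
        using l(1) by (intro sum.cong) (auto simp: \<mu>(2))
      also have "\<dots> = z (4 + i) * z l ^ N" using i(1) by simp
      finally show ?thesis .
    qed
    have eq: "?m e = (\<lambda>z. \<Sum>r<n. 1 * (F r z * (ev (\<mu> r) z * ?m e' z)))"
      unfolding fun_eq_iff e'(5) F[symmetric] by (simp only: sum_distrib_right mult.left_commute mult.assoc mult_1_left simp_thms)
    have "(\<lambda>z. ev (\<mu> r) z * ?m e' z) \<in> fs.span (R m)" for r
    proof -
      let ?T = "{f \<in> expo (4 + k). (\<forall>j\<ge>4. f j = e' j) \<and> (\<Sum>j<4. f j) = N - b i + (\<Sum>j<4. e' j)}"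
      have "?T \<subseteq> E m"
      proof
        fix f assume f: "f \<in> ?T"
        then have "(\<Sum>j<k. f (4 + j)) = (\<Sum>j<k. e' (4 + j))"
          "(\<Sum>j<k. f (4 + j) * b j) = (\<Sum>j<k. e' (4 + j) * b j)" by auto
        moreover have "(\<Sum>l<4. e l) = (\<Sum>i<k. e (4 + i) * b i)" using e by (simp add: E_def)
        ultimately show "f \<in> E m"
          using f e'(2,3,4) bN[OF i(1)] by (simp add: E_def)
      qed
      then have "fs.span (?m ` ?T) \<subseteq> fs.span (R m)"
        unfolding R_def by (intro fs.span_mono image_mono)
      moreover have "(\<lambda>z. ev (\<mu> r) z * ?m e' z) \<in> fs.span (?m ` ?T)"
        using \<mu>(1) e'(1) by (intro homog_times_monom_fun) auto
      ultimately show ?thesis by blast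
    qed
    then show ?thesis unfolding eq by (intro span_sum_scale F_times_span) auto
  qed
qed

section \<open>Growth of the spaces of sections\<close>

definition Fm :: "(nat \<Rightarrow> nat) \<Rightarrow> (nat \<Rightarrow> complex) \<Rightarrow> complex" where
  "Fm \<gamma> z = (\<Prod>r<n. F r z ^ \<gamma> r)"

text \<open>Iterating the step from \<open>m\<close> to \<open>Suc m\<close> leaves the fixed finite
  set \<open>R m0\<close> times monomials of degree \<open>t\<close> in \<open>n\<close> elements,
  whose number is of order at most \<open>t ^ (n - 1)\<close>.\<close>

lemma R_span_Fm:
  assumes step: "\<And>m. m0 \<le> m \<Longrightarrow> R (Suc m) \<subseteq> fs.span (Q m)"
  shows "R (m0 + t) \<subseteq> fs.span {\<lambda>z. Fm \<gamma> z * g z | \<gamma> g. \<gamma> \<in> {\<gamma> \<in> expo n. (\<Sum>r<n. \<gamma> r) = t} \<and> g \<in> R m0}"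
    (is "_ \<subseteq> fs.span (?B t)")
proof (induction t)
  case 0
  have "R m0 \<subseteq> ?B 0"
  proof
    fix g assume "g \<in> R m0"
    then show "g \<in> ?B 0"
      by (intro CollectI exI[of _ "\<lambda>_. 0"] exI[of _ g]) (simp add: Fm_def expo_def)
  qed
  also have "\<dots> \<subseteq> fs.span (?B 0)" by (rule fs.span_superset)
  finally show ?case by simp
next
  case (Suc t)
  have "Q (m0 + t) \<subseteq> fs.span (?B (Suc t))"
  proof
    fix q assume "q \<in> Q (m0 + t)"
    then obtain r g where q: "q = (\<lambda>z. F r z * g z)" "r < n" "g \<in> R (m0 + t)" by (auto simp: Q_def)
    show "q \<in> fs.span (?B (Suc t))"
      unfolding q(1)
    proof (rule span_mult)
      show "F r \<in> fs.span {F r}" by (intro fs.span_base) simp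
      show "g \<in> fs.span (?B t)" using Suc.IH q(3) by blast
      fix a h assume a: "a \<in> {F r}" and "h \<in> ?B t"
      then obtain \<gamma> g' where h: "h = (\<lambda>z. Fm \<gamma> z * g' z)" "\<gamma> \<in> expo n" "(\<Sum>r<n. \<gamma> r) = t" "g' \<in> R m0"
        by blast
      define \<delta> where "\<delta> = \<gamma>(r := Suc (\<gamma> r))"
      have "Fm \<delta> z = F r z * Fm \<gamma> z" for z
      proof -
        have "Fm \<delta> z = F r z ^ \<delta> r * (\<Prod>s\<in>{..<n} - {r}. F s z ^ \<delta> s)"
          unfolding Fm_def using q(2) by (intro prod.remove) auto
        moreover have "Fm \<gamma> z = F r z ^ \<gamma> r * (\<Prod>s\<in>{..<n} - {r}. F s z ^ \<gamma> s)"
          unfolding Fm_def using q(2) by (intro prod.remove) auto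
        moreover have "(\<Prod>s\<in>{..<n} - {r}. F s z ^ \<delta> s) = (\<Prod>s\<in>{..<n} - {r}. F s z ^ \<gamma> s)"
          by (intro prod.cong) (auto simp: \<delta>_def)
        ultimately show ?thesis by (simp add: \<delta>_def)
      qed
      then have "(\<lambda>z. a z * h z) = (\<lambda>z. Fm \<delta> z * g' z)" using a h(1) by (simp add: mult.assoc)
      moreover have "\<delta> \<in> expo n" using h(2) q(2) by (auto simp: expo_def \<delta>_def)
      moreover have "(\<Sum>r<n. \<delta> r) = Suc t"
      proof -
        have "(\<Sum>s<n. \<delta> s) = \<delta> r + (\<Sum>s\<in>{..<n} - {r}. \<delta> s)" using q(2) by (intro sum.remove) auto
        moreover have "(\<Sum>s<n. \<gamma> s) = \<gamma> r + (\<Sum>s\<in>{..<n} - {r}. \<gamma> s)" using q(2) by (intro sum.remove) auto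
        moreover have "(\<Sum>s\<in>{..<n} - {r}. \<delta> s) = (\<Sum>s\<in>{..<n} - {r}. \<gamma> s)"
          by (intro sum.cong) (auto simp: \<delta>_def)
        ultimately show ?thesis using h(3) by (simp add: \<delta>_def)
      qed
      ultimately show "(\<lambda>z. a z * h z) \<in> fs.span (?B (Suc t))"
        using h(4) by (intro fs.span_base CollectI exI[of _ \<delta>] exI[of _ g']) simp
    qed
  qed
  then have "fs.span (Q (m0 + t)) \<subseteq> fs.span (?B (Suc t))"
    by (intro fs.span_minimal) auto
  then show ?case using step[of "m0 + t"] by (simp add: subset_iff)
qed


text \<open>If some degree were positive, \<open>\<O>(1)\<close> would be big on the projectivised bundle, of dimension
  \<open>n\<close>: the number of monomials in \<open>R m\<close> grows like \<open>m ^ n\<close>. Being generated by \<open>n\<close> sections, it can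
  only grow like \<open>m ^ (n - 1)\<close>.\<close>

theorem degrees_zero:
  assumes n: "n = k + 2" and j: "j < k"
  shows "b j = 0"
proof (rule ccontr)
  assume bj: "b j \<noteq> 0"
  obtain N where N: "\<And>i. i < k \<Longrightarrow> b i \<le> N"
    "\<And>l i. l < 4 \<Longrightarrow> i < k \<Longrightarrow> \<exists>\<mu>. (\<forall>r. homog (N - b i) (\<mu> r)) \<and>
     (\<forall>j<k. dot n \<mu> (v j) = (if j = i then X l ^ N else 0))"
    using X_power_dual by blast
  define m0 where "m0 = 4 * N"
  have step: "R (Suc m) \<subseteq> fs.span (Q m)" if "m0 \<le> m" for m
  proof
    fix f assume "f \<in> R (Suc m)"
    then obtain e where "e \<in> E (Suc m)" "f = monom_fun (4 + k) e" by (auto simp: R_def)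
    then show "f \<in> fs.span (Q m)"
      using R_subset_span_Q[OF N] that by (simp add: m0_def)
  qed
  \<comment> \<open>Since \<open>t + 1 \<le> (k + 4) * s\<close>, at most
    \<open>((k + 4) * s) ^ (n - 1) * card (R m0)\<close> generators occur, and \<open>s\<close> is
    chosen to make this smaller than \<open>s ^ n\<close>. The factor \<open>k + 3\<close> in
    \<open>t\<close> leaves room for \<open>k * s\<close> in the fibre exponents and
    \<open>3 * s\<close> in the base exponents of the box \<open>P\<close>.\<close>
  define s where "s = card (R m0) * (k + 4) ^ (n - 1) + 1"
  define t where "t = (k + 3) * s"
  let ?G = "{\<gamma> \<in> expo n. (\<Sum>r<n. \<gamma> r) = t}"
  let ?B = "{\<lambda>z. Fm \<gamma> z * g z | \<gamma> g. \<gamma> \<in> ?G \<and> g \<in> R m0}"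
  have n0: "0 < n" using n by simp
  have B_eq: "?B = (\<lambda>(\<gamma>, g) z. Fm \<gamma> z * g z) ` (?G \<times> R m0)" by auto
  have finB: "finite ?B"
    unfolding B_eq using card_expo_sum(1)[OF n0] finite_R by (intro finite_imageI finite_cartesian_product)
  have "card ?B \<le> card (?G \<times> R m0)"
    unfolding B_eq using card_expo_sum(1)[OF n0] finite_R by (intro card_image_le finite_cartesian_product)
  also have "\<dots> \<le> (t + 1) ^ (n - 1) * card (R m0)"
    unfolding card_cartesian_product using card_expo_sum(2)[OF n0] by (rule mult_right_mono) simp
  also have "\<dots> \<le> ((k + 4) * s) ^ (n - 1) * card (R m0)"
    by (intro mult_right_mono power_mono) (auto simp: t_def s_def)
  also have "\<dots> = s ^ (n - 1) * (card (R m0) * (k + 4) ^ (n - 1))"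
    by (simp add: power_mult_distrib mult_ac)
  also have "\<dots> < s ^ (n - 1) * s" by (simp add: s_def)
  also have "\<dots> = s ^ n" using n by (simp flip: power_Suc2)
  finally have upper: "card ?B < s ^ n" .
  have sp: "R (m0 + t) \<subseteq> fs.span ?B" by (rule R_span_Fm) (rule step)
  define m where "m = m0 + t"
  \<comment> \<open>Two linear equations define \<open>E m\<close>: the exponent of the fibre
    coordinate \<open>j\<close> is solved from the first and that of the base variable 0 from the
    second. The remaining \<open>n\<close> of the \<open>4 + k\<close> exponents range freely below
    \<open>s\<close>.\<close>
  define J where "J = {..<4 + k} - {0, 4 + j}"
  define P where "P = PiE J (\<lambda>_. {..<s})"
  define S where "S h = (\<Sum>i\<in>{..<k} - {j}. h (4 + i))" for h :: "nat \<Rightarrow> nat"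
  define a where "a h = (\<lambda>i. if i \<in> J then h i else if i = 4 + j then m - S h else 0)" for h
  define e where "e h = (a h)(0 := (\<Sum>i<k. a h (4 + i) * b i) - (h 1 + h 2 + h 3))" for h
  have card_J: "card J = n" and fin_J: "finite J"
    using j n by (auto simp: J_def card_Diff_subset)
  have card_P: "card P = s ^ n" unfolding P_def using fin_J by (simp add: card_PiE card_J)
  have fin_P: "finite P" unfolding P_def using fin_J by (intro finite_PiE) auto
  have less: "h i < s" if "h \<in> P" "i \<in> J" for h i
    using that unfolding P_def by (auto dest: PiE_mem)
  have eE: "e h \<in> E m" if h: "h \<in> P" for h
  proof -
    have low: "h 1 < s" "h 2 < s" "h 3 < s" using h less by (auto simp: J_def)
    have "S h \<le> (\<Sum>i\<in>{..<k} - {j}. s)"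
      unfolding S_def using less[OF h] by (intro sum_mono less_imp_le) (auto simp: J_def)
    also have "\<dots> \<le> k * s" using j by simp
    finally have S: "S h \<le> k * s" .
    have a4: "a h (4 + j) = m - S h" by (simp add: a_def J_def)
    have big: "S h + 3 * s \<le> m" using S by (simp add: m_def t_def algebra_simps)
    have "(\<Sum>i<k. a h (4 + i)) = a h (4 + j) + (\<Sum>i\<in>{..<k} - {j}. a h (4 + i))"
      using j by (intro sum.remove) auto
    also have "(\<Sum>i\<in>{..<k} - {j}. a h (4 + i)) = S h"
      unfolding S_def by (intro sum.cong) (auto simp: a_def J_def)
    finally have y: "(\<Sum>i<k. a h (4 + i)) = m" using a4 big by simp
    \<comment> \<open>Positivity of \<open>b j\<close> enters here: the large exponent of coordinate
      \<open>j\<close> forces a base degree with room for three free base exponents.\<close>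
    have "3 * s \<le> a h (4 + j)" using a4 big by simp
    also have "\<dots> \<le> a h (4 + j) * b j" using bj by simp
    also have "\<dots> \<le> (\<Sum>i<k. a h (4 + i) * b i)"
      using j member_le_sum[of j "{..<k}" "\<lambda>i. a h (4 + i) * b i"] by simp
    finally have "h 1 + h 2 + h 3 \<le> (\<Sum>i<k. a h (4 + i) * b i)" using low by simp
    moreover have "e h 0 = (\<Sum>i<k. a h (4 + i) * b i) - (h 1 + h 2 + h 3)" by (simp add: e_def)
    moreover have "e h 1 = h 1" "e h 2 = h 2" "e h 3 = h 3" by (auto simp: e_def a_def J_def)
    moreover have "(\<Sum>l<4. e h l) = e h 0 + e h 1 + e h 2 + e h 3" by (simp add: eval_nat_numeral)
    ultimately have "(\<Sum>l<4. e h l) = (\<Sum>i<k. a h (4 + i) * b i)" by simp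
    moreover have "e h (4 + i) = a h (4 + i)" for i by (simp add: e_def)
    moreover have "e h \<in> expo (4 + k)" using j by (auto simp: expo_def e_def a_def J_def)
    ultimately show ?thesis using y by (simp add: E_def)
  qed
  have restr: "h i = e h i" if "i \<in> J" for h i using that by (simp add: e_def a_def J_def)
  have inj: "inj_on e P"
  proof (rule inj_onI)
    fix h h' assume h: "h \<in> P" "h' \<in> P" and eq: "e h = e h'"
    show "h = h'"
    proof (rule PiE_ext[OF h[unfolded P_def]])
      fix i assume "i \<in> J"
      then show "h i = h' i" using restr[of i h] restr[of i h'] eq by simp
    qed
  qed
  have "\<exists>r f. f \<in> e ` P \<and> r f \<noteq> 0 \<and> (\<forall>z. (\<Sum>f\<in>e ` P. r f * monom_fun (4 + k) f z) = 0)"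
  proof (rule dependent_family[OF finB])
    show "finite (e ` P)" using fin_P by simp
    show "card ?B < card (e ` P)" using upper by (simp add: card_image[OF inj] card_P)
    fix f assume "f \<in> e ` P"
    then have "monom_fun (4 + k) f \<in> R m" using eE by (auto simp: R_def)
    then show "monom_fun (4 + k) f \<in> fs.span ?B"
      using sp unfolding m_def by blast
  qed
  then obtain r f where f: "f \<in> e ` P" "r f \<noteq> 0" "\<And>z. (\<Sum>f\<in>e ` P. r f * monom_fun (4 + k) f z) = 0"
    by blast
  have "r f = 0"
  proof (rule monom_fun_independent[OF _ _ f(3) f(1)])
    show "finite (e ` P)" using fin_P by simp
    fix x y assume "x \<in> e ` P" "y \<in> e ` P" and eq: "\<And>i. i < 4 + k \<Longrightarrow> x i = y i"
    then have "x \<in> expo (4 + k)" "y \<in> expo (4 + k)" using eE by (auto simp: E_def)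
    then show "x = y" using eq by (auto simp: expo_def fun_eq_iff) (metis not_le)
  qed
  with f(2) show False by simp
qed

end

section \<open>The flag variety and its charts\<close>

lemma carrier_SL: "A \<in> carrier (SL n) \<longleftrightarrow> A \<in> carrier_mat n n \<and> det A = 1"
  by (simp add: SL_def)

lemma mult_SL [simp]: "A \<otimes>\<^bsub>SL n\<^esub> B = A * B"
  by (simp add: SL_def)

lemma one_SL [simp]: "\<one>\<^bsub>SL n\<^esub> = 1\<^sub>m n"
  by (simp add: SL_def)

lemma adj_mat_SL:
  assumes "A \<in> carrier (SL n)"
  shows "adj_mat A \<in> carrier (SL n)" "A * adj_mat A = 1\<^sub>m n" "adj_mat A * A = 1\<^sub>m n"
proof -
  have A: "A \<in> carrier_mat n n" "det A = 1" using assms by (auto simp: carrier_SL)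
  note adj = adj_mat[OF A(1)]
  have one: "1 \<cdot>\<^sub>m 1\<^sub>m n = (1\<^sub>m n :: complex mat)" by (rule eq_matI) auto
  show "A * adj_mat A = 1\<^sub>m n" using adj(2) A(2) one by simp
  show 1: "adj_mat A * A = 1\<^sub>m n" using adj(3) A(2) one by simp
  have "det (adj_mat A) * det A = 1" using det_mult[OF adj(1) A(1)] 1 by simp
  then show "adj_mat A \<in> carrier (SL n)" using adj(1) A(2) by (simp add: carrier_SL)
qed

lemma group_SL: "group (SL n)"
proof (rule groupI)
  fix x y assume "x \<in> carrier (SL n)" "y \<in> carrier (SL n)"
  then show "x \<otimes>\<^bsub>SL n\<^esub> y \<in> carrier (SL n)" by (auto simp: carrier_SL det_mult)
next
  fix x y z assume "x \<in> carrier (SL n)" "y \<in> carrier (SL n)" "z \<in> carrier (SL n)"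
  then show "x \<otimes>\<^bsub>SL n\<^esub> y \<otimes>\<^bsub>SL n\<^esub> z = x \<otimes>\<^bsub>SL n\<^esub> (y \<otimes>\<^bsub>SL n\<^esub> z)"
    by (auto simp: carrier_SL)
next
  fix x assume x: "x \<in> carrier (SL n)"
  then show "\<one>\<^bsub>SL n\<^esub> \<otimes>\<^bsub>SL n\<^esub> x = x" by (auto simp: carrier_SL)
  show "\<exists>y\<in>carrier (SL n). y \<otimes>\<^bsub>SL n\<^esub> x = \<one>\<^bsub>SL n\<^esub>"
    using adj_mat_SL[OF x] by (intro bexI[of _ "adj_mat x"]) auto
qed (auto simp: carrier_SL)

lemma mat_mult_index:
  assumes "A \<in> carrier_mat n n" "B \<in> carrier_mat n n" "i < n" "j < n"
  shows "(A * B) $$ (i, j) = (\<Sum>r<n. A $$ (i, r) * B $$ (r, j))"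
  using assms by (auto simp: scalar_prod_def atLeast0LessThan intro!: sum.cong)

text \<open>The stabiliser of the standard flag of coordinate subspaces of dimensions 1 to
  \<open>k\<close>: beyond determinant 1, only the first \<open>k\<close> columns are
  constrained.\<close>

definition flag_stabilizer :: "nat \<Rightarrow> nat \<Rightarrow> complex mat set" where
  "flag_stabilizer n k = {A \<in> carrier (SL n). \<forall>c<k. \<forall>r<n. c < r \<longrightarrow> A $$ (r, c) = 0}"

lemma flag_stabilizer_mult:
  assumes "A \<in> flag_stabilizer n k" "B \<in> flag_stabilizer n k" "k \<le> n"
  shows "A * B \<in> flag_stabilizer n k"
proof -
  have A: "A \<in> carrier (SL n)" and B: "B \<in> carrier (SL n)"
    and 0: "\<And>r c. c < k \<Longrightarrow> r < n \<Longrightarrow> c < r \<Longrightarrow> A $$ (r, c) = 0 \<and> B $$ (r, c) = 0"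
    using assms by (auto simp: flag_stabilizer_def)
  have "(A * B) $$ (r, c) = 0" if "c < k" "r < n" "c < r" for r c
  proof -
    have "A $$ (r, s) * B $$ (s, c) = 0" if "s < n" for s
      using 0[of c s] 0[of s r] that \<open>c < k\<close> \<open>r < n\<close> \<open>c < r\<close> by (cases "s \<le> c") auto
    moreover have "(A * B) $$ (r, c) = (\<Sum>s<n. A $$ (r, s) * B $$ (s, c))"
      using A B that assms(3) by (intro mat_mult_index) (auto simp: carrier_SL)
    ultimately show ?thesis by (simp add: sum.neutral)
  qed
  moreover have "A * B \<in> carrier (SL n)" using A B by (auto simp: carrier_SL det_mult)
  ultimately show ?thesis by (simp add: flag_stabilizer_def)
qed

text \<open>The adjugate is the inverse here. In column \<open>c\<close> of its product with
  \<open>A\<close> a single term survives once the earlier columns are known to be triangular, and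
  the diagonal entry of \<open>A\<close> is nonzero.\<close>

lemma flag_stabilizer_adj_mat:
  assumes A: "A \<in> flag_stabilizer n k" and "k \<le> n"
  shows "adj_mat A \<in> flag_stabilizer n k"
proof -
  let ?B = "adj_mat A"
  have S: "A \<in> carrier (SL n)" using A by (simp add: flag_stabilizer_def)
  note adj = adj_mat_SL[OF S]
  have "\<forall>i<n. c < i \<longrightarrow> ?B $$ (i, c) = 0" if "c < k" for c
    using that
  proof (induction c rule: less_induct)
    case (less c)
    have c: "c < n" using less.prems assms(2) by simp
    have eq: "?B $$ (i, c) * A $$ (c, c) = (if i = c then 1 else 0)" if i: "i < n" "c \<le> i" for i
    proof -
      have "(if i = c then 1 else 0) = (?B * A) $$ (i, c)" using adj(3) i c by simp
      also have "\<dots> = (\<Sum>r<n. ?B $$ (i, r) * A $$ (r, c))"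
        using S adj(1) i c by (intro mat_mult_index) (auto simp: carrier_SL)
      also have "\<dots> = (\<Sum>r\<in>{c}. ?B $$ (i, r) * A $$ (r, c))"
      proof (rule sum.mono_neutral_right)
        show "\<forall>r\<in>{..<n} - {c}. ?B $$ (i, r) * A $$ (r, c) = 0"
        proof
          fix r assume r: "r \<in> {..<n} - {c}"
          show "?B $$ (i, r) * A $$ (r, c) = 0"
          proof (cases "r < c")
            case True
            then show ?thesis using less.IH[of r] less.prems i by simp
          next
            case False
            then show ?thesis using A r less.prems by (simp add: flag_stabilizer_def)
          qed
        qed
      qed (use c in auto)
      finally show ?thesis by simp
    qed
    from eq[of c] c have "A $$ (c, c) \<noteq> 0" by auto
    show ?case
    proof (intro allI impI)
      fix i assume "i < n" "c < i"
      then show "?B $$ (i, c) = 0" using eq[of i] \<open>A $$ (c, c) \<noteq> 0\<close> by simp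
    qed
  qed
  then show ?thesis using adj(1) by (simp add: flag_stabilizer_def)
qed

lemma subgroup_flag_stabilizer:
  assumes "k \<le> n"
  shows "subgroup (flag_stabilizer n k) (SL n)"
proof (rule group.subgroupI[OF group_SL])
  show "flag_stabilizer n k \<subseteq> carrier (SL n)" by (auto simp: flag_stabilizer_def)
  have "1\<^sub>m n \<in> flag_stabilizer n k" using assms by (auto simp: flag_stabilizer_def carrier_SL)
  then show "flag_stabilizer n k \<noteq> {}" by blast
  fix A assume A: "A \<in> flag_stabilizer n k"
  then have S: "A \<in> carrier (SL n)" by (simp add: flag_stabilizer_def)
  have "inv\<^bsub>SL n\<^esub> A = adj_mat A"
    using adj_mat_SL[OF S] S by (intro group.inv_equality[OF group_SL]) auto
  then show "inv\<^bsub>SL n\<^esub> A \<in> flag_stabilizer n k" using flag_stabilizer_adj_mat[OF A assms] by simp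
next
  fix A B assume "A \<in> flag_stabilizer n k" "B \<in> flag_stabilizer n k"
  then show "A \<otimes>\<^bsub>SL n\<^esub> B \<in> flag_stabilizer n k" using flag_stabilizer_mult[OF _ _ assms] by simp
qed

text \<open>Bruhat decomposition of the lower right 2 by 2 block: either its lower left entry
  vanishes and the matrix is in the Borel subgroup, or a column operation and the reflection bring
  it there.\<close>

lemma minimal_parabolic_eq:
  assumes n: "n = Suc (Suc k)"
  shows "minimal_parabolic n (n - 1) = flag_stabilizer n k"
proof
  define \<sigma> where "\<sigma> = simple_reflection n (n - 1)"
  have s: "\<sigma> \<in> carrier (SL n)" unfolding \<sigma>_def using n by (intro simple_reflection_in_SL) auto
  have mp: "minimal_parabolic n (n - 1) =
      borel_SL n \<union> {x * \<sigma> * y | x y. x \<in> borel_SL n \<and> y \<in> borel_SL n}"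
    unfolding minimal_parabolic_def \<sigma>_def by (auto simp: r_coset_def set_mult_def)
  have s_eq: "\<sigma> = multrow (n - 1) (- 1) (swaprows_mat n (n - 1 - 1) (n - 1))"
    unfolding \<sigma>_def simple_reflection_def by (rule multrow_mat[of _ n n, symmetric]) simp
  have s_idx: "\<sigma> $$ (r, c) = (if r = k then (if c = Suc k then 1 else 0)
      else if r = Suc k then (if c = k then - 1 else 0) else if r = c then 1 else 0)"
    if "r < n" "c < n" for r c
    unfolding s_eq using that n by (auto simp: swaprows_mat_def)
  have borel: "borel_SL n \<subseteq> flag_stabilizer n k"
    using n by (auto simp: borel_SL_def flag_stabilizer_def carrier_SL upper_triangularD)
  have s_stab: "\<sigma> \<in> flag_stabilizer n k"
  proof -
    have "\<sigma> $$ (r, c) = 0" if "c < k" "r < n" "c < r" for r c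
      using s_idx[of r c] that n by (auto split: if_splits)
    then show ?thesis using s by (simp add: flag_stabilizer_def)
  qed
  have kn: "k \<le> n" using n by simp
  have lt: "k < n" "Suc k < n" "\<And>r. r < k \<Longrightarrow> r < n" using n by auto
  have cases: "c < k \<or> c = k \<or> c = Suc k" if "c < n" for c using that n by linarith
  show "minimal_parabolic n (n - 1) \<subseteq> flag_stabilizer n k"
    using borel s_stab flag_stabilizer_mult[OF _ _ kn]
    unfolding mp by blast
  show "flag_stabilizer n k \<subseteq> minimal_parabolic n (n - 1)"
  proof
    fix p assume p: "p \<in> flag_stabilizer n k"
    then have pS: "p \<in> carrier (SL n)" and p0: "\<And>c r. c < k \<Longrightarrow> r < n \<Longrightarrow> c < r \<Longrightarrow> p $$ (r, c) = 0"
      by (auto simp: flag_stabilizer_def)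
    have pc: "p \<in> carrier_mat n n" using pS by (simp add: carrier_SL)
    show "p \<in> minimal_parabolic n (n - 1)"
    proof (cases "p $$ (Suc k, k) = 0")
      case True
      have "upper_triangular p"
      proof (rule upper_triangularI)
        fix i j assume ij: "j < i" "i < dim_row p"
        then have "i < n" using pc by simp
        then consider "j < k" | "j = k" "i = Suc k" using ij n by linarith
        then show "p $$ (i, j) = 0" by cases (use p0 ij \<open>i < n\<close> True in auto)
      qed
      then show ?thesis using pS unfolding mp by (simp add: borel_SL_def)
    next
      case False
      \<comment> \<open>Adding \<open>x\<close> times column \<open>k\<close> to column
        \<open>Suc k\<close> kills the last diagonal entry; exchanging these columns with a sign
        then gives the triangular \<open>b\<close>, and \<open>w\<close> undoes the column
        operation.\<close>
      define x where "x = - p $$ (Suc k, Suc k) / p $$ (Suc k, k)"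
      define b where "b = mat n n (\<lambda>(i, c). if c = k then p $$ (i, Suc k) + x * p $$ (i, k)
        else if c = Suc k then - p $$ (i, k) else p $$ (i, c))"
      define w where "w = mat n n (\<lambda>(i, c). if i = c then 1 else if i = k \<and> c = Suc k then - x else 0)"
      have bc: "b \<in> carrier_mat n n" and wc: "w \<in> carrier_mat n n" and sc: "\<sigma> \<in> carrier_mat n n"
        using s by (auto simp: b_def w_def carrier_SL)
      have ut_w: "upper_triangular w"
        by (rule upper_triangularI) (auto simp: w_def)
      have "diag_mat w = replicate n 1"
        by (rule nth_equalityI) (auto simp: diag_mat_def w_def)
      then have "det w = 1" using det_upper_triangular[OF ut_w wc] by simp
      have wB: "w \<in> borel_SL n" using ut_w wc \<open>det w = 1\<close> by (simp add: borel_SL_def carrier_SL)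
      have bs: "(b * \<sigma>) $$ (i, c) = (if c = k then p $$ (i, k)
          else if c = Suc k then p $$ (i, Suc k) + x * p $$ (i, k) else p $$ (i, c))"
        if ic: "i < n" "c < n" for i c
      proof -
        have "(b * \<sigma>) $$ (i, c) = (\<Sum>r<n. b $$ (i, r) * \<sigma> $$ (r, c))"
          using bc sc ic by (rule mat_mult_index)
        also have "\<dots> = (\<Sum>r<k. b $$ (i, r) * \<sigma> $$ (r, c)) + b $$ (i, k) * \<sigma> $$ (k, c)
            + b $$ (i, Suc k) * \<sigma> $$ (Suc k, c)"
          by (simp add: n)
        also have "(\<Sum>r<k. b $$ (i, r) * \<sigma> $$ (r, c)) = (\<Sum>r<k. if r = c then p $$ (i, c) else 0)"
          using ic lt by (intro sum.cong) (auto simp: b_def s_idx)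
        finally show ?thesis using ic lt cases[OF ic(2)] by (auto simp: b_def s_idx)
      qed
      have "p = b * \<sigma> * w"
      proof (rule eq_matI)
        show "dim_row p = dim_row (b * \<sigma> * w)" "dim_col p = dim_col (b * \<sigma> * w)"
          using pc bc wc by auto
        fix i c assume "i < dim_row (b * \<sigma> * w)" "c < dim_col (b * \<sigma> * w)"
        then have ic: "i < n" "c < n" using bc wc by auto
        have "(b * \<sigma> * w) $$ (i, c) = (\<Sum>r<n. (b * \<sigma>) $$ (i, r) * w $$ (r, c))"
          using bc sc wc ic by (intro mat_mult_index) auto
        also have "\<dots> = (\<Sum>r<k. (b * \<sigma>) $$ (i, r) * w $$ (r, c)) + (b * \<sigma>) $$ (i, k) * w $$ (k, c)
            + (b * \<sigma>) $$ (i, Suc k) * w $$ (Suc k, c)"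
          by (simp add: n)
        also have "(\<Sum>r<k. (b * \<sigma>) $$ (i, r) * w $$ (r, c)) = (\<Sum>r<k. if r = c then p $$ (i, c) else 0)"
          using ic lt by (intro sum.cong) (auto simp: bs w_def)
        finally show "p $$ (i, c) = (b * \<sigma> * w) $$ (i, c)"
          using ic lt cases[OF ic(2)] by (auto simp: bs w_def)
      qed
      moreover have "b \<in> borel_SL n"
      proof -
        have "det p = det b * det \<sigma> * det w"
          using \<open>p = b * \<sigma> * w\<close> bc sc wc by (simp add: det_mult[of _ n])
        then have "det b = 1" using pS s \<open>det w = 1\<close> by (simp add: carrier_SL)
        moreover have "upper_triangular b"
        proof (rule upper_triangularI)
          fix i j assume ij: "j < i" "i < dim_row b"
          then have "i < n" using bc by simp
          show "b $$ (i, j) = 0"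
          proof (cases "j < k")
            case True
            then show ?thesis using p0[OF True \<open>i < n\<close> ij(1)] lt(3) \<open>i < n\<close> by (simp add: b_def)
          next
            case j: False
            then have "j = k" "i = Suc k" using ij(1) \<open>i < n\<close> n by linarith+
            then show ?thesis using lt False by (simp add: b_def x_def)
          qed
        qed
        ultimately show ?thesis using bc by (simp add: borel_SL_def carrier_SL)
      qed
      ultimately show ?thesis using wB
        unfolding mp by blast
    qed
  qed
qed

section \<open>Polynomial functions, homogeneous coordinates and regular functions\<close>

lemma poly_funs_sum:
  "(\<And>a. a \<in> A \<Longrightarrow> f a \<in> poly_funs C) \<Longrightarrow> (\<lambda>x. \<Sum>a\<in>A. f a x) \<in> poly_funs C"
  by (induction A rule: infinite_finite_induct) (auto intro: poly_funs.intros)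

lemma poly_funs_prod:
  "(\<And>a. a \<in> A \<Longrightarrow> f a \<in> poly_funs C) \<Longrightarrow> (\<lambda>x. \<Prod>a\<in>A. f a x) \<in> poly_funs C"
  by (induction A rule: infinite_finite_induct) (auto intro: poly_funs.intros)

lemma poly_funs_det:
  assumes "\<And>x. M x \<in> carrier_mat m m" "\<And>i j. i < m \<Longrightarrow> j < m \<Longrightarrow> (\<lambda>x. M x $$ (i, j)) \<in> poly_funs C"
  shows "(\<lambda>x. det (M x)) \<in> poly_funs C"
proof -
  have eq: "det (M x) = (\<Sum>\<pi>\<in>{\<pi>. \<pi> permutes {0..<m}}. signof \<pi> * (\<Prod>i\<in>{0..<m}. M x $$ (i, \<pi> i)))" for x
    using det_def'[OF assms(1)] by simp
  show ?thesis
    unfolding eq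
  proof (intro poly_funs_sum poly_funs.mult poly_funs.const poly_funs_prod assms(2))
    fix \<pi> i assume "\<pi> \<in> {\<pi>. \<pi> permutes {0..<m}}" "i \<in> {0..<m}"
    then show "i < m" "\<pi> i < m" using permutes_in_image[of \<pi> "{0..<m}" i] by auto
  qed
qed

lemma hom_poly_rel_poly4:
  assumes "(d, f) \<in> hom_poly_rel (vec_coords 4)"
  shows "\<exists>p. \<forall>z. f (vec 4 z) = ev p z"
  using assms
proof induction
  case (const c)
  then show ?case by (intro exI[of _ "cst c"]) simp
next
  case (coord f)
  then obtain i where "i < 4" "f = (\<lambda>v. v $ i)" by (auto simp: vec_coords_def)
  then show ?case by (intro exI[of _ "X i"]) simp
next
  case (add d f g)
  then obtain p q where "\<forall>z. f (vec 4 z) = ev p z" "\<forall>z. g (vec 4 z) = ev q z" by blast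
  then show ?case by (intro exI[of _ "p + q"]) simp
next
  case (mult d f e g)
  then obtain p q where "\<forall>z. f (vec 4 z) = ev p z" "\<forall>z. g (vec 4 z) = ev q z" by blast
  then show ?case by (intro exI[of _ "p * q"]) simp
qed

lemma hom_poly_rel_scale:
  assumes "(d, f) \<in> hom_poly_rel (vec_coords m)" "v \<in> carrier_vec m"
  shows "f (c \<cdot>\<^sub>v v) = c ^ d * f v"
  using assms
  by induction (auto simp: vec_coords_def algebra_simps power_add)

definition pt :: "(nat \<Rightarrow> complex) \<Rightarrow> complex vec set" where
  "pt z = proj_point (vec 4 z)"

lemma vec_in_pt: "vec 4 z \<in> pt z"
  unfolding pt_def proj_point_def by (intro CollectI exI[of _ 1]) auto

lemma pt_in_proj_points:
  assumes "nz z"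
  shows "pt z \<in> proj_points 3"
proof -
  obtain l where l: "l < 4" "z l \<noteq> 0" using assms by blast
  have "vec 4 z \<noteq> 0\<^sub>v 4"
  proof
    assume "vec 4 z = 0\<^sub>v 4"
    then have "vec 4 z $ l = 0" using l(1) by simp
    then show False using l by simp
  qed
  then show ?thesis unfolding pt_def proj_points_def by (intro imageI) simp
qed

lemma proj_points_pt:
  assumes "L \<in> proj_points 3"
  shows "\<exists>z. nz z \<and> L = pt z"
proof -
  obtain v where v: "v \<in> carrier_vec 4" "v \<noteq> 0\<^sub>v 4" "L = proj_point v"
    using assms by (auto simp: proj_points_def)
  have eq: "v = vec 4 (\<lambda>i. v $ i)" using v(1) by (intro eq_vecI) auto
  have "nz (\<lambda>i. v $ i)"
  proof (rule ccontr)
    assume "\<not> ?thesis"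
    then have "v = 0\<^sub>v 4" using v(1) by (intro eq_vecI) auto
    then show False using v(2) by simp
  qed
  moreover have "L = pt (\<lambda>i. v $ i)" unfolding pt_def v(3) using eq by simp
  ultimately show ?thesis by blast
qed

lemma pt_scale:
  assumes "t \<noteq> 0"
  shows "pt (\<lambda>l. t * z l) = pt z"
proof -
  have "vec 4 (\<lambda>l. t * z l) = t \<cdot>\<^sub>v vec 4 z" by (intro eq_vecI) auto
  moreover have "proj_point (t \<cdot>\<^sub>v v) = proj_point v" for v
    unfolding proj_point_def
  proof (intro equalityI subsetI)
    fix u assume "u \<in> {c \<cdot>\<^sub>v (t \<cdot>\<^sub>v v) | c. c \<noteq> 0}"
    then obtain c where "c \<noteq> 0" "u = (c * t) \<cdot>\<^sub>v v" by (auto simp: smult_smult_assoc)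
    then show "u \<in> {c \<cdot>\<^sub>v v | c. c \<noteq> 0}" using assms by (intro CollectI exI[of _ "c * t"]) simp
  next
    fix u assume "u \<in> {c \<cdot>\<^sub>v v | c. c \<noteq> 0}"
    then obtain c where "c \<noteq> 0" "u = c \<cdot>\<^sub>v v" by blast
    then show "u \<in> {c \<cdot>\<^sub>v (t \<cdot>\<^sub>v v) | c. c \<noteq> 0}"
      using assms by (intro CollectI exI[of _ "c / t"]) (simp add: smult_smult_assoc)
  qed
  ultimately show ?thesis by (simp add: pt_def)
qed

text \<open>A basic open set inside the neighbourhood where \<open>h\<close> is a quotient supplies
  \<open>e\<close>. Keeping \<open>e\<close> apart from the denominator makes it possible to
  multiply by it later, so that products vanish off the neighbourhood.\<close>

lemma regular_at_point:
  assumes h: "h \<in> proj_regular 3 U" and z0: "pt z0 \<in> U"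
  obtains f g e where "ev e z0 \<noteq> 0"
    "\<And>z. nz z \<Longrightarrow> ev e z \<noteq> 0 \<Longrightarrow> pt z \<in> U \<and> ev g z \<noteq> 0 \<and> h (pt z) = ev f z / ev g z"
proof -
  obtain V d f g where V: "openin (proj_zariski 3) V" "pt z0 \<in> V" "V \<subseteq> U"
    and fg: "f \<in> hom_poly_funs (vec_coords 4) d" "g \<in> hom_poly_funs (vec_coords 4) d"
    "\<And>M v. M \<in> V \<Longrightarrow> v \<in> M \<Longrightarrow> g v \<noteq> 0 \<and> h M = f v / g v"
    using h z0 unfolding proj_regular_def by force
  obtain p where p: "\<And>z. f (vec 4 z) = ev p z"
    using hom_poly_rel_poly4 fg(1) unfolding hom_poly_funs_def by blast
  obtain q where q: "\<And>z. g (vec 4 z) = ev q z"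
    using hom_poly_rel_poly4 fg(2) unfolding hom_poly_funs_def by blast
  obtain K where K: "K \<subseteq> Collect (proj_open_base 3)" "\<Union>K = V"
    using V(1) unfolding openin_proj_zariski union_of_def arbitrary_def by auto
  then obtain D where D: "D \<subseteq> V" "pt z0 \<in> D" "proj_open_base 3 D" using V(2) by blast
  obtain d' k where k: "(d', k) \<in> hom_poly_rel (vec_coords 4)"
    "D = {L \<in> proj_points 3. \<forall>v\<in>L. k v \<noteq> 0}"
    using D(3) unfolding proj_open_base_def hom_poly_funs_def by auto
  obtain e where e: "\<And>z. k (vec 4 z) = ev e z" using hom_poly_rel_poly4[OF k(1)] by blast
  show ?thesis
  proof (rule that)
    show "ev e z0 \<noteq> 0" using D(2) vec_in_pt[of z0] unfolding k(2) e[symmetric] by blast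
    fix z assume z: "nz z" "ev e z \<noteq> 0"
    have "k v \<noteq> 0" if "v \<in> pt z" for v
    proof -
      obtain c where c: "c \<noteq> 0" "v = c \<cdot>\<^sub>v vec 4 z" using \<open>v \<in> pt z\<close> by (auto simp: pt_def proj_point_def)
      have "k v = c ^ d' * k (vec 4 z)" unfolding c(2) by (rule hom_poly_rel_scale[OF k(1)]) simp
      then show ?thesis using c(1) z(2) by (simp add: e)
    qed
    then have "pt z \<in> V" using D(1) pt_in_proj_points[OF z(1)] unfolding k(2) by blast
    then show "pt z \<in> U \<and> ev q z \<noteq> 0 \<and> h (pt z) = ev p z / ev q z"
      using fg(3)[OF _ vec_in_pt] V(3) by (auto simp: p q)
  qed
qed


text \<open>\<open>lead n i g\<^sub>0 g\<close> is the leading \<open>(i + 1) \<times> (i + 1)\<close> block of \<open>g\<^sub>0\<inverse> g\<close>. Where it is invertible,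
  \<open>chart_vec\<close> describes the unique vector in the span of the first \<open>i + 1\<close> columns of \<open>g\<close> whose
  first \<open>i + 1\<close> coordinates with respect to the columns of \<open>g\<^sub>0\<close> are \<open>0, \<dots>, 0, 1\<close>; so it depends on the flag
  only.\<close>

definition lead :: "nat \<Rightarrow> nat \<Rightarrow> complex mat \<Rightarrow> complex mat \<Rightarrow> complex mat" where
  "lead n i g0 g = mat (Suc i) (Suc i) (\<lambda>(a, c). \<Sum>s<n. adj_mat g0 $$ (a, s) * g $$ (s, c))"

text \<open>Numerator in Cramer's rule: the last column of the adjugate solves for the unit vector
  \<open>i\<close> up to the determinant.\<close>

definition chart_num :: "nat \<Rightarrow> nat \<Rightarrow> complex mat \<Rightarrow> nat \<Rightarrow> complex mat \<Rightarrow> complex" where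
  "chart_num n i g0 s g = (\<Sum>c<Suc i. g $$ (s, c) * adj_mat (lead n i g0 g) $$ (c, i))"

definition chart_vec :: "nat \<Rightarrow> nat \<Rightarrow> complex mat \<Rightarrow> complex mat \<Rightarrow> (nat \<Rightarrow> complex) \<Rightarrow> bool" where
  "chart_vec n i g0 g y \<longleftrightarrow> (\<exists>d. \<forall>s<n. y s = (\<Sum>c<Suc i. g $$ (s, c) * d c)) \<and>
    (\<forall>a<Suc i. (\<Sum>s<n. adj_mat g0 $$ (a, s) * y s) = (if a = i then 1 else 0))"

lemma lead_carrier [simp]: "lead n i g0 g \<in> carrier_mat (Suc i) (Suc i)"
  by (simp add: lead_def)

lemma lead_apply:
  assumes "a < Suc i" "\<And>s. s < n \<Longrightarrow> y s = (\<Sum>c<Suc i. g $$ (s, c) * d c)"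
  shows "(\<Sum>s<n. adj_mat g0 $$ (a, s) * y s) = (\<Sum>c<Suc i. lead n i g0 g $$ (a, c) * d c)"
proof -
  have "(\<Sum>s<n. adj_mat g0 $$ (a, s) * y s) = (\<Sum>s<n. \<Sum>c<Suc i. adj_mat g0 $$ (a, s) * (g $$ (s, c) * d c))"
    by (intro sum.cong refl) (simp only: assms(2) sum_distrib_left lessThan_iff)
  also have "\<dots> = (\<Sum>c<Suc i. \<Sum>s<n. adj_mat g0 $$ (a, s) * (g $$ (s, c) * d c))" by (rule sum.swap)
  also have "\<dots> = (\<Sum>c<Suc i. lead n i g0 g $$ (a, c) * d c)"
    using assms(1) by (intro sum.cong) (auto simp: lead_def sum_distrib_right mult.assoc)
  finally show ?thesis .
qed

lemma chart_vec_exists: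
  assumes "det (lead n i g0 g) \<noteq> 0"
  shows "chart_vec n i g0 g (\<lambda>s. chart_num n i g0 s g / det (lead n i g0 g))"
proof -
  let ?A = "lead n i g0 g"
  let ?d = "\<lambda>c. adj_mat ?A $$ (c, i) / det ?A"
  have y: "chart_num n i g0 s g / det ?A = (\<Sum>c<Suc i. g $$ (s, c) * ?d c)" for s
    unfolding chart_num_def sum_divide_distrib by simp
  have "(\<Sum>s<n. adj_mat g0 $$ (a, s) * (chart_num n i g0 s g / det ?A)) = (if a = i then 1 else 0)"
    if a: "a < Suc i" for a
  proof -
    have "(\<Sum>s<n. adj_mat g0 $$ (a, s) * (chart_num n i g0 s g / det ?A)) = (\<Sum>c<Suc i. ?A $$ (a, c) * ?d c)"
      by (rule lead_apply[OF a y])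
    also have "\<dots> = (\<Sum>c<Suc i. ?A $$ (a, c) * adj_mat ?A $$ (c, i)) / det ?A"
      unfolding sum_divide_distrib by simp
    also have "(\<Sum>c<Suc i. ?A $$ (a, c) * adj_mat ?A $$ (c, i)) = (?A * adj_mat ?A) $$ (a, i)"
      by (rule mat_mult_index[symmetric]) (use a adj_mat(1)[OF lead_carrier] in auto)
    also have "\<dots> = (if a = i then det ?A else 0)"
      using a by (simp add: adj_mat(2)[OF lead_carrier])
    finally show ?thesis using assms by simp
  qed
  with y show ?thesis
    unfolding chart_vec_def by (intro conjI exI[of _ ?d] allI impI)
qed

lemma chart_vec_unique:
  assumes det: "det (lead n i g0 g) \<noteq> 0" and y: "chart_vec n i g0 g y" "chart_vec n i g0 g y'" and s: "s < n"
  shows "y s = y' s"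
proof -
  let ?A = "lead n i g0 g"
  obtain d d' where d: "\<And>s. s < n \<Longrightarrow> y s = (\<Sum>c<Suc i. g $$ (s, c) * d c)"
    and d': "\<And>s. s < n \<Longrightarrow> y' s = (\<Sum>c<Suc i. g $$ (s, c) * d' c)"
    using y unfolding chart_vec_def by blast
  have Ad: "(\<Sum>c<Suc i. ?A $$ (a, c) * d c) = (\<Sum>c<Suc i. ?A $$ (a, c) * d' c)" if a: "a < Suc i" for a
  proof -
    have 1: "(\<Sum>s<n. adj_mat g0 $$ (a, s) * y s) = (\<Sum>c<Suc i. ?A $$ (a, c) * d c)"
      by (rule lead_apply[OF a d])
    have 2: "(\<Sum>s<n. adj_mat g0 $$ (a, s) * y' s) = (\<Sum>c<Suc i. ?A $$ (a, c) * d' c)"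
      by (rule lead_apply[OF a d'])
    show ?thesis unfolding 1[symmetric] 2[symmetric] using y a unfolding chart_vec_def by simp
  qed
  have inv: "det ?A * f c = (\<Sum>a<Suc i. adj_mat ?A $$ (c, a) * (\<Sum>c<Suc i. ?A $$ (a, c) * f c))"
    if c: "c < Suc i" for c and f :: "nat \<Rightarrow> complex"
  proof -
    have "(\<Sum>a<Suc i. adj_mat ?A $$ (c, a) * (\<Sum>b<Suc i. ?A $$ (a, b) * f b))
        = (\<Sum>b<Suc i. (\<Sum>a<Suc i. adj_mat ?A $$ (c, a) * ?A $$ (a, b)) * f b)"
      unfolding sum_distrib_left sum_distrib_right mult.assoc by (rule sum.swap)
    also have "\<dots> = (\<Sum>b<Suc i. if b = c then det ?A * f c else 0)"
    proof (rule sum.cong)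
      fix b assume "b \<in> {..<Suc i}"
      then have b: "b < Suc i" by simp
      have "(\<Sum>a<Suc i. adj_mat ?A $$ (c, a) * ?A $$ (a, b)) = (adj_mat ?A * ?A) $$ (c, b)"
        by (rule mat_mult_index[symmetric]) (use b c adj_mat(1)[OF lead_carrier] in auto)
      also have "\<dots> = (if b = c then det ?A else 0)"
        using b c by (auto simp: adj_mat(3)[OF lead_carrier])
      finally show "(\<Sum>a<Suc i. adj_mat ?A $$ (c, a) * ?A $$ (a, b)) * f b = (if b = c then det ?A * f c else 0)"
        by simp
    qed simp
    also have "\<dots> = det ?A * f c" using c by (simp only: sum.delta finite_lessThan lessThan_iff if_True)
    finally show ?thesis by simp
  qed
  have "det ?A * d c = det ?A * d' c" if c: "c < Suc i" for c
    unfolding inv[OF c] using Ad by (intro sum.cong) auto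
  then have "d c = d' c" if "c < Suc i" for c using det that by simp
  then show ?thesis unfolding d[OF s] d'[OF s] by (intro sum.cong) auto
qed

lemma stabilizer_column:
  assumes p: "p \<in> flag_stabilizer n k" and g: "g \<in> carrier (SL n)" and i: "i < k" "k \<le> n"
    and sc: "s < n" "c < Suc i"
  shows "(g * p) $$ (s, c) = (\<Sum>r<Suc i. g $$ (s, r) * p $$ (r, c))"
proof -
  have pS: "p \<in> carrier (SL n)" using p by (simp add: flag_stabilizer_def)
  have "(g * p) $$ (s, c) = (\<Sum>r<n. g $$ (s, r) * p $$ (r, c))"
    using g pS i sc by (intro mat_mult_index) (auto simp: carrier_SL)
  also have "\<dots> = (\<Sum>r<Suc i. g $$ (s, r) * p $$ (r, c))"
    using p i sc by (intro sum.mono_neutral_right) (auto simp: flag_stabilizer_def)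
  finally show ?thesis .
qed

text \<open>Because \<open>i < k\<close>, right multiplication by \<open>p\<close> only recombines
  the first \<open>i + 1\<close> columns, so the normalised vector belongs to the coset.\<close>

lemma chart_vec_stabilizer:
  assumes p: "p \<in> flag_stabilizer n k" and g: "g \<in> carrier (SL n)" and i: "i < k" "k \<le> n"
    and y: "chart_vec n i g0 (g * p) y"
  shows "chart_vec n i g0 g y"
proof -
  obtain d where d: "\<And>s. s < n \<Longrightarrow> y s = (\<Sum>c<Suc i. (g * p) $$ (s, c) * d c)"
    using y unfolding chart_vec_def by blast
  have "y s = (\<Sum>r<Suc i. g $$ (s, r) * (\<Sum>c<Suc i. p $$ (r, c) * d c))" if s: "s < n" for s
  proof -
    have "y s = (\<Sum>c<Suc i. \<Sum>r<Suc i. g $$ (s, r) * (p $$ (r, c) * d c))"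
      unfolding d[OF s] using stabilizer_column[OF p g i s]
      by (intro sum.cong) (auto simp: sum_distrib_right mult.assoc simp del: sum.lessThan_Suc)
    also have "\<dots> = (\<Sum>r<Suc i. \<Sum>c<Suc i. g $$ (s, r) * (p $$ (r, c) * d c))" by (rule sum.swap)
    finally show ?thesis unfolding sum_distrib_left .
  qed
  then have "\<exists>d. \<forall>s<n. y s = (\<Sum>c<Suc i. g $$ (s, c) * d c)"
    by (intro exI[of _ "\<lambda>r. \<Sum>c<Suc i. p $$ (r, c) * d c"]) blast
  then show ?thesis using y unfolding chart_vec_def by blast
qed

text \<open>The leading block of \<open>g * p\<close> is that of \<open>g\<close> times the leading
  block of \<open>p\<close>; hence the domain of the chart is a union of cosets.\<close>

lemma det_lead_stabilizer:
  assumes p: "p \<in> flag_stabilizer n k" and g: "g \<in> carrier (SL n)" and i: "i < k" "k \<le> n"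
    and det: "det (lead n i g0 (g * p)) \<noteq> 0"
  shows "det (lead n i g0 g) \<noteq> 0"
proof -
  define q where "q = mat (Suc i) (Suc i) (\<lambda>(r, c). p $$ (r, c))"
  have "lead n i g0 (g * p) = lead n i g0 g * q"
  proof (rule eq_matI)
    fix a c assume "a < dim_row (lead n i g0 g * q)" "c < dim_col (lead n i g0 g * q)"
    then have ac: "a < Suc i" "c < Suc i" by (auto simp: lead_def q_def)
    have "lead n i g0 (g * p) $$ (a, c) = (\<Sum>s<n. adj_mat g0 $$ (a, s) * (g * p) $$ (s, c))"
      using ac by (simp add: lead_def)
    also have "\<dots> = (\<Sum>r<Suc i. lead n i g0 g $$ (a, r) * p $$ (r, c))"
      by (rule lead_apply[OF ac(1)]) (rule stabilizer_column[OF p g i _ ac(2)])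
    also have "\<dots> = (\<Sum>r<Suc i. lead n i g0 g $$ (a, r) * q $$ (r, c))"
      using ac by (intro sum.cong) (auto simp: q_def)
    also have "\<dots> = (lead n i g0 g * q) $$ (a, c)"
      by (rule mat_mult_index[symmetric]) (use ac in \<open>auto simp: q_def\<close>)
    finally show "lead n i g0 (g * p) $$ (a, c) = (lead n i g0 g * q) $$ (a, c)" .
  qed (auto simp: lead_def q_def)
  then have "det (lead n i g0 (g * p)) = det (lead n i g0 g) * det q"
    by (simp add: det_mult[of _ "Suc i"] q_def)
  then show ?thesis using det by auto
qed

lemma lead_self:
  assumes "g \<in> carrier (SL n)" "i < n"
  shows "lead n i g g = 1\<^sub>m (Suc i)"
proof (rule eq_matI)
  fix a c assume "a < dim_row (1\<^sub>m (Suc i))" "c < dim_col (1\<^sub>m (Suc i))"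
  then have ac: "a < Suc i" "c < Suc i" by auto
  have "(\<Sum>s<n. adj_mat g $$ (a, s) * g $$ (s, c)) = (adj_mat g * g) $$ (a, c)"
    by (rule mat_mult_index[symmetric])
      (use adj_mat_SL(1)[OF assms(1)] assms ac in \<open>auto simp: carrier_SL\<close>)
  then show "lead n i g g $$ (a, c) = 1\<^sub>m (Suc i) $$ (a, c)"
    using ac assms(2) by (simp add: lead_def adj_mat_SL(3)[OF assms(1)])
qed (auto simp: lead_def)

lemma poly_funs_entry: "i < n \<Longrightarrow> j < n \<Longrightarrow> (\<lambda>A. A $$ (i, j)) \<in> poly_funs (mat_coords n)"
  by (rule poly_funs.coord) (auto simp: mat_coords_def)

lemma poly_funs_lead:
  assumes "i < n" "a < Suc i" "c < Suc i"
  shows "(\<lambda>g. lead n i g0 g $$ (a, c)) \<in> poly_funs (mat_coords n)"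
proof -
  have "(\<lambda>g. \<Sum>s<n. adj_mat g0 $$ (a, s) * g $$ (s, c)) \<in> poly_funs (mat_coords n)"
    using assms by (intro poly_funs_sum poly_funs.mult poly_funs.const poly_funs_entry) auto
  then show ?thesis using assms by (simp add: lead_def)
qed

lemma poly_funs_det_lead:
  assumes "i < n"
  shows "(\<lambda>g. det (lead n i g0 g)) \<in> poly_funs (mat_coords n)"
  using assms by (intro poly_funs_det[where m = "Suc i"] poly_funs_lead) auto

lemma poly_funs_chart_num:
  assumes "i < n" "s < n"
  shows "chart_num n i g0 s \<in> poly_funs (mat_coords n)"
proof -
  have "(\<lambda>g. adj_mat (lead n i g0 g) $$ (c, i)) \<in> poly_funs (mat_coords n)" if c: "c < Suc i" for c
  proof -
    have "(\<lambda>g. (- 1) ^ (i + c) * det (mat_delete (lead n i g0 g) i c)) \<in> poly_funs (mat_coords n)"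
    proof (intro poly_funs.mult poly_funs.const poly_funs_det[where m = i])
      show "mat_delete (lead n i g0 g) i c \<in> carrier_mat i i" for g
        by (rule mat_delete_carrier[of _ "Suc i" "Suc i", simplified]) simp
      fix a b assume ab: "a < i" "b < i"
      have "(\<lambda>g. lead n i g0 g $$ (a, if b < c then b else Suc b)) \<in> poly_funs (mat_coords n)"
        using ab assms(1) by (intro poly_funs_lead) auto
      then show "(\<lambda>g. mat_delete (lead n i g0 g) i c $$ (a, b)) \<in> poly_funs (mat_coords n)"
        using ab by (simp add: mat_delete_def lead_def)
    qed
    moreover have "adj_mat (lead n i g0 g) $$ (c, i) = (- 1) ^ (i + c) * det (mat_delete (lead n i g0 g) i c)" for g
      using c by (simp add: adj_mat_def lead_def cofactor_def)
    ultimately show ?thesis by simp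
  qed
  then have "(\<lambda>g. \<Sum>c<Suc i. g $$ (s, c) * adj_mat (lead n i g0 g) $$ (c, i)) \<in> poly_funs (mat_coords n)"
    using assms by (intro poly_funs_sum poly_funs.mult poly_funs_entry) auto
  then show ?thesis by (simp only: chart_num_def[abs_def])
qed


section \<open>Charts of the flag variety and sections pulled back from them\<close>

abbreviation flag_quotient :: "nat \<Rightarrow> nat \<Rightarrow> complex mat set fun_space" where
  "flag_quotient n k \<equiv> SL_quotient n (flag_stabilizer n k)"

abbreviation coset :: "nat \<Rightarrow> nat \<Rightarrow> complex mat \<Rightarrow> complex mat set" where
  "coset n k g \<equiv> g <#\<^bsub>SL n\<^esub> flag_stabilizer n k"

lemma coset_eqD:
  assumes "coset n k g = coset n k g'" "g' \<in> carrier (SL n)" "k \<le> n"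
  shows "\<exists>p\<in>flag_stabilizer n k. g' = g * p"
proof -
  have "1\<^sub>m n \<in> flag_stabilizer n k"
    using subgroup.one_closed[OF subgroup_flag_stabilizer[OF assms(3)]] by simp
  moreover have "g' = g' * 1\<^sub>m n" using assms(2) right_mult_one_mat[of g' n n] by (simp add: carrier_SL)
  ultimately have "g' \<in> coset n k g'" unfolding l_coset_def mult_SL by blast
  then have "g' \<in> coset n k g" using assms(1) by simp
  then show ?thesis by (auto simp: l_coset_def)
qed

lemma coset_eqI:
  assumes g: "g \<in> carrier (SL n)" "g' \<in> carrier (SL n)" and "k \<le> n"
    and p: "adj_mat g * g' \<in> flag_stabilizer n k"
  shows "coset n k g = coset n k g'"
proof (rule group.l_repr_independence[OF group_SL _ g(1) subgroup_flag_stabilizer[OF assms(3)]])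
  have "g * (adj_mat g * g') = (g * adj_mat g) * g'"
    using g adj_mat_SL(1)[OF g(1)] by (intro assoc_mult_mat[symmetric, where ?n\<^sub>1.0 = n]) (auto simp: carrier_SL)
  also have "\<dots> = g'" using g(2) left_mult_one_mat[of g' n n] by (simp add: adj_mat_SL(2)[OF g(1)] carrier_SL)
  finally show "g' \<in> coset n k g" using p by (auto simp: l_coset_def intro!: bexI[of _ "adj_mat g * g'"])
qed

text \<open>\<open>U\<close> is a union of cosets, so its image is open in the quotient, and
  uniqueness of the normalised vector makes the functions independent of representatives. On the
  group they are quotients of polynomials with the determinant as denominator.\<close>

lemma regular_chart:
  assumes i: "i < k" and k: "k \<le> n" and g0: "g0 \<in> carrier (SL n)"
  obtains W h where "openin (Zariski (flag_quotient n k)) W" "coset n k g0 \<in> W"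
    "\<And>s. s < n \<Longrightarrow> h s \<in> Regular (flag_quotient n k) W"
    "\<And>g. g \<in> carrier (SL n) \<Longrightarrow> coset n k g \<in> W \<Longrightarrow> chart_vec n i g0 g (\<lambda>s. h s (coset n k g))"
proof -
  let ?C = "mat_coords n" and ?G = "carrier (SL n)"
  let ?d = "\<lambda>g. det (lead n i g0 g)"
  define U where "U = {g \<in> ?G. ?d g \<noteq> 0}"
  define W where "W = coset n k ` U"
  \<comment> \<open>An arbitrary representative of the coset; \<open>h_eq\<close> below shows that
    it may be replaced by any other in \<open>U\<close>.\<close>
  define r where "r = (\<lambda>Q. SOME g. g \<in> ?G \<and> coset n k g = Q)"
  define h where "h = (\<lambda>s Q. chart_num n i g0 s (r Q) / ?d (r Q))"
  have in_n: "i < n" using i k by simp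
  have r: "r (coset n k g) \<in> ?G" "coset n k (r (coset n k g)) = coset n k g" if "g \<in> ?G" for g
    using someI[of "\<lambda>x. x \<in> ?G \<and> coset n k x = coset n k g" g] that by (auto simp: r_def)
  have U: "g \<in> U" if g': "g' \<in> U" and g: "g \<in> ?G" and eq: "coset n k g = coset n k g'" for g g'
  proof -
    obtain p where "p \<in> flag_stabilizer n k" "g' = g * p"
      using coset_eqD[OF eq _ k] g' unfolding U_def by blast
    then show ?thesis using det_lead_stabilizer[OF _ g i k] g' g unfolding U_def by blast
  qed
  have pre: "{g \<in> ?G. coset n k g \<in> W} = U"
    using U by (auto simp: W_def) (auto simp: U_def)
  have points: "points (SL_variety n) = ?G"
    by (simp add: SL_variety_def affine_variety_def)
  have openU: "openin (affine_zariski ?C ?G) U"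
    unfolding openin_affine_zariski U_def
    by (intro arbitrary_union_of_inc) (auto simp: affine_open_base_def intro!: bexI[OF _ poly_funs_det_lead[OF in_n]])
  have chart: "chart_vec n i g0 g (\<lambda>s. h s (coset n k g))" if g: "g \<in> U" for g
  proof -
    let ?g = "r (coset n k g)"
    have gG: "g \<in> ?G" using g by (simp add: U_def)
    have "?g \<in> U" by (rule U[OF g r[OF gG]])
    then have "chart_vec n i g0 ?g (\<lambda>s. h s (coset n k g))"
      using chart_vec_exists[of n i g0 ?g] by (simp add: U_def h_def)
    moreover obtain p where "p \<in> flag_stabilizer n k" "?g = g * p"
      using coset_eqD[OF r(2)[OF gG, symmetric] r(1)[OF gG] k] by blast
    ultimately show ?thesis using chart_vec_stabilizer[OF _ gG i k] by metis
  qed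
  have h_eq: "h s (coset n k g) = chart_num n i g0 s g / ?d g" if "g \<in> U" "s < n" for s g
  proof -
    have "?d g \<noteq> 0" using that(1) by (simp add: U_def)
    from chart_vec_unique[OF this chart[OF that(1)] chart_vec_exists[OF this] that(2)] show ?thesis .
  qed
  show ?thesis
  proof (rule that)
    show "openin (Zariski (flag_quotient n k)) W"
      unfolding SL_quotient_def quotient_space_def fun_space.simps openin_quotient_zariski points pre
      using openU by (auto simp: W_def U_def SL_variety_def affine_variety_def)
    have "g0 \<in> U" using g0 by (simp add: U_def lead_self[OF g0 in_n])
    then show "coset n k g0 \<in> W" by (simp add: W_def)
    show "h s \<in> Regular (flag_quotient n k) W" if s: "s < n" for s
    proof -
      have "h s \<circ> coset n k \<in> affine_regular ?C ?G U"
        unfolding affine_regular_def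
      proof (intro CollectI ballI)
        fix x assume "x \<in> U"
        then show "\<exists>V. openin (affine_zariski ?C ?G) V \<and> x \<in> V \<and> V \<subseteq> U \<and>
            (\<exists>f\<in>poly_funs ?C. \<exists>g\<in>poly_funs ?C. \<forall>y\<in>V. g y \<noteq> 0 \<and> (h s \<circ> coset n k) y = f y / g y)"
          using openU poly_funs_chart_num[OF in_n s, of g0] poly_funs_det_lead[OF in_n, of g0] h_eq s
          by (intro exI[of _ U] conjI bexI[of _ "chart_num n i g0 s"] bexI[of _ ?d]) (auto simp: U_def)
      qed
      then show ?thesis
        by (simp add: SL_quotient_def quotient_space_def points pre)
          (simp add: SL_variety_def affine_variety_def)
    qed
    show "chart_vec n i g0 g (\<lambda>s. h s (coset n k g))" if "g \<in> ?G" "coset n k g \<in> W" for g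
      using chart that pre by blast
  qed
qed

text \<open>The chart functions centred at \<open>rep z0\<close>, pulled back along
  \<open>\<phi>\<close> and freed of denominators, form the vector \<open>w\<close>. Coordinate
  \<open>i\<close> of the normalised vector is 1 at \<open>z0\<close>, so \<open>w\<close> stays
  outside the smaller flag member there.\<close>

lemma local_section_exists:
  assumes mor: "variety_morphism (proj_space 3) (flag_quotient n k) \<phi>"
    and rep: "\<And>z. nz z \<Longrightarrow> rep z \<in> carrier (SL n) \<and> \<phi> (pt z) = coset n k (rep z)"
    and i: "i < k" and k: "k \<le> n" and z0: "nz z0"
  shows "\<exists>w. (\<forall>z. nz z \<longrightarrow> (\<forall>r. Suc i \<le> r \<longrightarrow> r < n \<longrightarrow>
      dot n (\<lambda>s. adj_mat (rep z) $$ (r, s)) (\<lambda>s. ev (w s) z) = 0)) \<and>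
    dot n (\<lambda>s. adj_mat (rep z0) $$ (i, s)) (\<lambda>s. ev (w s) z0) \<noteq> 0"
proof -
  let ?g0 = "rep z0"
  have g0: "?g0 \<in> carrier (SL n)" using rep[OF z0] by blast
  obtain W h where W: "openin (Zariski (flag_quotient n k)) W" "coset n k ?g0 \<in> W"
    and h: "\<And>s. s < n \<Longrightarrow> h s \<in> Regular (flag_quotient n k) W"
    and chart: "\<And>g. g \<in> carrier (SL n) \<Longrightarrow> coset n k g \<in> W \<Longrightarrow>
      chart_vec n i ?g0 g (\<lambda>s. h s (coset n k g))"
    using regular_chart[OF i k g0] by blast
  define U where "U = {L \<in> proj_points 3. \<phi> L \<in> W}"
  have z0U: "pt z0 \<in> U" using pt_in_proj_points[OF z0] rep[OF z0] W(2) by (simp add: U_def)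
  have "\<exists>f g e. ev e z0 \<noteq> 0 \<and> (\<forall>z. nz z \<longrightarrow> ev e z \<noteq> 0 \<longrightarrow>
      pt z \<in> U \<and> ev g z \<noteq> 0 \<and> h s (\<phi> (pt z)) = ev f z / ev g z)" if s: "s < n" for s
  proof -
    have "h s \<circ> \<phi> \<in> proj_regular 3 U"
      using mor W(1) h[OF s] by (simp add: variety_morphism_def proj_space_def U_def)
    then show ?thesis by (rule regular_at_point[OF _ z0U]) auto
  qed
  then have "\<forall>s\<in>{..<n}. \<exists>f g e. ev e z0 \<noteq> 0 \<and> (\<forall>z. nz z \<longrightarrow> ev e z \<noteq> 0 \<longrightarrow>
      pt z \<in> U \<and> ev g z \<noteq> 0 \<and> h s (\<phi> (pt z)) = ev f z / ev g z)" by blast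
  from bchoice[OF this] obtain f where "\<forall>s\<in>{..<n}. \<exists>g e. ev e z0 \<noteq> 0 \<and> (\<forall>z. nz z \<longrightarrow> ev e z \<noteq> 0 \<longrightarrow>
      pt z \<in> U \<and> ev g z \<noteq> 0 \<and> h s (\<phi> (pt z)) = ev (f s) z / ev g z)" by blast
  from bchoice[OF this] obtain g where "\<forall>s\<in>{..<n}. \<exists>e. ev e z0 \<noteq> 0 \<and> (\<forall>z. nz z \<longrightarrow> ev e z \<noteq> 0 \<longrightarrow>
      pt z \<in> U \<and> ev (g s) z \<noteq> 0 \<and> h s (\<phi> (pt z)) = ev (f s) z / ev (g s) z)" by blast
  from bchoice[OF this] obtain e where e: "\<And>s. s < n \<Longrightarrow> ev (e s) z0 \<noteq> 0"
    and fg: "\<And>s z. s < n \<Longrightarrow> nz z \<Longrightarrow> ev (e s) z \<noteq> 0 \<Longrightarrow>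
      pt z \<in> U \<and> ev (g s) z \<noteq> 0 \<and> h s (\<phi> (pt z)) = ev (f s) z / ev (g s) z" by auto
  \<comment> \<open>Every \<open>e t\<close> is a factor of every component, so \<open>w\<close>
    vanishes wherever some quotient is not known to be valid and is a section on all of space;
    elsewhere it is \<open>D\<close> times the normalised vector.\<close>
  define w where "w s = f s * e s * (\<Prod>t\<in>{..<n} - {s}. g t * e t)" for s
  define D where "D = (\<Prod>t<n. g t * e t)"
  have w: "ev (w s) z = ev D z * h s (\<phi> (pt z))"
    if s: "s < n" and z: "nz z" "\<And>t. t < n \<Longrightarrow> ev (e t) z \<noteq> 0" for s z
  proof -
    have "D = g s * e s * (\<Prod>t\<in>{..<n} - {s}. g t * e t)"
      unfolding D_def using s by (intro prod.remove) auto
    then show ?thesis using fg[OF s z(1) z(2)[OF s]] by (simp add: w_def del: ev_prod)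
  qed
  have n: "0 < n" using i k by simp
  have inv: "(\<Sum>s<n. adj_mat (rep z) $$ (r, s) * rep z $$ (s, c)) = (if r = c then 1 else 0)"
    if z: "nz z" and rc: "r < n" "c < n" for z r c
  proof -
    have G: "rep z \<in> carrier (SL n)" using rep[OF z] by blast
    have "(\<Sum>s<n. adj_mat (rep z) $$ (r, s) * rep z $$ (s, c)) = (adj_mat (rep z) * rep z) $$ (r, c)"
      using adj_mat_SL(1)[OF G] G rc by (intro mat_mult_index[symmetric]) (auto simp: carrier_SL)
    then show ?thesis using rc by (simp add: adj_mat_SL(3)[OF G])
  qed
  have vanish: "dot n (\<lambda>s. adj_mat (rep z) $$ (r, s)) (\<lambda>s. ev (w s) z) = 0"
    if z: "nz z" and r: "Suc i \<le> r" "r < n" for z r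
  proof (cases "\<forall>t<n. ev (e t) z \<noteq> 0")
    case False
    then obtain t where t: "t < n" "ev (e t) z = 0" by blast
    have "ev (w s) z = 0" for s
    proof (cases "s = t")
      case True
      then show ?thesis using t by (simp add: w_def)
    next
      case False
      then have "(\<Prod>t\<in>{..<n} - {s}. ev (g t * e t) z) = 0" using t by (intro prod_zero) auto
      then show ?thesis by (simp add: w_def)
    qed
    then show ?thesis by simp
  next
    case True
    have G: "rep z \<in> carrier (SL n)" and \<phi>z: "\<phi> (pt z) = coset n k (rep z)" using rep[OF z] by auto
    have "pt z \<in> U" using fg[OF n z] True n by blast
    then have "coset n k (rep z) \<in> W" using \<phi>z by (simp add: U_def)
    from chart[OF G this] obtain d
      where d: "\<And>s. s < n \<Longrightarrow> h s (\<phi> (pt z)) = (\<Sum>c<Suc i. rep z $$ (s, c) * d c)"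
      unfolding chart_vec_def \<phi>z by blast
    have "dot n (\<lambda>s. adj_mat (rep z) $$ (r, s)) (\<lambda>s. ev (w s) z)
        = dot n (\<lambda>s. adj_mat (rep z) $$ (r, s)) (\<lambda>s. \<Sum>c<Suc i. (ev D z * d c) * rep z $$ (s, c))"
      by (intro dot_cong) (simp only: w[OF _ z] True d sum_distrib_left mult_ac simp_thms)
    also have "\<dots> = (\<Sum>c<Suc i. (ev D z * d c) * (\<Sum>s<n. adj_mat (rep z) $$ (r, s) * rep z $$ (s, c)))"
      unfolding dot_sum dot_scale by (simp only: dot_def)
    also have "\<dots> = 0"
      using inv[OF z r(2)] r by (intro sum.neutral) auto
    finally show ?thesis .
  qed
  have "dot n (\<lambda>s. adj_mat ?g0 $$ (i, s)) (\<lambda>s. ev (w s) z0)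
      = dot n (\<lambda>s. adj_mat ?g0 $$ (i, s)) (\<lambda>s. ev D z0 * h s (coset n k ?g0))"
    by (intro dot_cong) (use w[OF _ z0 e] rep[OF z0] in auto)
  also have "\<dots> = ev D z0"
    using chart[OF g0 W(2)] unfolding dot_scale chart_vec_def dot_def by simp
  also have "\<dots> \<noteq> 0" using e fg[OF _ z0 e] by (auto simp: D_def)
  finally show ?thesis using vanish by blast
qed

theorem morphism_constant:
  assumes mor: "variety_morphism (proj_space 3) (flag_quotient n k) \<phi>" and n: "n = k + 2"
  shows "\<phi> constant_on points (proj_space 3)"
proof -
  have k: "k \<le> n" using n by simp
  have points: "points (proj_space 3) = proj_points 3" by (simp add: proj_space_def)
  \<comment> \<open>The choice depends on \<open>pt z\<close> only, so proportional \<open>z\<close>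
    get the same representative and the flag is invariant under homothety.\<close>
  define rep where "rep z = (SOME g. g \<in> carrier (SL n) \<and> \<phi> (pt z) = coset n k g)" for z
  have rep: "rep z \<in> carrier (SL n) \<and> \<phi> (pt z) = coset n k (rep z)" if z: "nz z" for z
  proof -
    have "continuous_map (Zariski (proj_space 3)) (Zariski (flag_quotient n k)) \<phi>"
      using mor unfolding variety_morphism_def by (rule conjunct1)
    from continuous_map_image_subset_topspace[OF this] have "\<phi> (pt z) \<in> points (flag_quotient n k)"
      using pt_in_proj_points[OF z] unfolding points by (rule subsetD[OF _ imageI])
    then have "\<exists>g. g \<in> carrier (SL n) \<and> \<phi> (pt z) = coset n k g"
      unfolding points_SL_quotient LCOSETS_def by (elim UN_E singletonE) blast
    then show ?thesis unfolding rep_def by (rule someI_ex)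
  qed
  \<comment> \<open>Row \<open>r\<close> of the inverse reads off coordinate \<open>r\<close> with
    respect to the columns of \<open>rep z\<close>; vanishing from \<open>i\<close> on means lying
    in the span of the first \<open>i\<close> columns.\<close>
  define H where "H = (\<lambda>z r s. adj_mat (rep z) $$ (r, s))"
  have "flag_map n k H"
  proof (rule flag_map.intro)
    show "k \<le> n" by (rule k)
  next
    fix z s and u :: "nat \<Rightarrow> complex"
    assume z: "nz z" and u: "\<forall>r. 0 \<le> r \<longrightarrow> r < n \<longrightarrow> dot n (H z r) u = 0" and s: "s < n"
    have G: "rep z \<in> carrier (SL n)" using rep[OF z] by blast
    have "u s = (\<Sum>t<n. (if s = t then 1 else 0) * u t)"
      using s by (simp add: if_distrib[of "\<lambda>x. x * _"] cong: if_cong)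
    also have "\<dots> = (\<Sum>t<n. (\<Sum>r<n. rep z $$ (s, r) * adj_mat (rep z) $$ (r, t)) * u t)"
    proof (intro sum.cong refl)
      fix t assume "t \<in> {..<n}"
      then have "(\<Sum>r<n. rep z $$ (s, r) * adj_mat (rep z) $$ (r, t)) = (rep z * adj_mat (rep z)) $$ (s, t)"
        using adj_mat_SL(1)[OF G] G s by (intro mat_mult_index[symmetric]) (auto simp: carrier_SL)
      then show "(if s = t then 1 else 0) * u t
          = (\<Sum>r<n. rep z $$ (s, r) * adj_mat (rep z) $$ (r, t)) * u t"
        using s \<open>t \<in> {..<n}\<close> by (simp add: adj_mat_SL(2)[OF G])
    qed
    also have "\<dots> = (\<Sum>r<n. rep z $$ (s, r) * dot n (H z r) u)"
      unfolding dot_def H_def sum_distrib_left sum_distrib_right mult.assoc by (rule sum.swap)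
    also have "\<dots> = 0" using u by simp
    finally show "u s = 0" .
  next
    fix z and t :: complex and i and u :: "nat \<Rightarrow> complex"
    assume "nz z" "t \<noteq> 0" "i \<le> k"
    then have "rep (\<lambda>l. t * z l) = rep z" unfolding rep_def by (simp add: pt_scale)
    then show "(\<forall>r. i \<le> r \<longrightarrow> r < n \<longrightarrow> dot n (H (\<lambda>l. t * z l) r) u = 0)
        \<longleftrightarrow> (\<forall>r. i \<le> r \<longrightarrow> r < n \<longrightarrow> dot n (H z r) u = 0)" by (simp add: H_def)
  next
    fix z i assume z: "nz z" and i: "i < k"
    have "i < n" using i k by simp
    then show "\<exists>w. (\<forall>z. nz z \<longrightarrow> (\<forall>r. Suc i \<le> r \<longrightarrow> r < n \<longrightarrow> dot n (H z r) (\<lambda>r. ev (w r) z) = 0)) \<and>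
        \<not> (\<forall>r. i \<le> r \<longrightarrow> r < n \<longrightarrow> dot n (H z r) (\<lambda>r. ev (w r) z) = 0)"
      using local_section_exists[OF mor rep i k z] unfolding H_def by blast
  qed
  then interpret F: flag_map n k H "\<lambda>i z u. \<forall>r. i \<le> r \<longrightarrow> r < n \<longrightarrow> dot n (H z r) u = 0"
    by simp_all
  obtain v b where v: "F.adapted k v" and hom: "\<And>j r. j < k \<Longrightarrow> homog (b j) (v j r)"
    using F.homogeneous_adapted_frame by blast
  interpret homog_frame n k v b
    using hom F.adapted_dual[OF v _ k] by unfold_locales blast+
  have const: "ev (v j r) z = ev (v j r) (\<lambda>_. 0)" if "j < k" for j r z
    using hom[OF that, of r] degrees_zero[OF n that] homog_0_const by metis
  have "\<phi> (pt z) = \<phi> (pt z')" if z: "nz z" and z': "nz z'" for z z'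
  proof -
    have G: "rep z \<in> carrier (SL n)" "rep z' \<in> carrier (SL n)" using rep z z' by auto
    have entry: "(adj_mat (rep y) * rep z') $$ (r, c) = dot n (H y r) (\<lambda>s. rep z' $$ (s, c))"
      if "nz y" "r < n" "c < n" for y r c
      unfolding dot_def H_def using adj_mat_SL(1)[of "rep y" n] rep[OF that(1)] G that
      by (intro mat_mult_index) (auto simp: carrier_SL)
    \<comment> \<open>Column \<open>c\<close> of \<open>rep z'\<close> is a combination of the first
      \<open>c + 1\<close> frame vectors. These being constant, it lies in the corresponding flag
      member at \<open>z\<close> too, which gives the triangular shape.\<close>
    have "(adj_mat (rep z) * rep z') $$ (r, c) = 0" if rc: "c < k" "r < n" "c < r" for r c
    proof -
      let ?u = "\<lambda>s. rep z' $$ (s, c)"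
      have vc: "F.adapted (Suc c) v" using v rc(1) by (auto simp: F.adapted_def)
      have "\<forall>r. Suc c \<le> r \<longrightarrow> r < n \<longrightarrow> dot n (H z' r) ?u = 0"
      proof (intro allI impI)
        fix r assume "Suc c \<le> r" "r < n"
        then show "dot n (H z' r) ?u = 0"
          using entry[OF z', of r c] by (simp add: adj_mat_SL(3)[OF G(2)])
      qed
      from F.adapted_span[OF vc z' this] obtain d
        where d: "\<And>s. s < n \<Longrightarrow> ?u s = (\<Sum>j<Suc c. d j * ev (v j s) z')" by blast
      have "\<forall>r. Suc c \<le> r \<longrightarrow> r < n \<longrightarrow> dot n (H z r) (\<lambda>s. \<Sum>j<Suc c. d j * ev (v j s) z) = 0"
        using F.adapted_sect[OF vc _ z] by (intro F.V_sum F.V_scale) auto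
      moreover have "dot n (H z r) ?u = dot n (H z r) (\<lambda>s. \<Sum>j<Suc c. d j * ev (v j s) z)"
      proof (rule dot_cong)
        fix s assume "s < n"
        have "(\<Sum>j<Suc c. d j * ev (v j s) z') = (\<Sum>j<Suc c. d j * ev (v j s) z)"
          using const rc(1) by (intro sum.cong refl) (metis lessThan_iff less_Suc_eq_le order.strict_trans1)
        then show "?u s = (\<Sum>j<Suc c. d j * ev (v j s) z)" using d[OF \<open>s < n\<close>] by simp
      qed
      ultimately show ?thesis using entry[OF z, of r c] rc by simp
    qed
    moreover have "adj_mat (rep z) * rep z' \<in> carrier (SL n)"
      using adj_mat_SL(1)[OF G(1)] G(2) by (auto simp: carrier_SL det_mult)
    ultimately have "adj_mat (rep z) * rep z' \<in> flag_stabilizer n k" by (simp add: flag_stabilizer_def)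
    from coset_eqI[OF G k this] show ?thesis using rep z z' by simp
  qed
  then show ?thesis unfolding constant_on_def points by (metis proj_points_pt)
qed

theorem corollary4p5:
  fixes n :: nat
  assumes "n \<ge> 2"
  shows "\<not> (\<exists>\<phi>. variety_morphism (proj_space 3) (SL_quotient n (minimal_parabolic n (n - 1))) \<phi> \<and>
             \<not> \<phi> constant_on points (proj_space 3))"
proof -
  obtain k where k: "n = k + 2" using assms by (metis add.commute le_Suc_ex)
  then have "minimal_parabolic n (n - 1) = flag_stabilizer n k" by (intro minimal_parabolic_eq) simp
  then show ?thesis using morphism_constant[OF _ k] by auto
qed

end
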